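(* Let $q\in(1/2,1)$, let $\varepsilon>0$, and let $\mathcal{D}\in A_q(R_{\max},R_{\min},r,L)$ be an admissible measure on $\mathbb{R}^d$. Then there is an $\varepsilon$-differentially private algorithm $\mathcal{A}$ which, for input $X=(X_1,\dots,X_n)$ sampled i.i.d. from $\mathcal{D}$, satisfies for all $0<\alpha<\frac{\min\{r,R_{\min}\}}{2}$ that $$\mathbb{P}\left(\|\mathcal{A}(X)-S(F_q(\mathcal{D}))\|_2\le\alpha\right)\ge0.9,$$ for some $$n=\tilde O\left(d^2\frac{(R_{\max}+r)^2}{R_{\min}^2\alpha^2L^2}+d^{2.5}\,\frac{R_{\max}+r}{R_{\min}}\left(\frac{1}{\varepsilon L\alpha}+\frac{1}{\varepsilon L\min\{r,R_{\min}\}}\right)\right),$$ where $S(F_q(\mathcal{D}))$ is the Steiner point of the $q$-floating body of $\mathcal{D}$.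
   Context: **Quantiles, floating body.** $\mathbb{S}^{d-1}$ is the Euclidean unit sphere in $\mathbb{R}^d$. For a real random variable $Y$, $Q_q(Y)=\inf\{t\in\mathbb{R}:\mathbb{P}(Y\le t)\ge q\}$. For a random vector $X\sim\mathcal{D}$ in $\mathbb{R}^d$, the $q$-floating body is $F_q(\mathcal{D})=F_q(X)=\bigcap_{\theta\in\mathbb{S}^{d-1}}\{x\in\mathbb{R}^d:\langle x,\theta\rangle\le Q_q(\langle X,\theta\rangle)\}$. **Steiner point.** For a convex body $K\subset\mathbb{R}^d$ with support function $h_K(\theta)=\max_{x\in K}\langle x,\theta\rangle$, $S(K)=d\int_{\mathbb{S}^{d-1}}\theta\,h_K(\theta)\,d\sigma(\theta)$, where $\sigma$ is the normalized Haar (rotation-invariant probability) measure on $\mathbb{S}^{d-1}$. **Admissible laws.** For $R_{\max},R_{\min},r,L>0$, a distribution $\mathcal{D}$ on $\mathbb{R}^d$ belongs to $A_q(R_{\max},R_{\min},r,L)$ if, for $X\sim\mathcal{D}$: (1) $Q_q(\langle X,\theta\rangle)\in[-R_{\max},R_{\max}]$ for every $\theta\in\mathbb{S}^{d-1}$; (2) for some $c\in\mathbb{R}^d$, $|Q_q(\langle X,\theta\rangle)-\langle c,\theta\rangle|\ge R_{\min}$ for every $\theta\in\mathbb{S}^{d-1}$; (3) for every $\theta\in\mathbb{S}^{d-1}$ the density $f_\theta$ of $\langle X,\theta\rangle$ exists and $f_\theta(t)\ge L$ for all $t\in[Q_q(\langle X,\theta\rangle)-r,Q_q(\langle X,\theta\rangle)+r]$;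 (4) if $X_1,\dots,X_n$ are i.i.d. from $\mathcal{D}$, then with high probability $\|X_i\|_2\le\mathrm{poly}(n,d)$ for all $i\in[n]$. **Privacy.** A randomized algorithm $\mathcal{A}$ on $(\mathbb{R}^d)^n$ is $\varepsilon$-differentially private if for all measurable subsets $S$ of the output space and all $X,X'\in(\mathbb{R}^d)^n$, $\mathbb{P}(\mathcal{A}(X)\in S)\le e^{\varepsilon d_H(X,X')}\mathbb{P}(\mathcal{A}(X')\in S)$, where $d_H(X,X')=|\{i\in[n]:X_i\ne X_i'\}|$. **Asymptotic notation.** $\tilde O$ means that logarithmic factors in all parameters are omitted (as well as multiplicative constants).
   Formalization: For d = 1 the formal statement also assumes R_min ≤ R_max (automatic for d ≥ 2); without it c may lie far outside the body, R_min can be arbitrarily large for a fixed law, and the claimed sample bound tends to 0, so the literal claim fails. *)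

theory Defs
  imports "HOL-Probability.Probability" "HOL-Computational_Algebra.Polynomial"
begin

text \<open>
  The asymptotic constants must not depend on the dimension, so the dimension has to be a number
  that can be quantified inside a formula rather than a type. A point of d-dimensional Euclidean
  space is therefore an extensional function on \<open>{..<d}\<close>, with the product sigma-algebra (the Borel
  sets); the Euclidean norm is \<open>L2_set x {..<d}\<close>.
\<close>

definition euclid :: "nat \<Rightarrow> (nat \<Rightarrow> real) measure" where
  "euclid d = (\<Pi>\<^sub>M i\<in>{..<d}. (borel :: real measure))"

definition ip :: "nat \<Rightarrow> (nat \<Rightarrow> real) \<Rightarrow> (nat \<Rightarrow> real) \<Rightarrow> real" where
  "ip d x y = (\<Sum>i<d. x i * y i)"

definition unit_sphere :: "nat \<Rightarrow> (nat \<Rightarrow> real) set" where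
  "unit_sphere d = {\<theta> \<in> space (euclid d). L2_set \<theta> {..<d} = 1}"

definition orthogonal_mat :: "nat \<Rightarrow> (nat \<Rightarrow> nat \<Rightarrow> real) \<Rightarrow> bool" where
  "orthogonal_mat d U \<longleftrightarrow>
     (\<forall>i<d. \<forall>j<d. (\<Sum>k<d. U k i * U k j) = (if i = j then 1 else 0))"

definition mat_apply :: "nat \<Rightarrow> (nat \<Rightarrow> nat \<Rightarrow> real) \<Rightarrow> (nat \<Rightarrow> real) \<Rightarrow> (nat \<Rightarrow> real)" where
  "mat_apply d U x = (\<lambda>i\<in>{..<d}. \<Sum>j<d. U i j * x j)"

text \<open>
  The normalized Haar measure on the sphere is the unique Borel probability measure invariant under
  the orthogonal group. Invariance is required under the full group O(d): for d = 1 the group SO(d)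
  is trivial and would not determine the measure.
\<close>

definition sphere_haar :: "nat \<Rightarrow> (nat \<Rightarrow> real) measure \<Rightarrow> bool" where
  "sphere_haar d \<sigma> \<longleftrightarrow>
     prob_space \<sigma> \<and>
     sets \<sigma> = sets (restrict_space (euclid d) (unit_sphere d)) \<and>
     (\<forall>U. orthogonal_mat d U \<longrightarrow> distr \<sigma> \<sigma> (mat_apply d U) = \<sigma>)"

definition quantile :: "real \<Rightarrow> real measure \<Rightarrow> real" where
  "quantile q \<mu> = Inf {t. q \<le> cdf \<mu> t}"

definition dir_quantile ::
    "nat \<Rightarrow> real \<Rightarrow> (nat \<Rightarrow> real) measure \<Rightarrow> (nat \<Rightarrow> real) \<Rightarrow> real" where
  "dir_quantile d q D \<theta> = quantile q (distr D borel (\<lambda>x. ip d x \<theta>))"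

definition floating_body :: "nat \<Rightarrow> real \<Rightarrow> (nat \<Rightarrow> real) measure \<Rightarrow> (nat \<Rightarrow> real) set" where
  "floating_body d q D =
     (\<Inter>\<theta>\<in>unit_sphere d. {x \<in> space (euclid d). ip d x \<theta> \<le> dir_quantile d q D \<theta>})"

definition support_fun :: "nat \<Rightarrow> (nat \<Rightarrow> real) set \<Rightarrow> (nat \<Rightarrow> real) \<Rightarrow> real" where
  "support_fun d K \<theta> = (SUP x\<in>K. ip d x \<theta>)"

definition steiner_point ::
    "nat \<Rightarrow> (nat \<Rightarrow> real) measure \<Rightarrow> (nat \<Rightarrow> real) set \<Rightarrow> (nat \<Rightarrow> real)" where
  "steiner_point d \<sigma> K = (\<lambda>i\<in>{..<d}. real d * (\<integral>\<theta>. \<theta> i * support_fun d K \<theta> \<partial>\<sigma>))"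

definition samples :: "nat \<Rightarrow> (nat \<Rightarrow> real) measure \<Rightarrow> (nat \<Rightarrow> nat \<Rightarrow> real) measure" where
  "samples n D = (\<Pi>\<^sub>M i\<in>{..<n}. D)"

text \<open>
  The admissible class. The last condition makes ``with high probability the sample norms are
  at most poly(n,d)'' precise: the norms are bounded by \<open>P (n * d)\<close> for a polynomial \<open>P\<close> (for
  \<open>n, d \<ge> 1\<close> every polynomial in n and d is dominated by one of this form), except with
  probability at most \<open>\<eta> n\<close>, where \<open>\<eta>\<close> is a fixed null sequence. Both \<open>P\<close> and \<open>\<eta>\<close> are
  parameters of the class.

  The condition involving \<open>c\<close> forces \<open>Rmin \<le> Rmax\<close> when \<open>d \<ge> 2\<close> and \<open>q > 1/2\<close>, because the difference
  then has constant sign on the connected sphere. For \<open>d = 1\<close> the point \<open>c\<close> may lie far outside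
  the body and \<open>Rmin\<close> is not controlled by the other conditions, so \<open>Rmin \<le> Rmax\<close> has to be required
  separately in that case.
\<close>

definition admissible ::
    "real poly \<Rightarrow> (nat \<Rightarrow> real) \<Rightarrow> nat \<Rightarrow> real \<Rightarrow> real \<Rightarrow> real \<Rightarrow> real \<Rightarrow> real
      \<Rightarrow> (nat \<Rightarrow> real) measure set" where
  "admissible P \<eta> d q Rmax Rmin r L = {D.
     prob_space D \<and> sets D = sets (euclid d) \<and>
     (\<forall>\<theta>\<in>unit_sphere d. dir_quantile d q D \<theta> \<in> {-Rmax..Rmax}) \<and>
     (\<exists>c\<in>space (euclid d). \<forall>\<theta>\<in>unit_sphere d. Rmin \<le> \<bar>dir_quantile d q D \<theta> - ip d c \<theta>\<bar>) \<and>
     (\<forall>\<theta>\<in>unit_sphere d. \<exists>f.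
        distributed D lborel (\<lambda>x. ip d x \<theta>) f \<and>
        (\<forall>t\<in>{dir_quantile d q D \<theta> - r..dir_quantile d q D \<theta> + r}. ennreal L \<le> f t)) \<and>
     (\<forall>n\<ge>1. 1 - \<eta> n \<le> measure (samples n D)
        {X \<in> space (samples n D). \<forall>i<n. L2_set (X i) {..<d} \<le> poly P (real (n * d))})}"

definition hamming_dist :: "nat \<Rightarrow> (nat \<Rightarrow> 'a) \<Rightarrow> (nat \<Rightarrow> 'a) \<Rightarrow> nat" where
  "hamming_dist n X X' = card {i. i < n \<and> X i \<noteq> X' i}"

text \<open>
  A randomized algorithm on n points is a Markov kernel from data sets to the output space, so
  that its success probability on a random data set is defined.
\<close>

definition diff_private ::
    "real \<Rightarrow> nat \<Rightarrow> nat \<Rightarrow> ((nat \<Rightarrow> nat \<Rightarrow> real) \<Rightarrow> (nat \<Rightarrow> real) measure) \<Rightarrow> bool" where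
  "diff_private \<epsilon> d n A \<longleftrightarrow>
     A \<in> samples n (euclid d) \<rightarrow>\<^sub>M prob_algebra (euclid d) \<and>
     (\<forall>X\<in>space (samples n (euclid d)). \<forall>X'\<in>space (samples n (euclid d)).
        \<forall>S\<in>sets (euclid d).
          measure (A X) S \<le> exp (\<epsilon> * real (hamming_dist n X X')) * measure (A X') S)"

definition success_prob ::
    "nat \<Rightarrow> nat \<Rightarrow> ((nat \<Rightarrow> nat \<Rightarrow> real) \<Rightarrow> (nat \<Rightarrow> real) measure) \<Rightarrow> (nat \<Rightarrow> real) measure
      \<Rightarrow> (nat \<Rightarrow> real) \<Rightarrow> real \<Rightarrow> real" where
  "success_prob d n A D s \<alpha> =
     measure (samples n D \<bind> A) {y \<in> space (euclid d). L2_set (\<lambda>i. y i - s i) {..<d} \<le> \<alpha>}"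

definition main_rate ::
    "nat \<Rightarrow> real \<Rightarrow> real \<Rightarrow> real \<Rightarrow> real \<Rightarrow> real \<Rightarrow> real \<Rightarrow> real" where
  "main_rate d \<epsilon> Rmax Rmin r L \<alpha> =
     real d ^ 2 * ((Rmax + r)^2 / (Rmin^2 * \<alpha>^2 * L^2)) +
     real d powr 2.5 * ((Rmax + r) / Rmin) * (1 / (\<epsilon> * L * \<alpha>) + 1 / (\<epsilon> * L * min r Rmin))"

text \<open>
  The factor hidden by the soft-O notation; the absolute values account for logarithms of both
  large and small parameters.
\<close>

definition polylog :: "nat \<Rightarrow> real list \<Rightarrow> real" where
  "polylog k ps = (\<Prod>p\<leftarrow>ps. 1 + \<bar>ln p\<bar>) ^ k"

end

theory Submission
  imports Defs
begin

text \<open>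
  The estimator is an exponential mechanism whose score compares the data with whole admissible
  laws. A law \<open>D'\<close> of the class fits a data set if, for every direction \<open>\<theta>\<close> of a finite net of the
  sphere, about \<open>q n\<close> of the \<open>n\<close> points lie below the quantile of \<open>D'\<close> in direction \<open>\<theta>\<close>; its score is
  the worst violation, counted in points. Changing one data point changes every such count by at
  most one, so the score is 1-Lipschitz for the Hamming distance on all data sets. Privacy is thus
  unconditional; admissibility enters only in the accuracy.

  The candidate outputs are the cells of a grid of mesh about \<open>\<alpha> / d\<close> that contain the Steiner point
  of the floating body of some admissible law, and the score of a cell is the best score of a law
  with Steiner point in it. There are only about \<open>(d\<^sup>2 Rmax / \<alpha>)^d\<close> cells, so the mechanism
  loses about \<open>d ln (\<dots>) / \<epsilon>\<close> points against the optimal score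
  (\<open>exponential_mechanism_utility\<close>).

  The true law \<open>D\<close> has a small score. By Hoeffding's inequality and a union bound over the net, the
  counts at the quantile of \<open>D\<close> and at distance \<open>s\<close> on either side of it are within \<open>n L s / 4\<close> of their
  means (\<open>concentrated_prob\<close>). Conversely, the density bound moves the distribution function by at
  least \<open>L s\<close> over a distance \<open>s\<close>, so any law with a small score has quantiles within \<open>2 s\<close> of those of
  \<open>D\<close> on the net (\<open>low_score_imp_close\<close>). Because counts are monotone in the threshold, three
  thresholds per direction are enough. The bound extends from the net to the sphere since the quantile
  of an admissible law is almost Lipschitz in the direction (\<open>Q_modulus\<close>): outside an event of
  probability \<open>L s / 2\<close> the norm of a sample is polynomially bounded, by the tail condition of the
  class (\<open>norm_tail\<close>).

  Finally, uniformly \<open>t\<close>-close quantiles give support functions of the floating bodies that are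
  \<open>2 Rmax t / Rmin\<close>-close, because each body contains a point at margin \<open>Rmin\<close> from all its supporting
  constraints (\<open>center\<close>, \<open>body_absorbs\<close>; for \<open>d = 1\<close> the support function is the quantile itself); and the Steiner point is \<open>sqrt d\<close>-Lipschitz in the
  support function, because \<open>\<integral>\<langle>v, \<theta>\<rangle>\<^sup>2 d\<sigma> = \<parallel>v\<parallel>\<^sup>2 / d\<close> (\<open>sphere_moment_lipschitz\<close>). With
  \<open>s = \<alpha> Rmin / (16 sqrt d Rmax)\<close> the total error is at most \<open>\<alpha>\<close>. The sampling requirement
  \<open>n L\<^sup>2 s\<^sup>2 \<ge> const d ln (\<dots>)\<close> is the first term of the rate, and the privacy requirement
  \<open>\<epsilon> n L s \<ge> const d ln (\<dots>)\<close> is of order \<open>d^(3/2) Rmax / (\<epsilon> L \<alpha> Rmin)\<close>, below the second term.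
\<close>

section \<open>Grids, the sphere and half-spaces\<close>

definition grid_cell :: "nat \<Rightarrow> real \<Rightarrow> (nat \<Rightarrow> real) \<Rightarrow> nat \<Rightarrow> int" where
  "grid_cell d h x = (\<lambda>i\<in>{..<d}. \<lfloor>x i / h\<rfloor>)"

text \<open>
  Rounding replaces covering numbers: both the net of the sphere and the set of candidate outputs have
  at most \<open>(2 B / h + 2) ^ d\<close> elements, whose logarithm is \<open>d\<close> up to logarithmic factors.
\<close>
lemma grid_cells_finite_card:
  assumes h: "0 < h" and B: "0 \<le> B" "\<And>x i. x \<in> K \<Longrightarrow> i < d \<Longrightarrow> \<bar>x i\<bar> \<le> B"
  shows "finite (grid_cell d h ` K)" "real (card (grid_cell d h ` K)) \<le> (2 * B / h + 2) ^ d"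
proof -
  let ?I = "{\<lfloor>- B / h\<rfloor>..\<lfloor>B / h\<rfloor>}"
  let ?P = "{..<d} \<rightarrow>\<^sub>E ?I"
  have sub: "grid_cell d h ` K \<subseteq> ?P"
  proof (clarsimp simp: grid_cell_def)
    fix x i assume "x \<in> K" "i < d"
    then have "- B \<le> x i" "x i \<le> B" using B(2)[of x i] by auto
    then show "\<lfloor>- (B / h)\<rfloor> \<le> \<lfloor>x i / h\<rfloor> \<and> \<lfloor>x i / h\<rfloor> \<le> \<lfloor>B / h\<rfloor>"
      using h by (intro conjI floor_mono) (auto simp: field_simps)
  qed
  have fin: "finite ?P" by (intro finite_PiE) auto
  show "finite (grid_cell d h ` K)" using sub fin by (rule finite_subset)
  have "0 \<le> B / h" using h B by simp
  then have "real (card ?I) \<le> 2 * B / h + 2"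
    by simp linarith
  then have "real (card ?I) ^ d \<le> (2 * B / h + 2) ^ d"
    by (intro power_mono) auto
  moreover have "card (grid_cell d h ` K) \<le> card ?P" using sub fin by (intro card_mono)
  moreover have "card ?P = card ?I ^ d" by (simp add: card_PiE)
  ultimately show "real (card (grid_cell d h ` K)) \<le> (2 * B / h + 2) ^ d"
    by (metis (mono_tags, lifting) of_nat_le_iff of_nat_power order_trans)
qed

lemma grid_cell_close:
  assumes "0 < h" "grid_cell d h x = grid_cell d h y" "i < d"
  shows "\<bar>x i - y i\<bar> \<le> h"
proof -
  have "\<lfloor>x i / h\<rfloor> = \<lfloor>y i / h\<rfloor>"
    using fun_cong[OF assms(2), of i] assms(3) by (simp add: grid_cell_def)
  then have "\<bar>x i / h - y i / h\<bar> \<le> 1" by linarith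
  then have "\<bar>x i - y i\<bar> / h \<le> 1"
    using assms(1) by (simp flip: diff_divide_distrib)
  then show ?thesis using assms(1) by simp
qed

lemma finite_grid_net:
  fixes K :: "(nat \<Rightarrow> real) set"
  assumes h: "0 < h" and B: "0 \<le> B" "\<And>x i. x \<in> K \<Longrightarrow> i < d \<Longrightarrow> \<bar>x i\<bar> \<le> B"
  obtains T where "finite T" "T \<subseteq> K" "real (card T) \<le> (2 * B / h + 2) ^ d"
    "\<And>x. x \<in> K \<Longrightarrow> \<exists>y\<in>T. \<forall>i<d. \<bar>x i - y i\<bar> \<le> h"
proof
  let ?c = "grid_cell d h"
  let ?T = "inv_into K ?c ` ?c ` K"
  have cells: "finite (?c ` K)" "real (card (?c ` K)) \<le> (2 * B / h + 2) ^ d"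
    by (rule grid_cells_finite_card[of h B K d]; use h B in simp)+
  show "finite ?T" using cells by auto
  show "?T \<subseteq> K" by (auto intro: inv_into_into)
  show "real (card ?T) \<le> (2 * B / h + 2) ^ d"
    using card_image_le[OF cells(1), of "inv_into K ?c"] cells(2) by linarith
  show "\<exists>y\<in>?T. \<forall>i<d. \<bar>x i - y i\<bar> \<le> h" if "x \<in> K" for x
  proof (intro bexI allI impI)
    show "\<bar>x i - inv_into K ?c (?c x) i\<bar> \<le> h" if "i < d" for i
      using f_inv_into_f[of "?c x" ?c K] \<open>x \<in> K\<close> by (intro grid_cell_close[OF h _ that]) auto
  qed (use that in auto)
qed

lemma abs_coord_le_L2: "i < (d::nat) \<Longrightarrow> \<bar>x i\<bar> \<le> L2_set x {..<d}"
  using member_le_L2_set[of "{..<d}" i "\<lambda>i. \<bar>x i\<bar>"] by (simp add: L2_set_def)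

lemma L2_le_of_coords: "(\<And>i. i < d \<Longrightarrow> \<bar>x i\<bar> \<le> h) \<Longrightarrow> L2_set x {..<d} \<le> real d * h"
proof -
  assume h: "\<And>i. i < d \<Longrightarrow> \<bar>x i\<bar> \<le> h"
  have "L2_set x {..<d} \<le> (\<Sum>i<d. \<bar>x i\<bar>)" by (rule L2_set_le_sum_abs)
  also have "\<dots> \<le> (\<Sum>i<d. h)" using h by (intro sum_mono) auto
  finally show ?thesis by simp
qed

lemma sphere_coord_le: "\<theta> \<in> unit_sphere d \<Longrightarrow> i < d \<Longrightarrow> \<bar>\<theta> i\<bar> \<le> 1"
  using abs_coord_le_L2[of i d \<theta>] by (simp add: unit_sphere_def)

lemma sphere_sum_squares: "\<theta> \<in> unit_sphere d \<Longrightarrow> (\<Sum>i<d. (\<theta> i)\<^sup>2) = 1"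
  by (simp add: unit_sphere_def L2_set_def)

lemma unit_sphereI: "\<theta> \<in> extensional {..<d} \<Longrightarrow> (\<Sum>i<d. (\<theta> i)\<^sup>2) = 1 \<Longrightarrow> \<theta> \<in> unit_sphere d"
  by (simp add: unit_sphere_def euclid_def space_PiM L2_set_def PiE_def)

lemma space_euclid: "space (euclid d) = extensional {..<d}"
  by (simp add: euclid_def space_PiM PiE_def)

definition antipode :: "nat \<Rightarrow> (nat \<Rightarrow> real) \<Rightarrow> nat \<Rightarrow> real" where
  "antipode d \<theta> = (\<lambda>i\<in>{..<d}. - \<theta> i)"

lemma antipode_sphere: "\<theta> \<in> unit_sphere d \<Longrightarrow> antipode d \<theta> \<in> unit_sphere d"
  by (rule unit_sphereI) (simp_all add: antipode_def sphere_sum_squares)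

lemma ip_antipode [simp]: "ip d x (antipode d \<theta>) = - ip d x \<theta>"
  by (simp add: ip_def antipode_def sum_negf)

lemma basis_vector_sphere: "i < d \<Longrightarrow> (\<lambda>k\<in>{..<d}. if k = i then 1 else 0) \<in> unit_sphere d"
proof (rule unit_sphereI)
  assume "i < d"
  have "(\<Sum>k<d. ((\<lambda>k\<in>{..<d}. if k = i then 1 else 0) k)\<^sup>2) = (\<Sum>k<d. if k = i then 1 else (0::real))"
    by (rule sum.cong) auto
  then show "(\<Sum>k<d. ((\<lambda>k\<in>{..<d}. if k = i then 1 else 0) k)\<^sup>2) = (1::real)" using \<open>i < d\<close> by simp
qed auto

text \<open>
  A suitable vector is supported on two coordinates \<open>i\<close>, \<open>j\<close> with \<open>\<theta> i \<noteq> 0\<close>: swap them and change one sign.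
\<close>
lemma orthogonal_unit_vector:
  assumes d: "2 \<le> d" and \<theta>: "\<theta> \<in> unit_sphere d"
  obtains e where "e \<in> unit_sphere d" "ip d \<theta> e = 0"
proof -
  have "\<exists>i<d. \<theta> i \<noteq> 0"
  proof (rule ccontr)
    assume "\<not> (\<exists>i<d. \<theta> i \<noteq> 0)"
    then have "(\<Sum>i<d. (\<theta> i)\<^sup>2) = 0" by simp
    then show False using sphere_sum_squares[OF \<theta>] by simp
  qed
  then obtain i where i: "i < d" "\<theta> i \<noteq> 0" by blast
  obtain j where j: "j < d" "j \<noteq> i"
    using d i by (metis Suc_1 Suc_le_lessD lessI less_trans_Suc not_less_eq numeral_2_eq_2 zero_less_Suc)
  define c where "c = sqrt ((\<theta> i)\<^sup>2 + (\<theta> j)\<^sup>2)"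
  have c2: "c\<^sup>2 = (\<theta> i)\<^sup>2 + (\<theta> j)\<^sup>2" unfolding c_def by simp
  then have c: "c \<noteq> 0" using i by (metis add_nonneg_eq_0_iff power_eq_0_iff zero_le_power2 zero_less_numeral)
  define e where "e = (\<lambda>k\<in>{..<d}. if k = i then \<theta> j / c else if k = j then - \<theta> i / c else 0)"
  have split: "(\<Sum>k<d. f k) = f i + f j" if "\<And>k. k < d \<Longrightarrow> k \<noteq> i \<Longrightarrow> k \<noteq> j \<Longrightarrow> f k = 0" for f :: "nat \<Rightarrow> real"
  proof -
    have "(\<Sum>k<d. f k) = (\<Sum>k\<in>{i, j}. f k)"
      using i j that by (intro sum.mono_neutral_right) auto
    then show ?thesis using j by simp
  qed
  have "(\<Sum>k<d. (e k)\<^sup>2) = (e i)\<^sup>2 + (e j)\<^sup>2" by (rule split) (simp add: e_def)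
  also have "\<dots> = 1" using i j c c2 by (simp add: e_def power_divide flip: add_divide_distrib)
  finally have "e \<in> unit_sphere d" by (intro unit_sphereI) (simp_all add: e_def)
  moreover have "ip d \<theta> e = \<theta> i * e i + \<theta> j * e j"
    unfolding ip_def by (rule split) (simp add: e_def)
  then have "ip d \<theta> e = 0" using i j by (simp add: e_def)
  ultimately show ?thesis by (rule that)
qed

text \<open>
  For \<open>t\<close> from \<open>0\<close> to \<open>pi\<close> this curve joins \<open>\<theta>\<close> to its antipode inside the sphere, which is all of the
  connectedness of the sphere that is needed below.
\<close>
lemma great_circle_sphere:
  assumes "\<theta> \<in> unit_sphere d" "e \<in> unit_sphere d" "ip d \<theta> e = 0"
  shows "(\<lambda>k\<in>{..<d}. cos t * \<theta> k + sin t * e k) \<in> unit_sphere d"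
proof (rule unit_sphereI)
  have "(\<Sum>k<d. ((\<lambda>k\<in>{..<d}. cos t * \<theta> k + sin t * e k) k)\<^sup>2)
      = (\<Sum>k<d. (cos t)\<^sup>2 * (\<theta> k)\<^sup>2 + (sin t)\<^sup>2 * (e k)\<^sup>2 + 2 * cos t * sin t * (\<theta> k * e k))"
    by (rule sum.cong) (simp_all add: power2_eq_square algebra_simps)
  also have "\<dots> = (cos t)\<^sup>2 * 1 + (sin t)\<^sup>2 * 1 + 2 * cos t * sin t * ip d \<theta> e"
    unfolding sum.distrib ip_def sum_distrib_left[symmetric]
    using sphere_sum_squares[OF assms(1)] sphere_sum_squares[OF assms(2)] by simp
  also have "\<dots> = 1" using assms(3) by simp
  finally show "(\<Sum>k<d. ((\<lambda>k\<in>{..<d}. cos t * \<theta> k + sin t * e k) k)\<^sup>2) = 1" .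
qed simp

lemma ip_measurable [measurable]: "(\<lambda>x. ip d x \<theta>) \<in> borel_measurable (euclid d)"
  unfolding ip_def euclid_def by measurable

lemma ip_diff_le: "\<bar>ip d x \<theta> - ip d x \<theta>'\<bar> \<le> L2_set x {..<d} * L2_set (\<lambda>i. \<theta> i - \<theta>' i) {..<d}"
proof -
  have "ip d x \<theta> - ip d x \<theta>' = (\<Sum>i<d. x i * (\<theta> i - \<theta>' i))"
    by (simp add: ip_def right_diff_distrib sum_subtractf)
  also have "\<bar>\<dots>\<bar> \<le> (\<Sum>i<d. \<bar>x i\<bar> * \<bar>\<theta> i - \<theta>' i\<bar>)"
    by (rule order_trans[OF sum_abs]) (simp add: abs_mult)
  also have "\<dots> \<le> L2_set x {..<d} * L2_set (\<lambda>i. \<theta> i - \<theta>' i) {..<d}"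
    by (rule L2_set_mult_ineq)
  finally show ?thesis .
qed

lemma norm_measurable [measurable]: "(\<lambda>x. L2_set x {..<d}) \<in> borel_measurable (euclid d)"
  unfolding L2_set_def euclid_def by measurable

lemma L2_ball_sets: "{y \<in> space (euclid d). L2_set (\<lambda>i. y i - z i) {..<d} \<le> \<alpha>} \<in> sets (euclid d)"
proof -
  have [measurable]: "(\<lambda>y. y i) \<in> borel_measurable (euclid d)" if "i < d" for i
    using that by (simp add: euclid_def)
  show ?thesis unfolding L2_set_def by measurable
qed

section \<open>Directional quantiles of an admissible law\<close>

text \<open>
  Right continuity of the distribution function makes the infimum in the definition of the quantile
  attained; everything below about quantiles rests on this equivalence.
\<close>
lemma (in real_distribution) cdf_ge_quantile_iff:
  assumes "0 < q" "q < 1"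
  shows "quantile q M \<le> t \<longleftrightarrow> q \<le> cdf M t"
proof -
  let ?A = "{t. q \<le> cdf M t}"
  have "eventually (\<lambda>t. q < cdf M t) at_top"
    using cdf_lim_at_top_prob assms(2) by (rule order_tendstoD)
  then obtain t1 where t1: "q < cdf M t1"
    by (metis eventually_at_top_linorder order_refl)
  have "eventually (\<lambda>t. cdf M t < q) at_bot"
    using cdf_lim_at_bot assms(1) by (rule order_tendstoD)
  then obtain t0 where t0: "cdf M t0 < q"
    by (metis eventually_at_bot_linorder order_refl)
  have bdd: "bdd_below ?A"
    by (rule bdd_belowI[of _ t0]) (use t0 cdf_nondecreasing in \<open>smt (verit) mem_Collect_eq\<close>)
  have up: "q \<le> cdf M t" if "quantile q M < t" for t
  proof -
    have "t1 \<in> ?A" using t1 by simp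
    then have "?A \<noteq> {}" by force
    moreover have "Inf ?A < t" using that by (simp add: quantile_def)
    ultimately obtain u where "u \<in> ?A" "u < t"
      using cInf_lessD by metis
    then show ?thesis using cdf_nondecreasing[of u t] by simp
  qed
  have "q \<le> cdf M (quantile q M)"
  proof (rule tendsto_lowerbound)
    show "(cdf M \<longlongrightarrow> cdf M (quantile q M)) (at_right (quantile q M))"
      using cdf_is_right_cont by (simp add: continuous_within)
    show "\<forall>\<^sub>F x in at_right (quantile q M). q \<le> cdf M x"
      using up by (auto simp: eventually_at_filter)
  qed auto
  then have "q \<le> cdf M t" if "quantile q M \<le> t"
    using that cdf_nondecreasing[OF that] by simp
  moreover have "quantile q M \<le> t" if "q \<le> cdf M t"
    unfolding quantile_def using that bdd by (intro cInf_lower) auto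
  ultimately show ?thesis by blast
qed

lemma (in real_distribution) cdf_quantile_eq:
  assumes "0 < q" "q < 1" "measure M {quantile q M} = 0"
  shows "cdf M (quantile q M) = q"
proof -
  let ?Q = "quantile q M"
  have "isCont (cdf M) ?Q" using assms(3) by (simp add: isCont_cdf)
  then have "(cdf M \<longlongrightarrow> cdf M ?Q) (at_left ?Q)"
    by (metis isCont_def filterlim_at_split)
  moreover have "\<forall>\<^sub>F x in at_left ?Q. cdf M x \<le> q"
    using cdf_ge_quantile_iff[OF assms(1,2)]
    by (auto simp: eventually_at_filter not_le[symmetric])
  ultimately have "cdf M ?Q \<le> q" by (rule tendsto_upperbound) simp
  then show ?thesis using cdf_ge_quantile_iff[OF assms(1,2), of ?Q] by simp
qed

lemma density_measure_Ioc_ge: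
  fixes f :: "real \<Rightarrow> ennreal"
  assumes f: "f \<in> borel_measurable borel" and prob: "prob_space (density lborel f)"
    and lo: "\<And>t. t \<in> {a<..b} \<Longrightarrow> ennreal L \<le> f t" and "a \<le> b" "0 \<le> L"
  shows "L * (b - a) \<le> measure (density lborel f) {a<..b}"
proof -
  interpret prob_space "density lborel f" by fact
  have "ennreal (L * (b - a)) = (\<integral>\<^sup>+x. ennreal L * indicator {a<..b} x \<partial>lborel)"
    using assms by (simp add: nn_integral_cmult_indicator ennreal_mult)
  also have "\<dots> \<le> (\<integral>\<^sup>+x. f x * indicator {a<..b} x \<partial>lborel)"
    using lo by (intro nn_integral_mono) (auto simp: indicator_def)
  also have "\<dots> = emeasure (density lborel f) {a<..b}"
    using f by (simp add: emeasure_density)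
  also have "\<dots> = ennreal (measure (density lborel f) {a<..b})"
    by (simp add: emeasure_eq_measure)
  finally show ?thesis by (simp add: ennreal_le_iff)
qed

lemma admissibleD:
  assumes "D \<in> admissible P \<eta> d q Rmax Rmin r L"
  shows "prob_space D" "sets D = sets (euclid d)"
    "\<forall>\<theta>\<in>unit_sphere d. dir_quantile d q D \<theta> \<in> {-Rmax..Rmax}"
    "\<exists>c\<in>space (euclid d). \<forall>\<theta>\<in>unit_sphere d. Rmin \<le> \<bar>dir_quantile d q D \<theta> - ip d c \<theta>\<bar>"
    "\<forall>\<theta>\<in>unit_sphere d. \<exists>f. distributed D lborel (\<lambda>x. ip d x \<theta>) f \<and>
        (\<forall>t\<in>{dir_quantile d q D \<theta> - r..dir_quantile d q D \<theta> + r}. ennreal L \<le> f t)"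
    "\<forall>n\<ge>1. 1 - \<eta> n \<le> measure (samples n D)
        {X \<in> space (samples n D). \<forall>i<n. L2_set (X i) {..<d} \<le> poly P (real (n * d))}"
  by (insert assms, unfold admissible_def mem_Collect_eq, (elim conjE, assumption)+)

locale admissible_law =
  fixes P \<eta> d q Rmax Rmin r L D
  assumes adm: "D \<in> admissible P \<eta> d q Rmax Rmin r L"
    and q: "1/2 < q" "q < 1" and pos: "0 < d" "0 < Rmax" "0 < Rmin" "0 < r" "0 < L"
begin

lemma sets_D [measurable_cong]: "sets D = sets (euclid d)"
  by (rule admissibleD(2)[OF adm])

lemma space_D: "space D = space (euclid d)"
  using sets_D by (rule sets_eq_imp_space_eq)

sublocale prob_space D
  by (rule admissibleD(1)[OF adm])

abbreviation Q :: "(nat \<Rightarrow> real) \<Rightarrow> real" where "Q \<equiv> dir_quantile d q D"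

definition proj_cdf :: "(nat \<Rightarrow> real) \<Rightarrow> real \<Rightarrow> real" where
  "proj_cdf \<theta> t = prob {x \<in> space (euclid d). ip d x \<theta> \<le> t}"

lemma half_space_sets [measurable]: "{x \<in> space (euclid d). ip d x \<theta> \<le> t} \<in> sets D"
  unfolding sets_D by measurable

lemma cdf_projection: "cdf (distr D borel (\<lambda>x. ip d x \<theta>)) t = proj_cdf \<theta> t"
  unfolding cdf_def proj_cdf_def
  by (subst measure_distr) (auto simp: space_D vimage_def Int_def conj_commute)

lemma real_distribution_projection: "real_distribution (distr D borel (\<lambda>x. ip d x \<theta>))"
  by (rule real_distribution_distr) measurable

lemma Q_le_iff: "Q \<theta> \<le> t \<longleftrightarrow> q \<le> proj_cdf \<theta> t"
  unfolding dir_quantile_def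
  using real_distribution.cdf_ge_quantile_iff[OF real_distribution_projection, of q] q
  by (simp add: cdf_projection)

lemma Q_bounds: "\<theta> \<in> unit_sphere d \<Longrightarrow> \<bar>Q \<theta>\<bar> \<le> Rmax"
  using admissibleD(3)[OF adm] by (auto simp: abs_le_iff)

lemma density_ex:
  assumes "\<theta> \<in> unit_sphere d"
  obtains f :: "real \<Rightarrow> ennreal" where "f \<in> borel_measurable borel"
    "distr D borel (\<lambda>x. ip d x \<theta>) = density lborel f"
    "\<forall>t\<in>{Q \<theta> - r..Q \<theta> + r}. ennreal L \<le> f t"
proof -
  obtain f where f: "distributed D lborel (\<lambda>x. ip d x \<theta>) f"
    "\<forall>t\<in>{Q \<theta> - r..Q \<theta> + r}. ennreal L \<le> f t"
    using admissibleD(5)[OF adm] assms by blast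
  have "distr D borel (\<lambda>x. ip d x \<theta>) = distr D lborel (\<lambda>x. ip d x \<theta>)"
    by (rule distr_cong) auto
  then show ?thesis using f that[of f] unfolding distributed_def by auto
qed

text \<open>
  The existence of a density excludes an atom at the quantile. Equality here is what keeps the
  count at the true quantile from exceeding \<open>q n\<close> by more than the sampling error.
\<close>
lemma proj_cdf_at_Q:
  assumes "\<theta> \<in> unit_sphere d"
  shows "proj_cdf \<theta> (Q \<theta>) = q"
proof -
  obtain f :: "real \<Rightarrow> ennreal" where f: "f \<in> borel_measurable borel" "distr D borel (\<lambda>x. ip d x \<theta>) = density lborel f"
    using density_ex[OF assms] by metis
  interpret R: real_distribution "distr D borel (\<lambda>x. ip d x \<theta>)"
    by (rule real_distribution_projection)
  have "emeasure (density lborel f) {Q \<theta>} = (\<integral>\<^sup>+x. f x * indicator {Q \<theta>} x \<partial>lborel)"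
    using f by (subst emeasure_density) auto
  also have "\<dots> = 0"
    by (subst nn_integral_0_iff_AE) (use f AE_lborel_singleton[of "Q \<theta>"] in \<open>auto elim!: eventually_mono simp: indicator_def\<close>)
  finally have "measure (distr D borel (\<lambda>x. ip d x \<theta>)) {Q \<theta>} = 0"
    unfolding f(2) by (simp add: measure_def)
  then show ?thesis
    using R.cdf_quantile_eq[of q] q by (simp add: cdf_projection dir_quantile_def)
qed

text \<open>
  The density bound in integrated form: near the quantile the distribution function grows at rate \<open>L\<close>,
  so an error in probability translates into an error in position at most \<open>1 / L\<close> times as large.
\<close>
lemma proj_cdf_increment:
  assumes \<theta>: "\<theta> \<in> unit_sphere d" and ab: "Q \<theta> - r \<le> a" "a \<le> b" "b \<le> Q \<theta> + r"
  shows "proj_cdf \<theta> a + L * (b - a) \<le> proj_cdf \<theta> b"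
proof -
  obtain f :: "real \<Rightarrow> ennreal" where f: "f \<in> borel_measurable borel" "distr D borel (\<lambda>x. ip d x \<theta>) = density lborel f"
    "\<forall>t\<in>{Q \<theta> - r..Q \<theta> + r}. ennreal L \<le> f t"
    using density_ex[OF \<theta>] by metis
  interpret R: real_distribution "distr D borel (\<lambda>x. ip d x \<theta>)"
    by (rule real_distribution_projection)
  have "L * (b - a) \<le> measure (density lborel f) {a<..b}"
  proof (rule density_measure_Ioc_ge[OF f(1)])
    show "prob_space (density lborel f)"
      using R.prob_space_axioms unfolding f(2) .
    show "ennreal L \<le> f t" if "t \<in> {a<..b}" for t
      using f(3) ab that by simp
  qed (use ab pos in simp_all)
  also have "\<dots> = proj_cdf \<theta> b - proj_cdf \<theta> a"
  proof (cases "a = b")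
    case False
    then show ?thesis
      using ab R.cdf_diff_eq[of a b] unfolding f(2)[symmetric] cdf_projection by simp
  qed simp
  finally show ?thesis by simp
qed

lemma proj_cdf_above_Q: "\<theta> \<in> unit_sphere d \<Longrightarrow> 0 \<le> s \<Longrightarrow> s \<le> r \<Longrightarrow> q + L * s \<le> proj_cdf \<theta> (Q \<theta> + s)"
  using proj_cdf_increment[of \<theta> "Q \<theta>" "Q \<theta> + s"] by (simp add: proj_cdf_at_Q)

lemma proj_cdf_below_Q: "\<theta> \<in> unit_sphere d \<Longrightarrow> 0 \<le> s \<Longrightarrow> s \<le> r \<Longrightarrow> proj_cdf \<theta> (Q \<theta> - s) \<le> q - L * s"
  using proj_cdf_increment[of \<theta> "Q \<theta> - s" "Q \<theta>"] by (simp add: proj_cdf_at_Q)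

text \<open>
  The mass of the interval of radius \<open>r\<close> around a quantile is at most one. It follows
  that the claimed rate is at least one.
\<close>
lemma L_r_le: "2 * L * r \<le> 1"
proof -
  let ?e = "\<lambda>k\<in>{..<d}. if k = 0 then 1 else (0::real)"
  have "?e \<in> unit_sphere d" by (rule basis_vector_sphere[OF pos(1)])
  then have "proj_cdf ?e (Q ?e - r) + L * (2 * r) \<le> proj_cdf ?e (Q ?e + r)"
    using proj_cdf_increment[of ?e "Q ?e - r" "Q ?e + r"] pos by simp
  moreover have "0 \<le> proj_cdf ?e (Q ?e - r)" "proj_cdf ?e (Q ?e + r) \<le> 1" unfolding proj_cdf_def by auto
  ultimately show ?thesis by simp
qed

text \<open>
  Turning the direction by \<open>\<delta>\<close> moves the projection of a point of norm at most \<open>M\<close> by at most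
  \<open>M \<delta> \<le> s / 2\<close>. Half of the step \<open>s\<close> makes up for this shift; over the other half the distribution function
  gains \<open>L s / 2\<close>, which makes up for the points of norm larger than \<open>M\<close>.
\<close>
lemma Q_modulus_one_sided:
  assumes \<theta>: "\<theta> \<in> unit_sphere d" 
    and \<delta>: "L2_set (\<lambda>i. \<theta>' i - \<theta> i) {..<d} \<le> \<delta>" and s: "2 * M * \<delta> \<le> s" "0 < s" "s \<le> r" and "0 \<le> M"
    and tail: "prob {x \<in> space (euclid d). M < L2_set x {..<d}} \<le> L * s / 2"
  shows "Q \<theta>' \<le> Q \<theta> + s"
proof -
  let ?T = "{x \<in> space (euclid d). M < L2_set x {..<d}}"
  have T: "?T \<in> sets D" unfolding sets_D by measurable
  have "q + L * (s / 2) \<le> proj_cdf \<theta> (Q \<theta> + s / 2)"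
    using s \<theta> by (intro proj_cdf_above_Q) auto
  also have "\<dots> \<le> prob ({x \<in> space (euclid d). ip d x \<theta>' \<le> Q \<theta> + s} \<union> ?T)"
    unfolding proj_cdf_def
  proof (intro finite_measure_mono subsetI)
    fix x assume x: "x \<in> {x \<in> space (euclid d). ip d x \<theta> \<le> Q \<theta> + s / 2}"
    show "x \<in> {x \<in> space (euclid d). ip d x \<theta>' \<le> Q \<theta> + s} \<union> ?T"
    proof (cases "M < L2_set x {..<d}")
      case False
      have "L2_set x {..<d} * L2_set (\<lambda>i. \<theta>' i - \<theta> i) {..<d} \<le> M * \<delta>"
        using False \<delta> \<open>0 \<le> M\<close> by (intro mult_mono) auto
      then have "ip d x \<theta>' \<le> ip d x \<theta> + s / 2"
        using ip_diff_le[of d x \<theta>' \<theta>] s by linarith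
      then show ?thesis using x by auto
    qed (use x in auto)
  qed (use T in auto)
  also have "\<dots> \<le> proj_cdf \<theta>' (Q \<theta> + s) + prob ?T"
    unfolding proj_cdf_def using T by (intro measure_Un_le) auto
  finally have "q \<le> proj_cdf \<theta>' (Q \<theta> + s)" using tail by simp
  then show ?thesis by (simp add: Q_le_iff)
qed

lemma Q_modulus:
  assumes "\<theta> \<in> unit_sphere d" "\<theta>' \<in> unit_sphere d"
    and \<delta>: "L2_set (\<lambda>i. \<theta>' i - \<theta> i) {..<d} \<le> \<delta>" and s: "2 * M * \<delta> \<le> s" "0 < s" "s \<le> r" and "0 \<le> M"
    and tail: "prob {x \<in> space (euclid d). M < L2_set x {..<d}} \<le> L * s / 2"
  shows "\<bar>Q \<theta>' - Q \<theta>\<bar> \<le> s"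
proof -
  have "L2_set (\<lambda>i. \<theta> i - \<theta>' i) {..<d} \<le> \<delta>"
    using \<delta> by (simp add: L2_set_def power2_commute)
  then show ?thesis
    using Q_modulus_one_sided[of \<theta> \<theta>' \<delta> M s] Q_modulus_one_sided[of \<theta>' \<theta> \<delta> M s] assms by simp
qed

end

section \<open>Support functions and moments of the Haar measure\<close>

lemma ip_coord_diff_le:
  assumes "\<And>i. i < d \<Longrightarrow> \<bar>x i - y i\<bar> \<le> h"
  shows "ip d x \<theta> \<le> ip d y \<theta> + h * (\<Sum>i<d. \<bar>\<theta> i\<bar>)"
proof -
  have "ip d x \<theta> - ip d y \<theta> = (\<Sum>i<d. (x i - y i) * \<theta> i)"
    by (simp add: ip_def left_diff_distrib sum_subtractf)
  also have "\<dots> \<le> (\<Sum>i<d. h * \<bar>\<theta> i\<bar>)"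
  proof (rule sum_mono)
    fix i assume "i \<in> {..<d}"
    then have "\<bar>x i - y i\<bar> * \<bar>\<theta> i\<bar> \<le> h * \<bar>\<theta> i\<bar>" using assms by (intro mult_right_mono) auto
    then show "(x i - y i) * \<theta> i \<le> h * \<bar>\<theta> i\<bar>" by (simp add: abs_mult[symmetric])
  qed
  finally show ?thesis by (simp add: sum_distrib_left)
qed

lemma ip_le_of_coords:
  assumes "\<And>i. i < d \<Longrightarrow> \<bar>x i\<bar> \<le> B"
  shows "ip d x \<theta> \<le> B * (\<Sum>i<d. \<bar>\<theta> i\<bar>)"
  using ip_coord_diff_le[of d x "\<lambda>_. 0" B \<theta>] assms by (simp add: ip_def)

text \<open>
  A union of grid nets of mesh \<open>1 / (m + 1)\<close> is a countable dense subset, over which the supremum is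
  the same.
\<close>
lemma support_fun_measurable:
  assumes K: "K \<noteq> {}" and B: "0 \<le> B" "\<And>x i. x \<in> K \<Longrightarrow> i < d \<Longrightarrow> \<bar>x i\<bar> \<le> B"
  shows "support_fun d K \<in> borel_measurable (euclid d)"
proof -
  have "\<exists>T. finite T \<and> T \<subseteq> K \<and> (\<forall>x\<in>K. \<exists>y\<in>T. \<forall>i<d. \<bar>x i - y i\<bar> \<le> 1 / real (Suc m))" for m
    by (rule finite_grid_net[of "1 / real (Suc m)" B K d]) (use B in auto)
  then obtain T where T: "\<And>m. finite (T m)" "\<And>m. T m \<subseteq> K"
    "\<And>m x. x \<in> K \<Longrightarrow> \<exists>y\<in>T m. \<forall>i<d. \<bar>x i - y i\<bar> \<le> 1 / real (Suc m)"
    by metis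
  define K0 where "K0 = (\<Union>m. T m)"
  have K0: "countable K0" "K0 \<subseteq> K" using T by (auto simp: K0_def intro: countable_finite)
  have "K0 \<noteq> {}" using T(3)[of _ 0] K by (auto simp: K0_def)
  have bdd: "bdd_above ((\<lambda>x. ip d x \<theta>) ` K)" for \<theta>
    by (rule bdd_aboveI[of _ "B * (\<Sum>i<d. \<bar>\<theta> i\<bar>)"]) (use ip_le_of_coords B in auto)
  have bdd0: "bdd_above ((\<lambda>x. ip d x \<theta>) ` K0)" for \<theta>
    using bdd K0(2) by (meson bdd_above_mono image_mono)
  have eq: "support_fun d K \<theta> = (SUP x\<in>K0. ip d x \<theta>)" for \<theta>
    unfolding support_fun_def
  proof (rule antisym)
    show "(SUP x\<in>K0. ip d x \<theta>) \<le> (SUP x\<in>K. ip d x \<theta>)"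
      using \<open>K0 \<noteq> {}\<close> bdd K0(2) by (intro cSUP_subset_mono) auto
    show "(SUP x\<in>K. ip d x \<theta>) \<le> (SUP x\<in>K0. ip d x \<theta>)"
    proof (intro cSUP_least K)
      fix x assume x: "x \<in> K"
      show "ip d x \<theta> \<le> (SUP x\<in>K0. ip d x \<theta>)"
      proof (rule field_le_epsilon)
        fix e :: real assume "0 < e"
        define c where "c = (\<Sum>i<d. \<bar>\<theta> i\<bar>)"
        have "0 \<le> c" by (auto simp: c_def sum_nonneg)
        obtain m where m: "c / e < real m" using reals_Archimedean2 by blast
        obtain y where y: "y \<in> T m" "\<forall>i<d. \<bar>x i - y i\<bar> \<le> 1 / real (Suc m)"
          using T(3)[OF x] by blast
        have "ip d x \<theta> \<le> ip d y \<theta> + 1 / real (Suc m) * c"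
          unfolding c_def using y by (intro ip_coord_diff_le) auto
        also have "1 / real (Suc m) * c \<le> e"
          using m \<open>0 < e\<close> \<open>0 \<le> c\<close> by (simp add: field_simps)
        also have "ip d y \<theta> \<le> (SUP x\<in>K0. ip d x \<theta>)"
          using y bdd0 by (intro cSUP_upper) (auto simp: K0_def)
        finally show "ip d x \<theta> \<le> (SUP x\<in>K0. ip d x \<theta>) + e" by simp
      qed
    qed
  qed
  have "(\<lambda>\<theta>. SUP x\<in>K0. ip d x \<theta>) \<in> borel_measurable (euclid d)"
  proof (rule borel_measurable_cSUP[OF K0(1)])
    show "(\<lambda>\<theta>. ip d x \<theta>) \<in> borel_measurable (euclid d)" for x
      unfolding ip_def euclid_def by measurable
  qed (use bdd0 in auto)
  then show ?thesis using eq by presburger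
qed

lemma mat_apply_sphere:
  assumes U: "orthogonal_mat d U" and \<theta>: "\<theta> \<in> unit_sphere d"
  shows "mat_apply d U \<theta> \<in> unit_sphere d"
proof (rule unit_sphereI)
  show "mat_apply d U \<theta> \<in> extensional {..<d}" by (simp add: mat_apply_def)
  have "(\<Sum>k<d. (mat_apply d U \<theta> k)\<^sup>2) = (\<Sum>k<d. \<Sum>i<d. \<Sum>j<d. \<theta> i * \<theta> j * (U k i * U k j))"
    by (intro sum.cong refl) (simp add: mat_apply_def power2_eq_square sum_product mult_ac)
  also have "\<dots> = (\<Sum>i<d. \<Sum>k<d. \<Sum>j<d. \<theta> i * \<theta> j * (U k i * U k j))"
    by (rule sum.swap)
  also have "\<dots> = (\<Sum>i<d. \<Sum>j<d. \<Sum>k<d. \<theta> i * \<theta> j * (U k i * U k j))"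
    by (rule sum.cong[OF refl], rule sum.swap)
  also have "\<dots> = (\<Sum>i<d. \<Sum>j<d. \<theta> i * \<theta> j * (if i = j then 1 else 0))"
    using U by (intro sum.cong refl) (simp add: orthogonal_mat_def flip: sum_distrib_left)
  also have "\<dots> = (\<Sum>i<d. \<theta> i * \<theta> i)"
    by (intro sum.cong refl) (simp add: if_distrib[of "\<lambda>x. _ * x"] cong: if_cong)
  also have "\<dots> = 1" using sphere_sum_squares[OF \<theta>] by (simp add: power2_eq_square)
  finally show "(\<Sum>k<d. (mat_apply d U \<theta> k)\<^sup>2) = 1" .
qed

locale haar_sphere =
  fixes d :: nat and \<sigma> :: "(nat \<Rightarrow> real) measure"
  assumes haar: "sphere_haar d \<sigma>" and d: "0 < d"
begin

sublocale prob_space \<sigma> using haar by (simp add: sphere_haar_def)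

lemma sets_\<sigma>: "sets \<sigma> = sets (restrict_space (euclid d) (unit_sphere d))"
  using haar by (simp add: sphere_haar_def)

lemma space_\<sigma>: "space \<sigma> = unit_sphere d"
  using sets_eq_imp_space_eq[OF sets_\<sigma>] by (auto simp: space_restrict_space unit_sphere_def)

lemma measurable_from_euclid: "f \<in> euclid d \<rightarrow>\<^sub>M N \<Longrightarrow> f \<in> \<sigma> \<rightarrow>\<^sub>M N"
  using measurable_restrict_space1 measurable_cong_sets[OF sets_\<sigma> refl, of N] by auto

lemma coord_measurable [measurable]: "i < d \<Longrightarrow> (\<lambda>\<theta>. \<theta> i) \<in> borel_measurable \<sigma>"
  by (intro measurable_from_euclid) (simp add: euclid_def)

lemma mat_apply_measurable:
  assumes U: "orthogonal_mat d U"
  shows "mat_apply d U \<in> \<sigma> \<rightarrow>\<^sub>M \<sigma>"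
proof -
  have "mat_apply d U \<in> \<sigma> \<rightarrow>\<^sub>M restrict_space (euclid d) (unit_sphere d)"
  proof (rule measurable_restrict_space2)
    show "mat_apply d U \<in> space \<sigma> \<rightarrow> unit_sphere d"
      using mat_apply_sphere[OF U] by (simp add: space_\<sigma>)
    have "(\<lambda>x. \<lambda>i\<in>{..<d}. \<Sum>j<d. U i j * x j) \<in> \<sigma> \<rightarrow>\<^sub>M euclid d"
      unfolding euclid_def by (intro measurable_restrict borel_measurable_sum) simp
    then show "mat_apply d U \<in> \<sigma> \<rightarrow>\<^sub>M euclid d"
      by (simp add: mat_apply_def[abs_def])
  qed
  then show ?thesis using measurable_cong_sets[OF refl sets_\<sigma>] by blast
qed

lemma integral_mat_apply:
  fixes f :: "(nat \<Rightarrow> real) \<Rightarrow> real"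
  assumes "orthogonal_mat d U" "f \<in> borel_measurable \<sigma>"
  shows "(\<integral>\<theta>. f (mat_apply d U \<theta>) \<partial>\<sigma>) = (\<integral>\<theta>. f \<theta> \<partial>\<sigma>)"
proof -
  have "distr \<sigma> \<sigma> (mat_apply d U) = \<sigma>" using haar assms(1) by (simp add: sphere_haar_def)
  then show ?thesis
    using integral_distr[OF mat_apply_measurable[OF assms(1)] assms(2)] by simp
qed

lemma integrable_bounded:
  fixes f :: "(nat \<Rightarrow> real) \<Rightarrow> real"
  assumes "f \<in> borel_measurable \<sigma>" "\<And>\<theta>. \<theta> \<in> unit_sphere d \<Longrightarrow> \<bar>f \<theta>\<bar> \<le> B"
  shows "integrable \<sigma> f"
  by (rule integrable_const_bound[of _ B]) (use assms in \<open>auto simp: space_\<sigma>\<close>)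

lemma abs_integral_le:
  fixes f :: "(nat \<Rightarrow> real) \<Rightarrow> real"
  assumes "f \<in> borel_measurable \<sigma>" "\<And>\<theta>. \<theta> \<in> unit_sphere d \<Longrightarrow> \<bar>f \<theta>\<bar> \<le> B"
  shows "\<bar>\<integral>\<theta>. f \<theta> \<partial>\<sigma>\<bar> \<le> B"
proof -
  have "\<bar>\<integral>\<theta>. f \<theta> \<partial>\<sigma>\<bar> \<le> (\<integral>\<theta>. \<bar>f \<theta>\<bar> \<partial>\<sigma>)"
    by (rule integral_abs_bound)
  also have "\<dots> \<le> (\<integral>\<theta>. B \<partial>\<sigma>)"
    using assms integrable_bounded[OF assms] by (intro integral_mono) (auto simp: space_\<sigma>)
  finally show ?thesis by (simp add: prob_space)
qed

lemma coord_prod_integrable: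
  assumes "i < d" "j < d"
  shows "integrable \<sigma> (\<lambda>\<theta>. \<theta> i * \<theta> j)"
proof (rule integrable_bounded[of _ 1])
  show "\<bar>\<theta> i * \<theta> j\<bar> \<le> 1" if "\<theta> \<in> unit_sphere d" for \<theta>
    using sphere_coord_le[OF that] assms unfolding abs_mult by (intro mult_le_one) auto
qed (use assms in measurable)

text \<open>
  Reflecting the \<open>i\<close>-th coordinate changes the sign of the integrand.
\<close>
lemma mixed_moment:
  assumes ij: "i < d" "j < d" "i \<noteq> j"
  shows "(\<integral>\<theta>. \<theta> i * \<theta> j \<partial>\<sigma>) = 0"
proof -
  define U :: "nat \<Rightarrow> nat \<Rightarrow> real" where "U = (\<lambda>k l. if k = l then (if k = i then -1 else 1) else 0)"
  have U: "orthogonal_mat d U"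
    unfolding orthogonal_mat_def
  proof (intro allI impI)
    fix a b assume "a < d" "b < d"
    have "(\<Sum>k<d. U k a * U k b) = (\<Sum>k<d. if k = a then (if a = b then 1 else 0) else 0)"
      by (intro sum.cong) (auto simp: U_def)
    then show "(\<Sum>k<d. U k a * U k b) = (if a = b then 1 else 0)" using \<open>a < d\<close> by simp
  qed
  have app: "mat_apply d U \<theta> k = (if k = i then - \<theta> k else \<theta> k)" if "k < d" for k \<theta>
  proof -
    have "(\<Sum>l<d. U k l * \<theta> l) = (\<Sum>l<d. if l = k then (if k = i then - \<theta> k else \<theta> k) else 0)"
      by (intro sum.cong) (auto simp: U_def)
    then show ?thesis using that by (simp add: mat_apply_def)
  qed
  have "(\<integral>\<theta>. \<theta> i * \<theta> j \<partial>\<sigma>) = (\<integral>\<theta>. mat_apply d U \<theta> i * mat_apply d U \<theta> j \<partial>\<sigma>)"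
    using U ij by (intro integral_mat_apply[symmetric]) auto
  also have "\<dots> = (\<integral>\<theta>. - (\<theta> i * \<theta> j) \<partial>\<sigma>)" using ij by (simp add: app)
  finally show ?thesis by simp
qed

text \<open>
  Swapping coordinates shows that all second moments agree, and they add up to one on the sphere.
\<close>
lemma second_moment:
  assumes "i < d"
  shows "(\<integral>\<theta>. \<theta> i * \<theta> i \<partial>\<sigma>) = 1 / real d"
proof -
  have eq: "(\<integral>\<theta>. \<theta> j * \<theta> j \<partial>\<sigma>) = (\<integral>\<theta>. \<theta> i * \<theta> i \<partial>\<sigma>)" if j: "j < d" for j
  proof -
    define \<pi> where "\<pi> = (\<lambda>k. if k = i then j else if k = j then i else k)"
    have \<pi>: "\<pi> (\<pi> k) = k" "k < d \<Longrightarrow> \<pi> k < d" for k using j assms by (auto simp: \<pi>_def)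
    define U :: "nat \<Rightarrow> nat \<Rightarrow> real" where "U = (\<lambda>k l. if k = \<pi> l then 1 else 0)"
    have U: "orthogonal_mat d U"
      unfolding orthogonal_mat_def
    proof (intro allI impI)
      fix a b assume "a < d" "b < d"
      have "(\<Sum>k<d. U k a * U k b) = (\<Sum>k<d. if k = \<pi> a then (if a = b then 1 else 0) else 0)"
        using \<pi>(1) by (intro sum.cong) (auto simp: U_def, metis)
      then show "(\<Sum>k<d. U k a * U k b) = (if a = b then 1 else 0)" using \<pi>(2)[OF \<open>a < d\<close>] by simp
    qed
    have app: "mat_apply d U \<theta> k = \<theta> (\<pi> k)" if "k < d" for k \<theta>
    proof -
      have "(\<Sum>l<d. U k l * \<theta> l) = (\<Sum>l<d. if l = \<pi> k then \<theta> (\<pi> k) else 0)"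
        using \<pi>(1) by (intro sum.cong) (auto simp: U_def)
      then show ?thesis using that \<pi>(2) by (simp add: mat_apply_def)
    qed
    have "(\<integral>\<theta>. \<theta> i * \<theta> i \<partial>\<sigma>) = (\<integral>\<theta>. mat_apply d U \<theta> i * mat_apply d U \<theta> i \<partial>\<sigma>)"
      using U assms by (intro integral_mat_apply[symmetric]) auto
    also have "\<dots> = (\<integral>\<theta>. \<theta> j * \<theta> j \<partial>\<sigma>)" using assms by (simp add: app) (simp add: \<pi>_def)
    finally show ?thesis by simp
  qed
  have "1 = (\<integral>\<theta>. (1::real) \<partial>\<sigma>)" by (simp add: prob_space)
  also have "\<dots> = (\<integral>\<theta>. (\<Sum>j<d. \<theta> j * \<theta> j) \<partial>\<sigma>)"
    using sphere_sum_squares by (intro Bochner_Integration.integral_cong refl) (simp add: space_\<sigma> power2_eq_square)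
  also have "\<dots> = (\<Sum>j<d. \<integral>\<theta>. \<theta> j * \<theta> j \<partial>\<sigma>)"
    by (intro Bochner_Integration.integral_sum coord_prod_integrable) auto
  also have "\<dots> = real d * (\<integral>\<theta>. \<theta> i * \<theta> i \<partial>\<sigma>)" using eq by simp
  finally show ?thesis using d by (simp add: field_simps)
qed

lemma projection_second_moment:
  "integrable \<sigma> (\<lambda>\<theta>. (ip d v \<theta>)\<^sup>2)" "(\<integral>\<theta>. (ip d v \<theta>)\<^sup>2 \<partial>\<sigma>) = (L2_set v {..<d})\<^sup>2 / real d"
proof -
  have eq: "(ip d v \<theta>)\<^sup>2 = (\<Sum>i<d. \<Sum>j<d. v i * v j * (\<theta> i * \<theta> j))" for \<theta>
    by (simp add: ip_def power2_eq_square sum_product mult_ac)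
  show "integrable \<sigma> (\<lambda>\<theta>. (ip d v \<theta>)\<^sup>2)"
    unfolding eq by (intro Bochner_Integration.integrable_sum integrable_mult_right coord_prod_integrable) auto
  have "(\<integral>\<theta>. (ip d v \<theta>)\<^sup>2 \<partial>\<sigma>) = (\<Sum>i<d. \<Sum>j<d. v i * v j * (\<integral>\<theta>. \<theta> i * \<theta> j \<partial>\<sigma>))"
    unfolding eq
    by (subst Bochner_Integration.integral_sum)
       (auto intro!: Bochner_Integration.integrable_sum integrable_mult_right coord_prod_integrable sum.cong
         simp: Bochner_Integration.integral_sum coord_prod_integrable)
  also have "\<dots> = (\<Sum>i<d. \<Sum>j<d. if j = i then v i * v i / real d else 0)"
    by (intro sum.cong refl) (auto simp: mixed_moment second_moment)
  also have "\<dots> = (L2_set v {..<d})\<^sup>2 / real d"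
    by (simp add: L2_set_def sum_nonneg power2_eq_square sum_divide_distrib)
  finally show "(\<integral>\<theta>. (ip d v \<theta>)\<^sup>2 \<partial>\<sigma>) = (L2_set v {..<d})\<^sup>2 / real d" .
qed

text \<open>
  Pair the difference \<open>v\<close> of the two vectors with itself. This gives
  \<open>\<parallel>v\<parallel>\<^sup>2 = d \<integral>\<langle>v, \<theta>\<rangle> (h - h') d\<sigma> \<le> d H \<integral>\<bar>\<langle>v, \<theta>\<rangle>\<bar> d\<sigma>\<close>, and by Cauchy-Schwarz the last integral is at most
  \<open>\<parallel>v\<parallel> / sqrt d\<close>. Bounding \<open>\<bar>\<langle>v, \<theta>\<rangle>\<bar>\<close> by one instead would lose a factor \<open>sqrt d\<close>.
\<close>
lemma sphere_moment_lipschitz: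
  fixes h h' :: "(nat \<Rightarrow> real) \<Rightarrow> real"
  assumes meas: "h \<in> borel_measurable \<sigma>" "h' \<in> borel_measurable \<sigma>"
    and bound: "\<And>\<theta>. \<theta> \<in> unit_sphere d \<Longrightarrow> \<bar>h \<theta>\<bar> \<le> B" "\<And>\<theta>. \<theta> \<in> unit_sphere d \<Longrightarrow> \<bar>h' \<theta>\<bar> \<le> B"
    and close: "\<And>\<theta>. \<theta> \<in> unit_sphere d \<Longrightarrow> \<bar>h \<theta> - h' \<theta>\<bar> \<le> H" and "0 \<le> H"
  shows "L2_set (\<lambda>i. real d * (\<integral>\<theta>. \<theta> i * h \<theta> \<partial>\<sigma>) - real d * (\<integral>\<theta>. \<theta> i * h' \<theta> \<partial>\<sigma>)) {..<d} \<le> sqrt (real d) * H"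
proof -
  define v where "v = (\<lambda>i. real d * (\<integral>\<theta>. \<theta> i * h \<theta> \<partial>\<sigma>) - real d * (\<integral>\<theta>. \<theta> i * h' \<theta> \<partial>\<sigma>))"
  define w where "w = L2_set v {..<d}"
  have int: "integrable \<sigma> (\<lambda>\<theta>. \<theta> i * f \<theta>)"
    if "i < d" "f \<in> borel_measurable \<sigma>" "\<And>\<theta>. \<theta> \<in> unit_sphere d \<Longrightarrow> \<bar>f \<theta>\<bar> \<le> C" for i f C
  proof (rule integrable_bounded[of _ "1 * C"])
    show "\<bar>\<theta> i * f \<theta>\<bar> \<le> 1 * C" if "\<theta> \<in> unit_sphere d" for \<theta>
      unfolding abs_mult using sphere_coord_le[OF that] \<open>i < d\<close> that \<open>\<And>\<theta>. \<theta> \<in> unit_sphere d \<Longrightarrow> \<bar>f \<theta>\<bar> \<le> C\<close>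
      by (intro mult_mono) auto
  qed (use that in measurable)
  have v: "v i = real d * (\<integral>\<theta>. \<theta> i * (h \<theta> - h' \<theta>) \<partial>\<sigma>)" if "i < d" for i
    using int[OF that meas(1) bound(1)] int[OF that meas(2) bound(2)]
    by (simp add: v_def right_diff_distrib)
  have meas_diff: "(\<lambda>\<theta>. h \<theta> - h' \<theta>) \<in> borel_measurable \<sigma>" using meas by measurable
  have int_diff: "integrable \<sigma> (\<lambda>\<theta>. \<theta> i * (h \<theta> - h' \<theta>))" if "i < d" for i
    using that meas_diff close by (rule int)
  have ip_meas: "(\<lambda>\<theta>. ip d v \<theta>) \<in> borel_measurable \<sigma>" unfolding ip_def by measurable
  show ?thesis
  proof (cases "w = 0")
    case True
    then show ?thesis using \<open>0 \<le> H\<close> by (simp add: w_def v_def)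
  next
    case False
    then have w: "0 < w" using L2_set_nonneg[of v "{..<d}"] unfolding w_def by linarith
    \<comment> \<open>Cauchy-Schwarz in the form \<open>2 \<bar>a\<bar> \<le> c + a\<^sup>2 / c\<close>, with the optimal \<open>c\<close>.\<close>
    define c where "c = w / sqrt (real d)"
    have c: "0 < c" using w d by (simp add: c_def)
    have "w\<^sup>2 = (\<Sum>i<d. v i * v i)"
      by (simp add: w_def L2_set_def sum_nonneg power2_eq_square)
    also have "\<dots> = (\<Sum>i<d. real d * (\<integral>\<theta>. v i * (\<theta> i * (h \<theta> - h' \<theta>)) \<partial>\<sigma>))"
      by (intro sum.cong refl) (simp add: v)
    also have "\<dots> = real d * (\<integral>\<theta>. (\<Sum>i<d. v i * (\<theta> i * (h \<theta> - h' \<theta>))) \<partial>\<sigma>)"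
      using int_diff by (subst Bochner_Integration.integral_sum) (auto simp: sum_distrib_left)
    also have "(\<integral>\<theta>. (\<Sum>i<d. v i * (\<theta> i * (h \<theta> - h' \<theta>))) \<partial>\<sigma>) \<le> (\<integral>\<theta>. H / 2 * (c + (ip d v \<theta>)\<^sup>2 / c) \<partial>\<sigma>)"
    proof (rule integral_mono)
      show "integrable \<sigma> (\<lambda>\<theta>. \<Sum>i<d. v i * (\<theta> i * (h \<theta> - h' \<theta>)))"
        using int_diff by (intro Bochner_Integration.integrable_sum integrable_mult_right) auto
      show "integrable \<sigma> (\<lambda>\<theta>. H / 2 * (c + (ip d v \<theta>)\<^sup>2 / c))"
        using projection_second_moment(1)[of v] by auto
      fix \<theta> assume "\<theta> \<in> space \<sigma>"
      then have \<theta>: "\<theta> \<in> unit_sphere d" by (simp add: space_\<sigma>)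
      have "(\<Sum>i<d. v i * (\<theta> i * (h \<theta> - h' \<theta>))) = ip d v \<theta> * (h \<theta> - h' \<theta>)"
        by (simp add: ip_def sum_distrib_left sum_distrib_right mult_ac)
      also have "\<dots> \<le> \<bar>ip d v \<theta>\<bar> * \<bar>h \<theta> - h' \<theta>\<bar>"
        by (metis abs_ge_self abs_mult)
      also have "\<dots> \<le> \<bar>ip d v \<theta>\<bar> * H" using close[OF \<theta>] by (intro mult_left_mono) auto
      also have "\<bar>ip d v \<theta>\<bar> \<le> (c + (ip d v \<theta>)\<^sup>2 / c) / 2"
      proof -
        have "0 \<le> (\<bar>ip d v \<theta>\<bar> - c)\<^sup>2" by simp
        then show ?thesis using c by (simp add: field_simps power2_eq_square)
      qed
      finally show "(\<Sum>i<d. v i * (\<theta> i * (h \<theta> - h' \<theta>))) \<le> H / 2 * (c + (ip d v \<theta>)\<^sup>2 / c)"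
        using \<open>0 \<le> H\<close> by (simp add: mult_right_mono mult.commute)
    qed
    also have "(\<integral>\<theta>. H / 2 * (c + (ip d v \<theta>)\<^sup>2 / c) \<partial>\<sigma>) = H / 2 * (c + w\<^sup>2 / real d / c)"
      using projection_second_moment[of v] by (simp add: w_def prob_space)
    also have "w\<^sup>2 / real d / c = c"
      using w d by (simp add: c_def power2_eq_square real_div_sqrt field_simps)
    also have "real d * (H / 2 * (c + c)) = w * (sqrt (real d) * H)"
      using d by (simp add: c_def real_div_sqrt field_simps)
    finally have "w * w \<le> w * (sqrt (real d) * H)" by (simp add: power2_eq_square mult_left_mono)
    then show ?thesis using w by (simp add: w_def v_def)
  qed
qed

end

section \<open>Empirical counts and the exponential mechanism\<close>

lemma sets_samples:
  assumes "sets D = sets E"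
  shows "sets (samples n D) = sets (samples n E)"
  unfolding samples_def by (rule sets_PiM_cong) (use assms in auto)

lemma prob_space_samples: "prob_space D \<Longrightarrow> prob_space (samples n D)"
  unfolding samples_def by (rule prob_space_PiM)

lemma indep_vars_samples:
  assumes "prob_space D" "0 < n"
  shows "prob_space.indep_vars (samples n D) (\<lambda>_. D) (\<lambda>i X. X i) {..<n}"
proof -
  interpret S: prob_space "samples n D" using assms by (intro prob_space_samples)
  have comp: "(\<lambda>X. X i) \<in> samples n D \<rightarrow>\<^sub>M D" if "i < n" for i
    unfolding samples_def using that by (intro measurable_component_singleton) auto
  have "distr (samples n D) (\<Pi>\<^sub>M i\<in>{..<n}. D) (\<lambda>X. \<lambda>i\<in>{..<n}. X i) = distr (samples n D) (samples n D) (\<lambda>X. X)"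
    by (rule distr_cong) (auto simp: samples_def space_PiM)
  also have "\<dots> = (\<Pi>\<^sub>M i\<in>{..<n}. distr (samples n D) D (\<lambda>X. X i))"
    unfolding distr_id unfolding samples_def
    by (intro PiM_cong refl) (use assms in \<open>auto intro!: distr_PiM_component[symmetric]\<close>)
  finally show ?thesis
    using assms comp by (subst S.indep_vars_iff_distr_eq_PiM') auto
qed

lemma empirical_count_concentration:
  assumes D: "prob_space D" and B: "B \<in> sets D" and n: "0 < n" and \<tau>: "0 \<le> \<tau>"
  shows "measure (samples n D)
      {X \<in> space (samples n D). real n * \<tau> \<le> \<bar>real (card {i. i < n \<and> X i \<in> B}) - real n * measure D B\<bar>}
    \<le> 2 * exp (- 2 * real n * \<tau>\<^sup>2)"
proof -
  interpret D: prob_space D by fact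
  interpret S: prob_space "samples n D" using D by (intro prob_space_samples)
  have comp: "(\<lambda>X. X i) \<in> samples n D \<rightarrow>\<^sub>M D" if "i < n" for i
    unfolding samples_def using that by (intro measurable_component_singleton) auto
  have distr: "distr (samples n D) D (\<lambda>X. X i) = D" if "i < n" for i
    unfolding samples_def using that D by (intro distr_PiM_component) auto
  have indep: "S.indep_vars (\<lambda>_. borel) (\<lambda>i X. indicator B (X i) :: real) {..<n}"
    using indep_vars_samples[OF D n] by (rule S.indep_vars_compose2) (use B in auto)
  have expect: "S.expectation (\<lambda>X. indicator B (X i) :: real) = measure D B" if "i < n" for i
  proof -
    have "S.expectation (\<lambda>X. indicator B (X i)) = integral\<^sup>L (distr (samples n D) D (\<lambda>X. X i)) (indicator B :: _ \<Rightarrow> real)"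
      using comp[OF that] B by (subst integral_distr) auto
    also have "\<dots> = measure D B" unfolding distr[OF that] using B by simp
    finally show ?thesis .
  qed
  interpret H: Hoeffding_ineq "samples n D" "{..<n}" "\<lambda>i X. indicator B (X i)" "\<lambda>_. 0" "\<lambda>_. 1" "real n * measure D B"
    by unfold_locales (use indep expect in auto)
  have "(\<Sum>i<n. indicator B (X i)) = real (card {i. i < n \<and> X i \<in> B})" for X
    by (simp add: indicator_def sum.If_cases) (rule arg_cong[where f=card], auto)
  moreover have "- 2 * (real n * \<tau>)\<^sup>2 / real n = - 2 * real n * \<tau>\<^sup>2"
    using n by (simp add: power2_eq_square)
  ultimately show ?thesis
    using H.Hoeffding_ineq_abs_ge[of "real n * \<tau>"] n \<tau> by simp
qed

definition halfspace_count :: "nat \<Rightarrow> nat \<Rightarrow> (nat \<Rightarrow> nat \<Rightarrow> real) \<Rightarrow> (nat \<Rightarrow> real) \<Rightarrow> real \<Rightarrow> real" where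
  "halfspace_count n d X \<theta> t = real (card {i. i < n \<and> ip d (X i) \<theta> \<le> t})"

lemma halfspace_count_mono: "s \<le> t \<Longrightarrow> halfspace_count n d X \<theta> s \<le> halfspace_count n d X \<theta> t"
  unfolding halfspace_count_def of_nat_le_iff by (rule card_mono) auto

lemma halfspace_count_measurable [measurable]:
  "(\<lambda>X. halfspace_count n d X \<theta> t) \<in> borel_measurable (samples n (euclid d))"
proof -
  have "halfspace_count n d X \<theta> t = (\<Sum>i<n. indicator {x. ip d x \<theta> \<le> t} (X i))" for X
    by (simp add: halfspace_count_def indicator_def sum.If_cases) (rule arg_cong[where f=card], auto)
  moreover have "(\<lambda>X. (\<Sum>i<n. indicator {x. ip d x \<theta> \<le> t} (X i)) :: real) \<in> borel_measurable (samples n (euclid d))"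
  proof (rule borel_measurable_sum)
    fix i assume "i \<in> {..<n}"
    then have [measurable]: "(\<lambda>X. X i) \<in> samples n (euclid d) \<rightarrow>\<^sub>M euclid d"
      unfolding samples_def by (intro measurable_component_singleton)
    have "(\<lambda>X. indicator {x. ip d x \<theta> \<le> t} (X i)) = (\<lambda>X. if ip d (X i) \<theta> \<le> t then 1 else (0::real))"
      by (auto simp: indicator_def)
    then show "(\<lambda>X. indicator {x. ip d x \<theta> \<le> t} (X i) :: real) \<in> borel_measurable (samples n (euclid d))"
      by simp
  qed
  ultimately show ?thesis by simp
qed

text \<open>
  The source of privacy: one data point contributes at most one to every count.
\<close>
lemma halfspace_count_lipschitz:
  "\<bar>halfspace_count n d X \<theta> t - halfspace_count n d X' \<theta> t\<bar> \<le> real (hamming_dist n X X')"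
proof -
  have le: "halfspace_count n d X \<theta> t \<le> halfspace_count n d X' \<theta> t + real (hamming_dist n X X')" for X X'
  proof -
    have "card {i. i < n \<and> ip d (X i) \<theta> \<le> t}
        \<le> card ({i. i < n \<and> ip d (X' i) \<theta> \<le> t} \<union> {i. i < n \<and> X i \<noteq> X' i})"
      by (rule card_mono) auto
    also have "\<dots> \<le> card {i. i < n \<and> ip d (X' i) \<theta> \<le> t} + card {i. i < n \<and> X i \<noteq> X' i}"
      by (rule card_Un_le)
    finally show ?thesis unfolding halfspace_count_def hamming_dist_def by linarith
  qed
  have "hamming_dist n X' X = hamming_dist n X X'"
    unfolding hamming_dist_def by (rule arg_cong[where f=card]) auto
  then show ?thesis using le[of X X'] le[of X' X] by linarith
qed

lemma Max_image_le_shift: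
  fixes f g :: "'a \<Rightarrow> real"
  assumes "finite A" "A \<noteq> {}" "\<And>a. a \<in> A \<Longrightarrow> f a \<le> g a + c"
  shows "Max (f ` A) \<le> Max (g ` A) + c"
  using assms by (subst Max_le_iff) (auto intro: order_trans[OF assms(3)])

lemma Min_image_le_shift:
  fixes f g :: "'a \<Rightarrow> real"
  assumes "finite A" "A \<noteq> {}" "\<And>a. a \<in> A \<Longrightarrow> f a \<le> g a + c"
  shows "Min (f ` A) \<le> Min (g ` A) + c"
proof -
  have "Min (g ` A) \<in> g ` A" using assms(1,2) by (intro Min_in) auto
  then obtain a where a: "a \<in> A" "Min (g ` A) = g a" by auto
  have "Min (f ` A) \<le> f a" using a assms by simp
  then show ?thesis using assms(3)[OF a(1)] a by linarith
qed

text \<open>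
  Low scores are good. The factor \<open>1/2\<close> makes the mechanism \<open>\<epsilon>\<close>-private for 1-Lipschitz scores, because
  both the weight and the normalizing sum change.
\<close>
definition exponential_mechanism ::
    "real \<Rightarrow> 'j set \<Rightarrow> ('j \<Rightarrow> 'x \<Rightarrow> real) \<Rightarrow> ('j \<Rightarrow> 'y) \<Rightarrow> 'y measure \<Rightarrow> 'x \<Rightarrow> 'y measure" where
  "exponential_mechanism \<epsilon> J u y E X =
     distr (density (count_space J)
       (\<lambda>j. ennreal (exp (- \<epsilon> / 2 * u j X) / (\<Sum>i\<in>J. exp (- \<epsilon> / 2 * u i X))))) E y"

context
  fixes \<epsilon> :: real and J :: "'j set" and u :: "'j \<Rightarrow> 'x \<Rightarrow> real" and y :: "'j \<Rightarrow> 'y" and E :: "'y measure"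
  assumes J: "finite J" "J \<noteq> {}" and y: "\<And>j. j \<in> J \<Longrightarrow> y j \<in> space E" and \<epsilon>: "0 < \<epsilon>"
begin

abbreviation (input) "weight X j \<equiv> exp (- \<epsilon> / 2 * u j X)"
abbreviation (input) "normalizer X \<equiv> (\<Sum>j\<in>J. exp (- \<epsilon> / 2 * u j X))"

lemma normalizer_pos: "0 < normalizer X"
  using J by (intro sum_pos) auto

lemma sets_exponential_mechanism: "sets (exponential_mechanism \<epsilon> J u y E X) = sets E"
  by (simp add: exponential_mechanism_def)

lemma emeasure_exponential_mechanism:
  assumes S: "S \<in> sets E"
  shows "emeasure (exponential_mechanism \<epsilon> J u y E X) S =
    ennreal (\<Sum>j\<in>J. weight X j / normalizer X * indicator S (y j))"
proof -
  have meas: "y \<in> density (count_space J) (\<lambda>j. ennreal (weight X j / normalizer X)) \<rightarrow>\<^sub>M E"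
    using y by auto
  have pre: "y -` S \<inter> space (density (count_space J) (\<lambda>j. ennreal (weight X j / normalizer X))) = y -` S \<inter> J"
    by simp
  have "emeasure (exponential_mechanism \<epsilon> J u y E X) S =
      (\<integral>\<^sup>+j. ennreal (weight X j / normalizer X) * indicator (y -` S \<inter> J) j \<partial>count_space J)"
    unfolding exponential_mechanism_def emeasure_distr[OF meas S] pre
    by (subst emeasure_density) auto
  also have "\<dots> = (\<Sum>j\<in>J. ennreal (weight X j / normalizer X) * indicator (y -` S \<inter> J) j)"
    using J by (intro nn_integral_count_space_finite)
  also have "\<dots> = (\<Sum>j\<in>J. ennreal (weight X j / normalizer X * indicator S (y j)))"
    by (intro sum.cong refl) (auto simp: indicator_def)
  also have "\<dots> = ennreal (\<Sum>j\<in>J. weight X j / normalizer X * indicator S (y j))"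
    using normalizer_pos by (intro sum_ennreal) (auto intro!: mult_nonneg_nonneg divide_nonneg_pos)
  finally show ?thesis .
qed

lemma measure_exponential_mechanism:
  assumes S: "S \<in> sets E"
  shows "measure (exponential_mechanism \<epsilon> J u y E X) S = (\<Sum>j\<in>J. weight X j / normalizer X * indicator S (y j))"
  unfolding measure_def emeasure_exponential_mechanism[OF S]
  using normalizer_pos[of X] by (intro enn2real_ennreal sum_nonneg) (auto intro!: mult_nonneg_nonneg divide_nonneg_pos)

lemma prob_space_exponential_mechanism: "prob_space (exponential_mechanism \<epsilon> J u y E X)"
proof (rule prob_spaceI)
  have "space (exponential_mechanism \<epsilon> J u y E X) = space E"
    using sets_exponential_mechanism by (rule sets_eq_imp_space_eq)
  then have "emeasure (exponential_mechanism \<epsilon> J u y E X) (space (exponential_mechanism \<epsilon> J u y E X)) =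
      ennreal (\<Sum>j\<in>J. weight X j / normalizer X * indicator (space E) (y j))"
    by (simp add: emeasure_exponential_mechanism)
  also have "(\<Sum>j\<in>J. weight X j / normalizer X * indicator (space E) (y j)) = (\<Sum>j\<in>J. weight X j / normalizer X)"
    using y by (intro sum.cong) auto
  also have "\<dots> = 1" using normalizer_pos[of X] by (simp flip: sum_divide_distrib)
  finally show "emeasure (exponential_mechanism \<epsilon> J u y E X) (space (exponential_mechanism \<epsilon> J u y E X)) = 1"
    by simp
qed

lemma exponential_mechanism_measurable:
  assumes u: "\<And>j. j \<in> J \<Longrightarrow> u j \<in> borel_measurable N"
  shows "exponential_mechanism \<epsilon> J u y E \<in> N \<rightarrow>\<^sub>M prob_algebra E"
proof (intro measurable_prob_algebraI measurable_subprob_algebra)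
  fix S assume S: "S \<in> sets E"
  show "(\<lambda>X. emeasure (exponential_mechanism \<epsilon> J u y E X) S) \<in> borel_measurable N"
    unfolding emeasure_exponential_mechanism[OF S]
    by (intro measurable_compose[OF _ measurable_ennreal] borel_measurable_sum borel_measurable_times
      borel_measurable_divide borel_measurable_exp borel_measurable_const measurable_compose[OF _ borel_measurable_exp] u) 
qed (auto simp: prob_space_exponential_mechanism sets_exponential_mechanism prob_space_imp_subprob_space)

lemma exponential_mechanism_private:
  assumes S: "S \<in> sets E" and u: "\<And>j. j \<in> J \<Longrightarrow> \<bar>u j X - u j X'\<bar> \<le> k"
  shows "measure (exponential_mechanism \<epsilon> J u y E X) S
    \<le> exp (\<epsilon> * k) * measure (exponential_mechanism \<epsilon> J u y E X') S"
proof -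
  have w: "weight X j \<le> exp (\<epsilon> / 2 * k) * weight X' j" "weight X' j \<le> exp (\<epsilon> / 2 * k) * weight X j" if "j \<in> J" for j
  proof -
    have "\<epsilon> / 2 * \<bar>u j X - u j X'\<bar> \<le> \<epsilon> / 2 * k"
      using u[OF that] \<epsilon> by (intro mult_left_mono) auto
    then have "\<bar>\<epsilon> / 2 * u j X - \<epsilon> / 2 * u j X'\<bar> \<le> \<epsilon> / 2 * k"
      using \<epsilon> by (simp only: right_diff_distrib[symmetric] abs_mult)
    then have "\<epsilon> / 2 * u j X - \<epsilon> / 2 * u j X' \<le> \<epsilon> / 2 * k"
      "- (\<epsilon> / 2 * u j X - \<epsilon> / 2 * u j X') \<le> \<epsilon> / 2 * k"
      unfolding abs_le_iff by blast+
    then show "weight X j \<le> exp (\<epsilon> / 2 * k) * weight X' j" "weight X' j \<le> exp (\<epsilon> / 2 * k) * weight X j"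
      unfolding exp_add[symmetric] exp_le_cancel_iff by linarith+
  qed
  have "normalizer X' \<le> exp (\<epsilon> / 2 * k) * normalizer X"
    unfolding sum_distrib_left using w by (intro sum_mono) auto
  then have tot: "1 / normalizer X \<le> exp (\<epsilon> / 2 * k) / normalizer X'"
    using normalizer_pos[of X] normalizer_pos[of X'] by (simp add: field_simps)
  have "weight X j / normalizer X \<le> exp (\<epsilon> * k) * (weight X' j / normalizer X')" if "j \<in> J" for j
  proof -
    have "weight X j * (1 / normalizer X) \<le> (exp (\<epsilon> / 2 * k) * weight X' j) * (exp (\<epsilon> / 2 * k) / normalizer X')"
      using w[OF that] tot normalizer_pos[of X] by (intro mult_mono) auto
    also have "\<dots> = exp (\<epsilon> / 2 * k) * exp (\<epsilon> / 2 * k) * (weight X' j / normalizer X')" by simp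
    also have "exp (\<epsilon> / 2 * k) * exp (\<epsilon> / 2 * k) = exp (\<epsilon> * k)" by (simp flip: exp_add)
    finally show ?thesis by simp
  qed
  then show ?thesis
    unfolding measure_exponential_mechanism[OF S] sum_distrib_left
    by (intro sum_mono) (auto simp: indicator_def)
qed

text \<open>
  An element whose score exceeds \<open>m + k\<close> has at most \<open>exp (- \<epsilon> k / 2)\<close> times the weight of \<open>j0\<close>; sum over all of them.
\<close>
lemma exponential_mechanism_utility:
  assumes S: "S \<in> sets E" and j0: "j0 \<in> J" "u j0 X \<le> m"
    and good: "\<And>j. j \<in> J \<Longrightarrow> u j X \<le> m + k \<Longrightarrow> y j \<in> S"
  shows "1 - real (card J) * exp (- \<epsilon> / 2 * k) \<le> measure (exponential_mechanism \<epsilon> J u y E X) S"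
proof -
  have "1 = (\<Sum>j\<in>J. weight X j / normalizer X)"
    using normalizer_pos[of X] by (simp flip: sum_divide_distrib)
  also have "\<dots> \<le> (\<Sum>j\<in>J. weight X j / normalizer X * indicator S (y j) + exp (- \<epsilon> / 2 * k))"
  proof (intro sum_mono)
    fix j assume j: "j \<in> J"
    show "weight X j / normalizer X \<le> weight X j / normalizer X * indicator S (y j) + exp (- \<epsilon> / 2 * k)"
    proof (cases "u j X \<le> m + k")
      case False
      have "weight X j0 \<le> normalizer X"
        using J j0 by (intro member_le_sum) auto
      moreover have "exp (- \<epsilon> / 2 * m) \<le> weight X j0"
        using j0 \<epsilon> by simp
      ultimately have "exp (- \<epsilon> / 2 * m) \<le> normalizer X" by (rule order_trans[rotated])
      then have "exp (- \<epsilon> / 2 * k) * exp (- \<epsilon> / 2 * m) \<le> exp (- \<epsilon> / 2 * k) * normalizer X"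
        by (intro mult_left_mono) auto
      moreover have "weight X j \<le> exp (- \<epsilon> / 2 * k) * exp (- \<epsilon> / 2 * m)"
        using False \<epsilon> mult_left_mono[of "m + k" "u j X" \<epsilon>] by (simp add: algebra_simps flip: exp_add)
      ultimately have "weight X j \<le> exp (- \<epsilon> / 2 * k) * normalizer X"
        by linarith
      then have "weight X j / normalizer X \<le> exp (- \<epsilon> / 2 * k)"
        using normalizer_pos[of X] by (simp add: divide_le_eq)
      moreover have "0 \<le> weight X j / normalizer X * indicator S (y j)"
        using normalizer_pos[of X] by (intro mult_nonneg_nonneg divide_nonneg_pos) auto
      ultimately show ?thesis by linarith
    qed (use good[OF j] in simp)
  qed
  also have "\<dots> = measure (exponential_mechanism \<epsilon> J u y E X) S + real (card J) * exp (- \<epsilon> / 2 * k)"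
    by (simp add: sum.distrib measure_exponential_mechanism[OF S])
  finally show ?thesis by simp
qed

end

context admissible_law
begin

lemma halfspace_count_concentration:
  assumes "0 < n" "0 \<le> \<tau>"
  shows "measure (samples n D)
      {X \<in> space (samples n D). real n * \<tau> \<le> \<bar>halfspace_count n d X \<theta> t - real n * proj_cdf \<theta> t\<bar>}
    \<le> 2 * exp (- 2 * real n * \<tau>\<^sup>2)"
proof -
  let ?B = "{x \<in> space (euclid d). ip d x \<theta> \<le> t}"
  have "halfspace_count n d X \<theta> t = real (card {i. i < n \<and> X i \<in> ?B})" if "X \<in> space (samples n D)" for X
  proof -
    have "X i \<in> space (euclid d)" if "i < n" for i
      using \<open>X \<in> space (samples n D)\<close> that by (auto simp: samples_def space_PiM space_D)
    then show ?thesis unfolding halfspace_count_def by (intro arg_cong[where f="\<lambda>A. real (card A)"]) auto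
  qed
  then have "{X \<in> space (samples n D). real n * \<tau> \<le> \<bar>halfspace_count n d X \<theta> t - real n * proj_cdf \<theta> t\<bar>}
    = {X \<in> space (samples n D). real n * \<tau> \<le> \<bar>real (card {i. i < n \<and> X i \<in> ?B}) - real n * prob ?B\<bar>}"
    by (auto simp: proj_cdf_def)
  then show ?thesis
    using empirical_count_concentration[OF prob_space_axioms half_space_sets[of \<theta> t] assms] by simp
qed

text \<open>
  Passing from all \<open>n\<close> samples to one: \<open>n\<close> independent points all have norm at most \<open>M\<close> with probability
  at least one half, so \<open>(1 - p) ^ n \<ge> 1/2\<close> for the tail probability \<open>p\<close>. Here \<open>n\<close> is a free parameter
  of the class; it is unrelated to the number of samples given to the algorithm.
\<close>
lemma norm_tail:
  assumes n: "1 \<le> n" "\<eta> n \<le> 1/2" and M: "poly P (real (n * d)) \<le> M"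
  shows "prob {x \<in> space (euclid d). M < L2_set x {..<d}} \<le> 1 / real n"
proof -
  interpret S: finite_product_prob_space "\<lambda>_. D" "{..<n}"
    by unfold_locales auto
  let ?B = "{x \<in> space (euclid d). L2_set x {..<d} \<le> M}"
  let ?T = "{x \<in> space (euclid d). M < L2_set x {..<d}}"
  have B: "?B \<in> sets D" and T: "?T \<in> sets D" unfolding sets_D by measurable
  have "1/2 \<le> 1 - \<eta> n" using n by simp
  also have "\<dots> \<le> measure (samples n D)
        {X \<in> space (samples n D). \<forall>i<n. L2_set (X i) {..<d} \<le> poly P (real (n * d))}"
    using admissibleD(6)[OF adm] n by blast
  also have "\<dots> \<le> measure (samples n D) (\<Pi>\<^sub>E i\<in>{..<n}. ?B)"
  proof (rule finite_measure.finite_measure_mono)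
    show "finite_measure (samples n D)"
      using prob_space_samples[OF prob_space_axioms] by (simp add: prob_space_def)
    show "{X \<in> space (samples n D). \<forall>i<n. L2_set (X i) {..<d} \<le> poly P (real (n * d))} \<subseteq> (\<Pi>\<^sub>E i\<in>{..<n}. ?B)"
      using M by (force simp: samples_def space_PiM space_D PiE_iff)
    show "(\<Pi>\<^sub>E i\<in>{..<n}. ?B) \<in> sets (samples n D)"
      unfolding samples_def using B by (intro sets_PiM_I_finite) auto
  qed
  also have "\<dots> = (\<Prod>i<n. prob ?B)"
    unfolding samples_def using B by (intro S.finite_measure_PiM_emb) auto
  also have "\<dots> = (1 - prob ?T) ^ n"
  proof -
    have "?B = space D - ?T" by (auto simp: space_D)
    then show ?thesis using prob_compl[OF T] by simp
  qed
  also have "\<dots> \<le> exp (- prob ?T) ^ n"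
    using exp_ge_add_one_self[of "- prob ?T"] by (intro power_mono) auto
  also have "\<dots> = exp (- (real n * prob ?T))" by (simp flip: exp_of_nat_mult)
  finally have "ln (1/2) \<le> ln (exp (- (real n * prob ?T)))"
    by (intro ln_mono) auto
  then have "real n * prob ?T \<le> ln 2" by (simp add: ln_div)
  also have "\<dots> \<le> 1" using ln_2_less_1 by simp
  finally show ?thesis using n by (simp add: field_simps)
qed

end

section \<open>Stability of the floating body and its Steiner point\<close>

context admissible_law
begin

abbreviation body :: "(nat \<Rightarrow> real) set" where "body \<equiv> floating_body d q D"

text \<open>
  Otherwise the two half-spaces would be disjoint, each of mass at least \<open>q > 1/2\<close>.
\<close>
lemma Q_antipodal_sum_nonneg: "0 \<le> Q \<theta> + Q (antipode d \<theta>)"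
proof (rule ccontr)
  assume neg: "\<not> 0 \<le> Q \<theta> + Q (antipode d \<theta>)"
  let ?A = "{x \<in> space (euclid d). ip d x \<theta> \<le> Q \<theta>}"
  let ?B = "{x \<in> space (euclid d). ip d x (antipode d \<theta>) \<le> Q (antipode d \<theta>)}"
  have "q \<le> prob ?A" "q \<le> prob ?B" using Q_le_iff unfolding proj_cdf_def by blast+
  moreover have "prob (?A \<union> ?B) = prob ?A + prob ?B"
  proof (rule finite_measure_Union)
    show "?A \<inter> ?B = {}" using neg by auto
  qed simp_all
  moreover have "prob (?A \<union> ?B) \<le> 1" by simp
  ultimately show False using q by linarith
qed

lemma tail_vanishes:
  assumes "0 < e"
  obtains M where "0 \<le> M" "prob {x \<in> space (euclid d). M < L2_set x {..<d}} \<le> e"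
proof -
  let ?A = "\<lambda>n::nat. {x \<in> space (euclid d). real n < L2_set x {..<d}}"
  have "(\<lambda>n. prob (?A n)) \<longlonglongrightarrow> prob (\<Inter>n. ?A n)"
  proof (rule finite_Lim_measure_decseq)
    have "?A n \<in> sets D" for n unfolding sets_D by measurable
    then show "range ?A \<subseteq> sets D" by blast
    show "decseq ?A" by (auto simp: decseq_def)
  qed
  moreover have "(\<Inter>n. ?A n) = {}"
  proof (rule equals0I)
    fix x assume x: "x \<in> (\<Inter>n. ?A n)"
    obtain n :: nat where "L2_set x {..<d} < real n" using reals_Archimedean2 by blast
    then have "x \<notin> ?A n" by simp
    then show False using x by blast
  qed
  ultimately have "(\<lambda>n. prob (?A n)) \<longlonglongrightarrow> 0" by simp
  then have "\<forall>\<^sub>F n in sequentially. prob (?A n) < e" using assms by (rule order_tendstoD)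
  then obtain n where "prob (?A n) < e" by (auto simp: eventually_sequentially)
  then show ?thesis using that[of "real n"] by simp
qed

lemma Q_continuous:
  assumes \<theta>: "\<theta> \<in> unit_sphere d" and s: "0 < s" "s \<le> r"
  obtains \<delta> where "0 < \<delta>"
    "\<And>\<theta>'. \<theta>' \<in> unit_sphere d \<Longrightarrow> L2_set (\<lambda>i. \<theta>' i - \<theta> i) {..<d} \<le> \<delta> \<Longrightarrow> \<bar>Q \<theta>' - Q \<theta>\<bar> \<le> s"
proof -
  obtain M where M: "0 \<le> M" "prob {x \<in> space (euclid d). M < L2_set x {..<d}} \<le> L * s / 2"
    using tail_vanishes[of "L * s / 2"] pos s by auto
  have \<delta>: "2 * M * (s / (2 * (M + 1))) \<le> s" using M s by (simp add: field_simps)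
  show ?thesis
  proof (rule that[of "s / (2 * (M + 1))"])
    show "0 < s / (2 * (M + 1))" using M s by simp
    show "\<bar>Q \<theta>' - Q \<theta>\<bar> \<le> s"
      if "\<theta>' \<in> unit_sphere d" "L2_set (\<lambda>i. \<theta>' i - \<theta> i) {..<d} \<le> s / (2 * (M + 1))" for \<theta>'
      by (rule Q_modulus[OF \<theta> that \<delta> s M])
  qed
qed

text \<open>
  The admissibility condition only bounds \<open>\<bar>Q \<theta> - \<langle>c, \<theta>\<rangle>\<bar>\<close> from below. If the difference were
  negative at \<open>\<theta>\<close>, then it would be nonnegative at the antipode of \<open>\<theta>\<close> by \<open>Q_antipodal_sum_nonneg\<close>, and by
  continuity it would vanish somewhere on a half great circle between them.
\<close>
lemma center:
  assumes d2: "2 \<le> d"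
  obtains c where "c \<in> space (euclid d)" "\<And>\<theta>. \<theta> \<in> unit_sphere d \<Longrightarrow> ip d c \<theta> + Rmin \<le> Q \<theta>"
proof -
  obtain c where c: "c \<in> space (euclid d)" "\<And>\<theta>. \<theta> \<in> unit_sphere d \<Longrightarrow> Rmin \<le> \<bar>Q \<theta> - ip d c \<theta>\<bar>"
    using admissibleD(4)[OF adm] by auto
  have "ip d c \<theta> + Rmin \<le> Q \<theta>" if \<theta>: "\<theta> \<in> unit_sphere d" for \<theta>
  proof (rule ccontr)
    assume "\<not> ip d c \<theta> + Rmin \<le> Q \<theta>"
    then have neg: "Q \<theta> - ip d c \<theta> \<le> - Rmin" using c(2)[OF \<theta>] by linarith
    obtain e where e: "e \<in> unit_sphere d" "ip d \<theta> e = 0"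
      using orthogonal_unit_vector[OF d2 \<theta>] .
    define \<gamma> where "\<gamma> = (\<lambda>t. \<lambda>k\<in>{..<d}. cos t * \<theta> k + sin t * e k)"
    have \<gamma>: "\<gamma> t \<in> unit_sphere d" for t
      unfolding \<gamma>_def using \<theta> e by (rule great_circle_sphere)
    have \<gamma>0: "\<gamma> 0 = \<theta>" and \<gamma>pi: "\<gamma> pi = antipode d \<theta>"
      using \<theta> by (auto simp: \<gamma>_def antipode_def unit_sphere_def space_euclid extensional_def)
    have "isCont (\<lambda>t. Q (\<gamma> t)) t" for t
      unfolding isCont_def
    proof (rule tendstoI)
      fix \<epsilon> :: real assume \<epsilon>: "0 < \<epsilon>"
      obtain \<delta> where \<delta>: "0 < \<delta>" "\<And>\<theta>'. \<theta>' \<in> unit_sphere d \<Longrightarrow> L2_set (\<lambda>i. \<theta>' i - \<gamma> t i) {..<d} \<le> \<delta> \<Longrightarrow> \<bar>Q \<theta>' - Q (\<gamma> t)\<bar> \<le> min r (\<epsilon> / 2)"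
        using Q_continuous[OF \<gamma>[of t], of "min r (\<epsilon> / 2)"] \<epsilon> pos by auto
      have "((\<lambda>u. real d * (\<bar>cos u - cos t\<bar> + \<bar>sin u - sin t\<bar>)) \<longlongrightarrow> real d * (\<bar>cos t - cos t\<bar> + \<bar>sin t - sin t\<bar>)) (at t)"
        by (intro tendsto_intros)
      then have "\<forall>\<^sub>F u in at t. real d * (\<bar>cos u - cos t\<bar> + \<bar>sin u - sin t\<bar>) < \<delta>"
        using \<delta>(1) by (intro order_tendstoD) auto
      then show "\<forall>\<^sub>F u in at t. dist (Q (\<gamma> u)) (Q (\<gamma> t)) < \<epsilon>"
      proof eventually_elim
        case (elim u)
        have "L2_set (\<lambda>i. \<gamma> u i - \<gamma> t i) {..<d} \<le> real d * (\<bar>cos u - cos t\<bar> + \<bar>sin u - sin t\<bar>)"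
        proof (rule L2_le_of_coords)
          fix i assume i: "i < d"
          have "\<gamma> u i - \<gamma> t i = (cos u - cos t) * \<theta> i + (sin u - sin t) * e i"
            using i by (simp add: \<gamma>_def algebra_simps)
          also have "\<bar>\<dots>\<bar> \<le> \<bar>cos u - cos t\<bar> * \<bar>\<theta> i\<bar> + \<bar>sin u - sin t\<bar> * \<bar>e i\<bar>"
            by (metis abs_mult abs_triangle_ineq)
          also have "\<dots> \<le> \<bar>cos u - cos t\<bar> * 1 + \<bar>sin u - sin t\<bar> * 1"
            using sphere_coord_le[OF \<theta> i] sphere_coord_le[OF e(1) i] by (intro add_mono mult_left_mono) auto
          finally show "\<bar>\<gamma> u i - \<gamma> t i\<bar> \<le> \<bar>cos u - cos t\<bar> + \<bar>sin u - sin t\<bar>" by simp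
        qed
        then have "\<bar>Q (\<gamma> u) - Q (\<gamma> t)\<bar> \<le> min r (\<epsilon> / 2)"
          using elim by (intro \<delta>(2)[OF \<gamma>]) auto
        then show ?case using \<epsilon> by (simp add: dist_real_def)
      qed
    qed
    moreover have "isCont (\<lambda>t. ip d c (\<gamma> t)) t" for t
      unfolding ip_def \<gamma>_def by (simp cong: sum.cong)
    ultimately have cont: "continuous_on {0..pi} (\<lambda>t. Q (\<gamma> t) - ip d c (\<gamma> t))"
      by (intro continuous_on_diff continuous_at_imp_continuous_on) auto
    have "0 \<le> Q (\<gamma> pi) - ip d c (\<gamma> pi)"
      using Q_antipodal_sum_nonneg[of \<theta>] neg pos by (simp add: \<gamma>pi)
    then obtain t where "Q (\<gamma> t) - ip d c (\<gamma> t) = 0"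
      using IVT'[of "\<lambda>t. Q (\<gamma> t) - ip d c (\<gamma> t)" 0 0 pi] cont neg pos by (auto simp: \<gamma>0)
    then show False using c(2)[OF \<gamma>[of t]] pos by simp
  qed
  then show ?thesis using c that by blast
qed

lemma body_iff: "x \<in> body \<longleftrightarrow> x \<in> space (euclid d) \<and> (\<forall>\<theta>\<in>unit_sphere d. ip d x \<theta> \<le> Q \<theta>)"
  using basis_vector_sphere[OF pos(1)] unfolding floating_body_def by blast

lemma body_ip_le: "x \<in> body \<Longrightarrow> \<theta> \<in> unit_sphere d \<Longrightarrow> ip d x \<theta> \<le> Q \<theta>"
  by (simp add: body_iff)

lemma body_abs_ip_le: "x \<in> body \<Longrightarrow> \<theta> \<in> unit_sphere d \<Longrightarrow> \<bar>ip d x \<theta>\<bar> \<le> Rmax"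
  using body_ip_le[of x \<theta>] body_ip_le[of x "antipode d \<theta>"] antipode_sphere[of \<theta> d]
    Q_bounds[of \<theta>] Q_bounds[of "antipode d \<theta>"] by (simp add: abs_le_iff)

lemma body_coord_le:
  assumes "x \<in> body" "i < d"
  shows "\<bar>x i\<bar> \<le> Rmax"
proof -
  have "ip d x (\<lambda>k\<in>{..<d}. if k = i then 1 else 0) = (\<Sum>k<d. if k = i then x i else 0)"
    unfolding ip_def by (rule sum.cong) auto
  also have "\<dots> = x i" using assms(2) by simp
  finally have "ip d x (\<lambda>k\<in>{..<d}. if k = i then 1 else 0) = x i" .
  then show ?thesis using body_abs_ip_le[OF assms(1) basis_vector_sphere[OF assms(2)]] by simp
qed

lemma sphere_1_cases:
  assumes "d = 1" "\<theta> \<in> unit_sphere d" "\<theta>' \<in> unit_sphere d"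
  shows "\<theta>' = \<theta> \<or> \<theta>' = antipode d \<theta>"
proof -
  have "(\<theta> 0)\<^sup>2 = (\<theta>' 0)\<^sup>2"
    using sphere_sum_squares[OF assms(2)] sphere_sum_squares[OF assms(3)] assms(1) by simp
  then have "\<theta>' 0 = \<theta> 0 \<or> \<theta>' 0 = - \<theta> 0" by (metis power2_eq_iff)
  moreover have "\<theta> \<in> extensional {..<1}" "\<theta>' \<in> extensional {..<1}"
    using assms by (auto simp: unit_sphere_def space_euclid)
  ultimately show ?thesis
    using assms(1) by (auto simp: antipode_def extensional_def fun_eq_iff) (metis neq0_conv)+
qed

text \<open>
  On the line the floating body is the interval between the two directional quantiles. A centre with
  margin \<open>Rmin\<close> need not exist there, but the support function is the quantile itself.
\<close>
lemma boundary_point_1: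
  assumes "d = 1" "\<theta> \<in> unit_sphere d"
  shows "(\<lambda>i\<in>{..<d}. Q \<theta> * \<theta> i) \<in> body" "ip d (\<lambda>i\<in>{..<d}. Q \<theta> * \<theta> i) \<theta> = Q \<theta>"
proof -
  have "(\<theta> 0)\<^sup>2 = 1" using sphere_sum_squares[OF assms(2)] assms(1) by simp
  then show ip: "ip d (\<lambda>i\<in>{..<d}. Q \<theta> * \<theta> i) \<theta> = Q \<theta>"
    using assms(1) by (simp add: ip_def power2_eq_square)
  show "(\<lambda>i\<in>{..<d}. Q \<theta> * \<theta> i) \<in> body"
    unfolding body_iff
  proof (intro conjI ballI)
    fix \<theta>' assume "\<theta>' \<in> unit_sphere d"
    then have "\<theta>' = \<theta> \<or> \<theta>' = antipode d \<theta>" by (rule sphere_1_cases[OF assms])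
    then show "ip d (\<lambda>i\<in>{..<d}. Q \<theta> * \<theta> i) \<theta>' \<le> Q \<theta>'"
      using Q_antipodal_sum_nonneg[of \<theta>] ip by auto
  qed (simp add: space_euclid)
qed

lemma body_nonempty: "body \<noteq> {}"
proof (cases "2 \<le> d")
  case True
  obtain c where "c \<in> space (euclid d)" "\<And>\<theta>. \<theta> \<in> unit_sphere d \<Longrightarrow> ip d c \<theta> + Rmin \<le> Q \<theta>"
    using center[OF True] by metis
  then have "c \<in> body" using pos unfolding body_iff by force
  then show ?thesis by auto
next
  case False
  then have "d = 1" using pos by simp
  then show ?thesis using boundary_point_1(1)[OF _ basis_vector_sphere[OF pos(1)]] by blast
qed

lemma Rmin_le_Rmax: "2 \<le> d \<Longrightarrow> Rmin \<le> Rmax"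
proof -
  assume "2 \<le> d"
  then obtain c where c: "\<And>\<theta>. \<theta> \<in> unit_sphere d \<Longrightarrow> ip d c \<theta> + Rmin \<le> Q \<theta>"
    using center by metis
  define \<theta> :: "nat \<Rightarrow> real" where "\<theta> = (\<lambda>k\<in>{..<d}. if k = 0 then 1 else 0)"
  have "\<theta> \<in> unit_sphere d" unfolding \<theta>_def by (rule basis_vector_sphere) (rule pos)
  then show ?thesis
    using c[of \<theta>] c[of "antipode d \<theta>"] antipode_sphere[of \<theta> d] Q_bounds[of \<theta>] Q_bounds[of "antipode d \<theta>"]
    by simp
qed

lemma bdd_above_body: "\<theta> \<in> unit_sphere d \<Longrightarrow> bdd_above ((\<lambda>x. ip d x \<theta>) ` body)"
  by (rule bdd_aboveI[of _ "Q \<theta>"]) (use body_ip_le in auto)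

lemma support_fun_upper: "x \<in> body \<Longrightarrow> \<theta> \<in> unit_sphere d \<Longrightarrow> ip d x \<theta> \<le> support_fun d body \<theta>"
  unfolding support_fun_def by (rule cSUP_upper) (use bdd_above_body in auto)

lemma support_fun_least: "(\<And>x. x \<in> body \<Longrightarrow> ip d x \<theta> \<le> b) \<Longrightarrow> support_fun d body \<theta> \<le> b"
  unfolding support_fun_def using body_nonempty by (rule cSUP_least)

lemma support_fun_abs_le:
  assumes "\<theta> \<in> unit_sphere d"
  shows "\<bar>support_fun d body \<theta>\<bar> \<le> Rmax"
proof -
  obtain x where x: "x \<in> body" using body_nonempty by blast
  have "support_fun d body \<theta> \<le> Rmax"
    by (rule support_fun_least) (use body_abs_ip_le[OF _ assms] in \<open>auto simp: abs_le_iff\<close>)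
  then show ?thesis
    using support_fun_upper[OF x assms] body_abs_ip_le[OF x assms] by linarith
qed

text \<open>
  Moving \<open>x\<close> towards a centre with margin \<open>Rmin\<close> by the fraction \<open>t / (Rmin + t)\<close> repairs a violation
  of all constraints by \<open>t\<close>, and displaces \<open>x\<close> by at most \<open>2 Rmax t / Rmin\<close> in every direction.
\<close>
lemma body_absorbs:
  assumes d2: "2 \<le> d" and t: "0 \<le> t" and x: "x \<in> space (euclid d)"
    "\<And>\<theta>. \<theta> \<in> unit_sphere d \<Longrightarrow> ip d x \<theta> \<le> Q \<theta> + t" "\<And>\<theta>. \<theta> \<in> unit_sphere d \<Longrightarrow> \<bar>ip d x \<theta>\<bar> \<le> Rmax"
  obtains x' where "x' \<in> body" "\<And>\<theta>. \<theta> \<in> unit_sphere d \<Longrightarrow> ip d x \<theta> \<le> ip d x' \<theta> + 2 * Rmax * t / Rmin"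
proof -
  obtain c where c: "c \<in> space (euclid d)" "\<And>\<theta>. \<theta> \<in> unit_sphere d \<Longrightarrow> ip d c \<theta> + Rmin \<le> Q \<theta>"
    using center[OF d2] by metis
  define l where "l = t / (Rmin + t)"
  have l: "0 \<le> l" "l \<le> 1" "l \<le> t / Rmin" "(1 - l) * (Rmin + t) = Rmin" "l * (Rmin + t) = t"
    using t pos by (auto simp: l_def field_simps)
  define x' where "x' = (\<lambda>i\<in>{..<d}. (1 - l) * x i + l * c i)"
  have ip': "ip d x' \<theta> = (1 - l) * ip d x \<theta> + l * ip d c \<theta>" for \<theta>
  proof -
    have "ip d x' \<theta> = (\<Sum>i<d. (1 - l) * (x i * \<theta> i) + l * (c i * \<theta> i))"
      unfolding ip_def by (rule sum.cong) (simp_all add: x'_def algebra_simps)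
    then show ?thesis by (simp add: ip_def sum.distrib flip: sum_distrib_left)
  qed
  show ?thesis
  proof (rule that)
    show "x' \<in> body" unfolding body_iff
    proof (intro conjI ballI)
      show "x' \<in> space (euclid d)" by (simp add: x'_def space_euclid)
      fix \<theta> assume \<theta>: "\<theta> \<in> unit_sphere d"
      have "(1 - l) * ip d x \<theta> \<le> (1 - l) * (Q \<theta> + t)"
        using x(2)[OF \<theta>] l by (intro mult_left_mono) auto
      moreover have "l * ip d c \<theta> \<le> l * (Q \<theta> - Rmin)"
        using c(2)[OF \<theta>] l by (intro mult_left_mono) auto
      ultimately show "ip d x' \<theta> \<le> Q \<theta>"
        using l(5) unfolding ip' by (simp add: algebra_simps)
    qed
    fix \<theta> assume \<theta>: "\<theta> \<in> unit_sphere d"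
    have "ip d x \<theta> - ip d x' \<theta> = l * (ip d x \<theta> - ip d c \<theta>)" unfolding ip' by (simp add: algebra_simps)
    also have "\<dots> \<le> l * (2 * Rmax)"
    proof (rule mult_left_mono[OF _ l(1)])
      have "- ip d c \<theta> \<le> Rmax"
        using c(2)[OF antipode_sphere[OF \<theta>]] Q_bounds[OF antipode_sphere[OF \<theta>]] pos by simp
      then show "ip d x \<theta> - ip d c \<theta> \<le> 2 * Rmax" using x(3)[OF \<theta>] by linarith
    qed
    also have "\<dots> \<le> t / Rmin * (2 * Rmax)" using l pos by (intro mult_right_mono) auto
    finally show "ip d x \<theta> \<le> ip d x' \<theta> + 2 * Rmax * t / Rmin" by (simp add: mult_ac)
  qed
qed

end

lemma support_fun_stability_one_sided:
  assumes D: "admissible_law P \<eta> d q Rmax Rmin r L D" and D': "admissible_law P \<eta> d q Rmax Rmin r L D'"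
    and R: "d = 1 \<Longrightarrow> Rmin \<le> Rmax" and t: "0 \<le> t"
    and close: "\<And>\<theta>. \<theta> \<in> unit_sphere d \<Longrightarrow> dir_quantile d q D' \<theta> \<le> dir_quantile d q D \<theta> + t"
    and \<theta>: "\<theta> \<in> unit_sphere d"
  shows "support_fun d (floating_body d q D') \<theta> \<le> support_fun d (floating_body d q D) \<theta> + 2 * Rmax * t / Rmin"
proof -
  interpret D: admissible_law P \<eta> d q Rmax Rmin r L D by fact
  interpret D': admissible_law P \<eta> d q Rmax Rmin r L D' by fact
  show ?thesis
  proof (rule D'.support_fun_least)
    fix x assume x: "x \<in> D'.body"
    show "ip d x \<theta> \<le> support_fun d D.body \<theta> + 2 * Rmax * t / Rmin"
    proof (cases "2 \<le> d")
      case True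
      obtain x' where "x' \<in> D.body" "\<And>\<theta>. \<theta> \<in> unit_sphere d \<Longrightarrow> ip d x \<theta> \<le> ip d x' \<theta> + 2 * Rmax * t / Rmin"
      proof (rule D.body_absorbs[OF True t])
        show "x \<in> space (euclid d)" using x by (simp add: D'.body_iff)
        show "ip d x \<phi> \<le> D.Q \<phi> + t" if "\<phi> \<in> unit_sphere d" for \<phi>
          using D'.body_ip_le[OF x that] close[OF that] by linarith
      qed (use D'.body_abs_ip_le[OF x] in auto)
      then show ?thesis using D.support_fun_upper[OF _ \<theta>] \<theta> by force
    next
      case False
      then have d1: "d = 1" using D.pos by simp
      have "ip d x \<theta> \<le> D.Q \<theta> + t" using D'.body_ip_le[OF x \<theta>] close[OF \<theta>] by linarith
      also have "D.Q \<theta> \<le> support_fun d D.body \<theta>"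
        using D.support_fun_upper[OF D.boundary_point_1(1)[OF d1 \<theta>] \<theta>] D.boundary_point_1(2)[OF d1 \<theta>] by simp
      also have "t \<le> 2 * Rmax * t / Rmin"
      proof -
        have "Rmin * t \<le> 2 * Rmax * t" using R[OF d1] t D.pos by (intro mult_right_mono) auto
        then show ?thesis using D.pos by (simp add: field_simps)
      qed
      finally show ?thesis by simp
    qed
  qed
qed

lemma steiner_point_stability:
  assumes \<sigma>: "haar_sphere d \<sigma>"
    and D: "admissible_law P \<eta> d q Rmax Rmin r L D" and D': "admissible_law P \<eta> d q Rmax Rmin r L D'"
    and R: "d = 1 \<Longrightarrow> Rmin \<le> Rmax" and t: "0 \<le> t"
    and close: "\<And>\<theta>. \<theta> \<in> unit_sphere d \<Longrightarrow> \<bar>dir_quantile d q D' \<theta> - dir_quantile d q D \<theta>\<bar> \<le> t"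
  shows "L2_set (\<lambda>i. steiner_point d \<sigma> (floating_body d q D') i - steiner_point d \<sigma> (floating_body d q D) i) {..<d}
    \<le> sqrt (real d) * (2 * Rmax * t / Rmin)"
proof -
  interpret D: admissible_law P \<eta> d q Rmax Rmin r L D by fact
  interpret D': admissible_law P \<eta> d q Rmax Rmin r L D' by fact
  interpret haar_sphere d \<sigma> by fact
  let ?h = "support_fun d D.body" and ?h' = "support_fun d D'.body"
  have "L2_set (\<lambda>i. real d * (\<integral>\<theta>. \<theta> i * ?h' \<theta> \<partial>\<sigma>) - real d * (\<integral>\<theta>. \<theta> i * ?h \<theta> \<partial>\<sigma>)) {..<d}
      \<le> sqrt (real d) * (2 * Rmax * t / Rmin)"
  proof (rule sphere_moment_lipschitz)
    show "?h' \<in> borel_measurable \<sigma>" "?h \<in> borel_measurable \<sigma>"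
      using D.body_nonempty D'.body_nonempty D.body_coord_le D'.body_coord_le D.pos
      by (auto intro!: measurable_from_euclid support_fun_measurable[where B=Rmax])
    show "\<bar>?h' \<theta> - ?h \<theta>\<bar> \<le> 2 * Rmax * t / Rmin" if \<theta>: "\<theta> \<in> unit_sphere d" for \<theta>
    proof -
      have close': "dir_quantile d q D' \<phi> \<le> dir_quantile d q D \<phi> + t"
        "dir_quantile d q D \<phi> \<le> dir_quantile d q D' \<phi> + t" if "\<phi> \<in> unit_sphere d" for \<phi>
        using close[OF that] by linarith+
      have "?h' \<theta> \<le> ?h \<theta> + 2 * Rmax * t / Rmin"
        by (rule support_fun_stability_one_sided[OF D D' R t close'(1) \<theta>])
      moreover have "?h \<theta> \<le> ?h' \<theta> + 2 * Rmax * t / Rmin"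
        by (rule support_fun_stability_one_sided[OF D' D R t close'(2) \<theta>])
      ultimately show ?thesis by linarith
    qed
    show "0 \<le> 2 * Rmax * t / Rmin" using D.pos t by simp
  qed (use D.support_fun_abs_le D'.support_fun_abs_le in auto)
  moreover have "L2_set (\<lambda>i. steiner_point d \<sigma> D'.body i - steiner_point d \<sigma> D.body i) {..<d} =
    L2_set (\<lambda>i. real d * (\<integral>\<theta>. \<theta> i * ?h' \<theta> \<partial>\<sigma>) - real d * (\<integral>\<theta>. \<theta> i * ?h \<theta> \<partial>\<sigma>)) {..<d}"
    by (rule L2_set_cong) (auto simp: steiner_point_def)
  ultimately show ?thesis by simp
qed

lemma steiner_point_coord_le:
  assumes \<sigma>: "haar_sphere d \<sigma>" and D: "admissible_law P \<eta> d q Rmax Rmin r L D" and i: "i < d"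
  shows "\<bar>steiner_point d \<sigma> (floating_body d q D) i\<bar> \<le> real d * Rmax"
proof -
  interpret D: admissible_law P \<eta> d q Rmax Rmin r L D by fact
  interpret haar_sphere d \<sigma> by fact
  have h: "support_fun d D.body \<in> borel_measurable \<sigma>"
    using D.body_nonempty D.body_coord_le D.pos
    by (auto intro!: measurable_from_euclid support_fun_measurable[where B=Rmax])
  have "\<bar>\<integral>\<theta>. \<theta> i * support_fun d D.body \<theta> \<partial>\<sigma>\<bar> \<le> 1 * Rmax"
  proof (rule abs_integral_le)
    show "\<bar>\<theta> i * support_fun d D.body \<theta>\<bar> \<le> 1 * Rmax" if "\<theta> \<in> unit_sphere d" for \<theta>
      unfolding abs_mult using sphere_coord_le[OF that i] D.support_fun_abs_le[OF that] by (intro mult_mono) auto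
  qed (use h i in measurable)
  then show ?thesis using i by (simp add: steiner_point_def abs_mult)
qed

section \<open>A private mechanism for fixed sample size and accuracy\<close>

text \<open>
  Rounding the quantiles to multiples of \<open>s\<close> leaves finitely many codes for the whole class, so that the
  minimum over laws in the score is finite and measurable in the data.
\<close>
definition quantile_code :: "real \<Rightarrow> (nat \<Rightarrow> real) set \<Rightarrow> ((nat \<Rightarrow> real) \<Rightarrow> real) \<Rightarrow> (nat \<Rightarrow> real) \<Rightarrow> int" where
  "quantile_code s \<Theta> f = (\<lambda>\<theta>\<in>\<Theta>. \<lfloor>f \<theta> / s\<rfloor>)"

text \<open>
  The code \<open>g\<close> stands for a quantile somewhere in \<open>[s g \<theta>, s (g \<theta> + 1)]\<close>. Each end of the interval is tested
  from one side only, so that rounding never makes the score of the true law worse; testing at a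
  rounded threshold from both sides could fail, as the density is not bounded from above.
\<close>
definition quantile_score ::
    "nat \<Rightarrow> nat \<Rightarrow> real \<Rightarrow> real \<Rightarrow> (nat \<Rightarrow> real) set \<Rightarrow> ((nat \<Rightarrow> real) \<Rightarrow> int) \<Rightarrow> (nat \<Rightarrow> nat \<Rightarrow> real) \<Rightarrow> real" where
  "quantile_score n d q s \<Theta> g X = Max ((\<lambda>\<theta>.
     max (halfspace_count n d X \<theta> (s * of_int (g \<theta>)) - q * real n)
         (q * real n - halfspace_count n d X \<theta> (s * (of_int (g \<theta>) + 1)))) ` \<Theta>)"

lemma quantile_codes_finite:
  assumes "finite \<Theta>" "0 < s" "\<And>D \<theta>. D \<in> \<D> \<Longrightarrow> \<theta> \<in> \<Theta> \<Longrightarrow> \<bar>f D \<theta>\<bar> \<le> R"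
  shows "finite ((\<lambda>D. quantile_code s \<Theta> (f D)) ` \<D>)"
proof (rule finite_subset)
  show "finite (\<Theta> \<rightarrow>\<^sub>E {\<lfloor>- R / s\<rfloor>..\<lfloor>R / s\<rfloor>})" using assms(1) by (intro finite_PiE) auto
  show "(\<lambda>D. quantile_code s \<Theta> (f D)) ` \<D> \<subseteq> \<Theta> \<rightarrow>\<^sub>E {\<lfloor>- R / s\<rfloor>..\<lfloor>R / s\<rfloor>}"
  proof (clarsimp simp: quantile_code_def)
    fix D \<theta> assume "D \<in> \<D>" "\<theta> \<in> \<Theta>"
    then have "- R \<le> f D \<theta>" "f D \<theta> \<le> R" using assms(3)[of D \<theta>] by (auto simp: abs_le_iff)
    then show "\<lfloor>- (R / s)\<rfloor> \<le> \<lfloor>f D \<theta> / s\<rfloor> \<and> \<lfloor>f D \<theta> / s\<rfloor> \<le> \<lfloor>R / s\<rfloor>"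
      using assms(2) by (intro conjI floor_mono) (auto simp: field_simps)
  qed
qed

lemma floor_grid_bounds:
  fixes h x :: real
  assumes "0 < h"
  shows "h * of_int \<lfloor>x / h\<rfloor> \<le> x" "x \<le> h * (of_int \<lfloor>x / h\<rfloor> + 1)"
proof -
  have "h * of_int \<lfloor>x / h\<rfloor> \<le> h * (x / h)" "h * (x / h) \<le> h * (of_int \<lfloor>x / h\<rfloor> + 1)"
    using assms by (intro mult_left_mono; linarith)+
  then show "h * of_int \<lfloor>x / h\<rfloor> \<le> x" "x \<le> h * (of_int \<lfloor>x / h\<rfloor> + 1)"
    using assms by simp_all
qed

lemma quantile_code_bounds:
  assumes "0 < s" "\<theta> \<in> \<Theta>"
  shows "s * of_int (quantile_code s \<Theta> f \<theta>) \<le> f \<theta>" "f \<theta> \<le> s * (of_int (quantile_code s \<Theta> f \<theta>) + 1)"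
  using floor_grid_bounds[OF assms(1), of "f \<theta>"] assms(2) by (simp_all add: quantile_code_def)

lemma quantile_score_le_iff:
  assumes "finite \<Theta>" "\<Theta> \<noteq> {}"
  shows "quantile_score n d q s \<Theta> g X \<le> k \<longleftrightarrow> (\<forall>\<theta>\<in>\<Theta>.
     halfspace_count n d X \<theta> (s * of_int (g \<theta>)) \<le> q * real n + k \<and>
     q * real n - k \<le> halfspace_count n d X \<theta> (s * (of_int (g \<theta>) + 1)))"
  unfolding quantile_score_def using assms by (subst Max_le_iff) (auto simp: algebra_simps)

lemma quantile_score_measurable:
  assumes "finite \<Theta>"
  shows "quantile_score n d q s \<Theta> g \<in> borel_measurable (samples n (euclid d))"
  unfolding quantile_score_def using assms by (intro borel_measurable_Max) measurable

lemma quantile_score_lipschitz: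
  assumes "finite \<Theta>" "\<Theta> \<noteq> {}"
  shows "quantile_score n d q s \<Theta> g X \<le> quantile_score n d q s \<Theta> g X' + real (hamming_dist n X X')"
  unfolding quantile_score_def
proof (rule Max_image_le_shift[OF assms])
  fix \<theta>
  show "max (halfspace_count n d X \<theta> (s * of_int (g \<theta>)) - q * real n)
         (q * real n - halfspace_count n d X \<theta> (s * (of_int (g \<theta>) + 1)))
     \<le> max (halfspace_count n d X' \<theta> (s * of_int (g \<theta>)) - q * real n)
         (q * real n - halfspace_count n d X' \<theta> (s * (of_int (g \<theta>) + 1))) + real (hamming_dist n X X')"
    using halfspace_count_lipschitz[of n d X \<theta> "s * of_int (g \<theta>)" X']
      halfspace_count_lipschitz[of n d X \<theta> "s * (of_int (g \<theta>) + 1)" X'] by linarith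
qed

lemma hamming_dist_commute: "hamming_dist n X X' = hamming_dist n X' X"
  unfolding hamming_dist_def by (rule arg_cong[where f=card]) auto

context admissible_law
begin

text \<open>
  The only events about the data used in the accuracy proof; there are only
  three of them for each direction of the net, so Hoeffding's inequality and a union bound control them all.
\<close>
definition concentrated :: "nat \<Rightarrow> real \<Rightarrow> real \<Rightarrow> (nat \<Rightarrow> real) set \<Rightarrow> (nat \<Rightarrow> nat \<Rightarrow> real) set" where
  "concentrated n \<tau> s \<Theta> = {X \<in> space (samples n D). \<forall>\<theta>\<in>\<Theta>. \<forall>v\<in>{0, s, - s}.
     \<bar>halfspace_count n d X \<theta> (Q \<theta> + v) - real n * proj_cdf \<theta> (Q \<theta> + v)\<bar> < real n * \<tau>}"

lemma halfspace_count_measurable_D [measurable]: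
  "(\<lambda>X. halfspace_count n d X \<theta> t) \<in> borel_measurable (samples n D)"
  using halfspace_count_measurable measurable_cong_sets[OF sets_samples[OF sets_D] refl] by blast

lemma concentrated_prob:
  assumes \<Theta>: "finite \<Theta>" and n: "0 < n" and \<tau>: "0 \<le> \<tau>"
  shows "concentrated n \<tau> s \<Theta> \<in> sets (samples n D)"
    "1 - 6 * real (card \<Theta>) * exp (- 2 * real n * \<tau>\<^sup>2) \<le> measure (samples n D) (concentrated n \<tau> s \<Theta>)"
proof -
  interpret S: prob_space "samples n D" using prob_space_axioms by (rule prob_space_samples)
  \<comment> \<open>The factor 6 below: three thresholds, each with a two-sided deviation bound.\<close>
  let ?bad = "\<lambda>(\<theta>, v). {X \<in> space (samples n D).
    real n * \<tau> \<le> \<bar>halfspace_count n d X \<theta> (Q \<theta> + v) - real n * proj_cdf \<theta> (Q \<theta> + v)\<bar>}"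
  let ?I = "\<Theta> \<times> {0, s, - s}"
  have I: "finite ?I" using \<Theta> by simp
  have bad: "?bad p \<in> sets (samples n D)" for p by (cases p) simp
  then have un: "(\<Union>p\<in>?I. ?bad p) \<in> sets (samples n D)" using I by (intro sets.finite_UN) auto
  have eq: "concentrated n \<tau> s \<Theta> = space (samples n D) - (\<Union>p\<in>?I. ?bad p)"
    unfolding concentrated_def by (auto simp: not_le)
  show "concentrated n \<tau> s \<Theta> \<in> sets (samples n D)" unfolding eq using un by auto
  have "measure (samples n D) (\<Union>p\<in>?I. ?bad p) \<le> (\<Sum>p\<in>?I. measure (samples n D) (?bad p))"
    using I bad by (intro S.finite_measure_subadditive_finite) auto
  also have "\<dots> \<le> (\<Sum>p\<in>?I. 2 * exp (- 2 * real n * \<tau>\<^sup>2))"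
  proof (rule sum_mono)
    fix p
    show "measure (samples n D) (?bad p) \<le> 2 * exp (- 2 * real n * \<tau>\<^sup>2)"
      using halfspace_count_concentration[OF n \<tau>, where \<theta>="fst p" and t="Q (fst p) + snd p"]
      by (simp add: case_prod_beta)
  qed
  also have "\<dots> = real (card ?I) * (2 * exp (- 2 * real n * \<tau>\<^sup>2))" by simp
  also have "\<dots> \<le> real (3 * card \<Theta>) * (2 * exp (- 2 * real n * \<tau>\<^sup>2))"
  proof -
    have "card {0, s, - s} \<le> 3" by (simp add: card_insert_if)
    then have "card ?I \<le> 3 * card \<Theta>" by (simp add: card_cartesian_product)
    then show ?thesis by (intro mult_right_mono) (simp_all only: of_nat_le_iff, simp)
  qed
  finally show "1 - 6 * real (card \<Theta>) * exp (- 2 * real n * \<tau>\<^sup>2) \<le> measure (samples n D) (concentrated n \<tau> s \<Theta>)"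
    unfolding eq using S.prob_compl[OF un] by simp
qed

lemma own_score_le:
  assumes \<Theta>: "finite \<Theta>" "\<Theta> \<noteq> {}" "\<Theta> \<subseteq> unit_sphere d" and s: "0 < s"
    and X: "X \<in> concentrated n \<tau> s \<Theta>"
  shows "quantile_score n d q s \<Theta> (quantile_code s \<Theta> Q) X \<le> real n * \<tau>"
  unfolding quantile_score_le_iff[OF \<Theta>(1,2)]
proof (intro ballI)
  fix \<theta> assume \<theta>: "\<theta> \<in> \<Theta>"
  then have c: "\<bar>halfspace_count n d X \<theta> (Q \<theta>) - real n * q\<bar> < real n * \<tau>"
    using X proj_cdf_at_Q[of \<theta>] \<Theta>(3) unfolding concentrated_def by force
  show "halfspace_count n d X \<theta> (s * of_int (quantile_code s \<Theta> Q \<theta>)) \<le> q * real n + real n * \<tau> \<and>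
    q * real n - real n * \<tau> \<le> halfspace_count n d X \<theta> (s * (of_int (quantile_code s \<Theta> Q \<theta>) + 1))"
    using c halfspace_count_mono[OF quantile_code_bounds(1)[OF s \<theta>, of Q], of n d X \<theta>]
      halfspace_count_mono[OF quantile_code_bounds(2)[OF s \<theta>, of Q], of n d X \<theta>]
    by (simp add: abs_less_iff mult.commute)
qed

text \<open>
  If the code placed the quantile beyond \<open>Q \<theta> + s\<close>, then at least as many points as lie below \<open>Q \<theta> + s\<close> would lie below it,
  that is more than \<open>q n + 3 n L s / 4\<close>, contradicting the score. The other side is symmetric, and
  rounding costs a further \<open>s\<close>.
\<close>
lemma low_score_imp_close:
  assumes \<Theta>: "finite \<Theta>" "\<Theta> \<noteq> {}" "\<Theta> \<subseteq> unit_sphere d" and s: "0 < s" "s \<le> r" and n: "0 < n"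
    and X: "X \<in> concentrated n (L * s / 4) s \<Theta>"
    and score: "quantile_score n d q s \<Theta> (quantile_code s \<Theta> f) X \<le> 2 * (real n * (L * s / 4))"
    and \<theta>: "\<theta> \<in> \<Theta>"
  shows "\<bar>f \<theta> - Q \<theta>\<bar> \<le> 2 * s"
proof -
  let ?g = "of_int (quantile_code s \<Theta> f \<theta>) :: real"
  have \<theta>': "\<theta> \<in> unit_sphere d" using \<theta> \<Theta> by auto
  have g: "s * ?g \<le> f \<theta>" "f \<theta> \<le> s * (?g + 1)" using quantile_code_bounds[OF s(1) \<theta>] by auto
  have score': "halfspace_count n d X \<theta> (s * ?g) \<le> q * real n + 2 * (real n * (L * s / 4))"
    "q * real n - 2 * (real n * (L * s / 4)) \<le> halfspace_count n d X \<theta> (s * (?g + 1))"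
    using score \<theta> unfolding quantile_score_le_iff[OF \<Theta>(1,2)] by blast+
  have c: "\<bar>halfspace_count n d X \<theta> (Q \<theta> + v) - real n * proj_cdf \<theta> (Q \<theta> + v)\<bar> < real n * (L * s / 4)" if "v \<in> {0, s, - s}" for v
    using X \<theta> that unfolding concentrated_def by blast
  have nLs: "0 < real n * (L * s)" using n s pos by simp
  have up: "real n * (q + L * s) \<le> real n * proj_cdf \<theta> (Q \<theta> + s)"
    using proj_cdf_above_Q[OF \<theta>', of s] s by (intro mult_left_mono) auto
  have down: "real n * proj_cdf \<theta> (Q \<theta> - s) \<le> real n * (q - L * s)"
    using proj_cdf_below_Q[OF \<theta>', of s] s by (intro mult_left_mono) auto
  have "s * ?g \<le> Q \<theta> + s"
  proof (rule ccontr)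
    assume "\<not> s * ?g \<le> Q \<theta> + s"
    then have "halfspace_count n d X \<theta> (Q \<theta> + s) \<le> halfspace_count n d X \<theta> (s * ?g)"
      by (intro halfspace_count_mono) simp
    then show False using c[of s] up score'(1) nLs by (simp add: algebra_simps abs_less_iff)
  qed
  moreover have "Q \<theta> - s \<le> s * (?g + 1)"
  proof (rule ccontr)
    assume "\<not> Q \<theta> - s \<le> s * (?g + 1)"
    then have "halfspace_count n d X \<theta> (s * (?g + 1)) \<le> halfspace_count n d X \<theta> (Q \<theta> - s)"
      by (intro halfspace_count_mono) simp
    then show False using c[of "- s"] down score'(2) nLs by (simp add: algebra_simps abs_less_iff)
  qed
  ultimately show ?thesis using g by (simp add: algebra_simps abs_le_iff)
qed

lemma success_prob_ge:
  assumes A: "A \<in> samples n (euclid d) \<rightarrow>\<^sub>M prob_algebra (euclid d)"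
    and G: "G \<in> sets (samples n D)" "a \<le> measure (samples n D) G" and "0 \<le> b"
    and good: "\<And>X. X \<in> G \<Longrightarrow> b \<le> measure (A X) {y \<in> space (euclid d). L2_set (\<lambda>i. y i - z i) {..<d} \<le> \<alpha>}"
  shows "a * b \<le> success_prob d n A D z \<alpha>"
proof -
  let ?B = "{y \<in> space (euclid d). L2_set (\<lambda>i. y i - z i) {..<d} \<le> \<alpha>}"
  interpret S: prob_space "samples n D" using prob_space_axioms by (rule prob_space_samples)
  have B: "?B \<in> sets (euclid d)" by (rule L2_ball_sets)
  have S: "samples n D \<in> space (prob_algebra (samples n (euclid d)))"
    using sets_samples[OF sets_D] S.prob_space_axioms by (simp add: space_prob_algebra)
  interpret bind: prob_space "samples n D \<bind> A" by (rule prob_space_bind'[OF S A])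
  have space: "space (samples n D) = space (samples n (euclid d))"
    by (rule sets_eq_imp_space_eq[OF sets_samples[OF sets_D]])
  have A_prob: "prob_space (A X)" if "X \<in> space (samples n D)" for X
    using measurable_space[OF A, of X] that by (simp add: space space_prob_algebra)
  have "ennreal (b * measure (samples n D) G) = (\<integral>\<^sup>+X. ennreal b * indicator G X \<partial>samples n D)"
    using G \<open>0 \<le> b\<close> by (simp add: nn_integral_cmult_indicator S.emeasure_eq_measure ennreal_mult)
  also have "\<dots> \<le> (\<integral>\<^sup>+X. emeasure (A X) ?B \<partial>samples n D)"
  proof (rule nn_integral_mono)
    fix X assume X: "X \<in> space (samples n D)"
    interpret AX: prob_space "A X" by (rule A_prob[OF X])
    show "ennreal b * indicator G X \<le> emeasure (A X) ?B"
      using good[of X] by (auto simp: indicator_def AX.emeasure_eq_measure ennreal_leI)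
  qed
  also have "\<dots> = emeasure (samples n D \<bind> A) ?B"
    by (rule emeasure_bind_prob_algebra[OF S A B, symmetric])
  also have "\<dots> = ennreal (success_prob d n A D z \<alpha>)"
    by (simp add: bind.emeasure_eq_measure success_prob_def)
  finally have "b * measure (samples n D) G \<le> success_prob d n A D z \<alpha>"
    by (simp add: success_prob_def)
  moreover have "a * b \<le> b * measure (samples n D) G"
    using mult_left_mono[OF G(2) \<open>0 \<le> b\<close>] by (simp add: mult.commute)
  ultimately show ?thesis by linarith
qed

end

text \<open>
  The error \<open>\<alpha>\<close> is split as follows: the quantiles of a law with a good score are off by \<open>4 s\<close> on
  the whole sphere (\<open>2 s\<close> on the net, and \<open>s\<close> for each of the two laws in passing to the sphere), hence the
  Steiner points by \<open>8 sqrt d Rmax s / Rmin = \<alpha> / 2\<close>; rounding the output costs the other half. The last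
  two assumptions make each of the two failure probabilities at most \<open>1/20\<close>.
\<close>
theorem private_steiner_mechanism:
  fixes \<sigma> :: "(nat \<Rightarrow> real) measure" and P \<eta> d q Rmax Rmin r L \<epsilon> \<alpha> n M \<delta>
  defines "s \<equiv> \<alpha> * Rmin / (16 * sqrt (real d) * Rmax)"
  assumes \<sigma>: "haar_sphere d \<sigma>" and q: "1/2 < q" "q < 1"
    and pos: "0 < d" "0 < Rmax" "0 < Rmin" "0 < r" "0 < L" and \<epsilon>: "0 < \<epsilon>"
    and R: "d = 1 \<Longrightarrow> Rmin \<le> Rmax" and \<alpha>: "0 < \<alpha>" "\<alpha> \<le> r"
    and ne: "admissible P \<eta> d q Rmax Rmin r L \<noteq> {}"
    and tail: "0 \<le> M" "\<And>D. D \<in> admissible P \<eta> d q Rmax Rmin r L \<Longrightarrow>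
      measure D {x \<in> space (euclid d). M < L2_set x {..<d}} \<le> L * s / 2"
    and \<delta>: "0 < \<delta>" "2 * M * \<delta> \<le> s"
    and n: "0 < n" "6 * (2 * real d / \<delta> + 2) ^ d * exp (- 2 * real n * (L * s / 4)\<^sup>2) \<le> 1/20"
      "(4 * (real d)\<^sup>2 * Rmax / \<alpha> + 2) ^ d * exp (- \<epsilon> / 2 * (real n * (L * s / 4))) \<le> 1/20"
  shows "\<exists>A. diff_private \<epsilon> d n A \<and> (\<forall>D\<in>admissible P \<eta> d q Rmax Rmin r L.
    0.9 \<le> success_prob d n A D (steiner_point d \<sigma> (floating_body d q D)) \<alpha>)"
proof -
  let ?\<A> = "admissible P \<eta> d q Rmax Rmin r L"
  have law: "admissible_law P \<eta> d q Rmax Rmin r L D" if "D \<in> ?\<A>" for D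
    using that q pos by unfold_locales
  obtain D0 where D0: "D0 \<in> ?\<A>" using ne by blast
  have RR: "Rmin \<le> Rmax"
    using admissible_law.Rmin_le_Rmax[OF law[OF D0]] R pos by (cases "2 \<le> d") auto
  have s: "0 < s" "s \<le> r"
  proof -
    have "1 \<le> sqrt (real d)" using pos by simp
    then have "1 \<le> 16 * sqrt (real d)" by linarith
    then have "1 * Rmin \<le> (16 * sqrt (real d)) * Rmax"
      using RR pos by (intro mult_mono) auto
    then have "\<alpha> * Rmin \<le> \<alpha> * (16 * sqrt (real d) * Rmax)"
      using \<alpha> by (intro mult_left_mono) auto
    then have "s \<le> \<alpha>" using pos \<alpha> by (simp add: s_def divide_le_eq mult_ac)
    then show "s \<le> r" using \<alpha> by simp
    show "0 < s" using pos \<alpha> by (simp add: s_def)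
  qed
  obtain \<Theta> where \<Theta>: "finite \<Theta>" "\<Theta> \<subseteq> unit_sphere d" "real (card \<Theta>) \<le> (2 * 1 / (\<delta> / real d) + 2) ^ d"
    "\<And>\<theta>. \<theta> \<in> unit_sphere d \<Longrightarrow> \<exists>\<phi>\<in>\<Theta>. \<forall>i<d. \<bar>\<theta> i - \<phi> i\<bar> \<le> \<delta> / real d"
    by (rule finite_grid_net[of "\<delta> / real d" 1 "unit_sphere d" d]) (use \<delta> pos sphere_coord_le in auto)
  have \<Theta>_ne: "\<Theta> \<noteq> {}" using \<Theta>(4)[OF basis_vector_sphere[OF pos(1)]] by blast
  define h where "h = \<alpha> / (2 * real d)"
  have h: "0 < h" using \<alpha> pos by (simp add: h_def)
  define S where "S D = steiner_point d \<sigma> (floating_body d q D)" for D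
  define cell where "cell D = grid_cell d h (S D)" for D
  define code where "code D = quantile_code s \<Theta> (dir_quantile d q D)" for D
  define J where "J = cell ` ?\<A>"
  define G where "G j = code ` {D \<in> ?\<A>. cell D = j}" for j
  define u where "u j X = Min ((\<lambda>g. quantile_score n d q s \<Theta> g X) ` G j)" for j X
  define y where "y j = (\<lambda>i\<in>{..<d}. h * real_of_int (j i))" for j :: "nat \<Rightarrow> int"
  define A where "A = exponential_mechanism \<epsilon> J u y (euclid d)"
  have S_le: "\<bar>S D i\<bar> \<le> real d * Rmax" if "D \<in> ?\<A>" "i < d" for D i
    unfolding S_def using \<sigma> law[OF that(1)] that(2) by (rule steiner_point_coord_le)
  have cells: "finite (grid_cell d h ` (S ` ?\<A>))" "real (card (grid_cell d h ` (S ` ?\<A>))) \<le> (2 * (real d * Rmax) / h + 2) ^ d"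
    by (rule grid_cells_finite_card[of h "real d * Rmax"]; use h pos S_le in auto)+
  have J_eq: "J = grid_cell d h ` (S ` ?\<A>)" by (auto simp: J_def cell_def)
  have J: "finite J" "J \<noteq> {}" using cells D0 unfolding J_eq by auto
  have card_J: "real (card J) \<le> (4 * (real d)\<^sup>2 * Rmax / \<alpha> + 2) ^ d"
    using cells(2) \<alpha> pos unfolding J_eq h_def by (simp add: power2_eq_square field_simps)
  have fin_G: "finite (G j)" for j
    unfolding G_def code_def
    by (rule quantile_codes_finite[OF \<Theta>(1) s(1), of _ _ Rmax])
       (use admissible_law.Q_bounds[OF law] \<Theta>(2) in auto)
  have G_ne: "G j \<noteq> {}" if "j \<in> J" for j using that by (auto simp: J_def G_def)
  have y: "y j \<in> space (euclid d)" for j by (simp add: y_def space_euclid)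
  note mech = J y \<epsilon>
  have u_meas: "u j \<in> borel_measurable (samples n (euclid d))" for j
    unfolding u_def using fin_G quantile_score_measurable[OF \<Theta>(1)] by (intro borel_measurable_Min) auto
  have u_lip: "\<bar>u j X - u j X'\<bar> \<le> real (hamming_dist n X X')" if "j \<in> J" for j X X'
  proof -
    have "u j X \<le> u j X' + real (hamming_dist n X X')" for X X'
      unfolding u_def
      by (rule Min_image_le_shift[OF fin_G G_ne[OF that] quantile_score_lipschitz[OF \<Theta>(1) \<Theta>_ne]])
    from this[of X X'] this[of X' X] show ?thesis
      by (simp add: abs_le_iff hamming_dist_commute)
  qed
  have A_kernel: "A \<in> samples n (euclid d) \<rightarrow>\<^sub>M prob_algebra (euclid d)"
    unfolding A_def by (rule exponential_mechanism_measurable[OF mech u_meas])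
  have dp: "diff_private \<epsilon> d n A"
    unfolding diff_private_def
  proof (intro conjI A_kernel ballI)
    fix X X' S assume "S \<in> sets (euclid d)"
    then show "measure (A X) S \<le> exp (\<epsilon> * real (hamming_dist n X X')) * measure (A X') S"
      unfolding A_def by (intro exponential_mechanism_private J y \<epsilon> u_lip)
  qed
  have "0.9 \<le> success_prob d n A D (S D) \<alpha>" if D: "D \<in> ?\<A>" for D
  proof -
    interpret admissible_law P \<eta> d q Rmax Rmin r L D by (rule law[OF D])
    define \<tau> where "\<tau> = L * s / 4"
    have \<tau>: "0 \<le> \<tau>" using pos s by (simp add: \<tau>_def)
    let ?B = "{y \<in> space (euclid d). L2_set (\<lambda>i. y i - S D i) {..<d} \<le> \<alpha>}"
    have B: "?B \<in> sets (euclid d)" by (rule L2_ball_sets)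
    note conc = concentrated_prob[OF \<Theta>(1) n(1) \<tau>, of s]
    have card: "6 * real (card \<Theta>) * exp (- 2 * real n * \<tau>\<^sup>2) \<le> 6 * (2 * real d / \<delta> + 2) ^ d * exp (- 2 * real n * \<tau>\<^sup>2)"
      using \<Theta>(3) by (intro mult_right_mono mult_left_mono) auto
    have "19/20 \<le> measure (samples n D) (concentrated n \<tau> s \<Theta>)"
      using card conc(2) n(2) unfolding \<tau>_def by linarith
    moreover have "19/20 \<le> measure (A X) ?B" if X: "X \<in> concentrated n \<tau> s \<Theta>" for X
    proof -
      have "1 - real (card J) * exp (- \<epsilon> / 2 * (real n * \<tau>)) \<le> measure (A X) ?B"
        unfolding A_def
      proof (rule exponential_mechanism_utility[OF mech B])
        show "cell D \<in> J" using D by (simp add: J_def)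
        have "u (cell D) X \<le> quantile_score n d q s \<Theta> (code D) X"
          unfolding u_def using fin_G D by (intro Min_le) (auto simp: G_def)
        also have "\<dots> \<le> real n * \<tau>"
          unfolding code_def by (rule own_score_le[OF \<Theta>(1) \<Theta>_ne \<Theta>(2) s(1) X])
        finally show "u (cell D) X \<le> real n * \<tau>" .
      next
        fix j assume j: "j \<in> J" "u j X \<le> real n * \<tau> + real n * \<tau>"
        have "u j X \<in> (\<lambda>g. quantile_score n d q s \<Theta> g X) ` G j"
          unfolding u_def using fin_G G_ne[OF j(1)] by (intro Min_in) auto
        then obtain D' where D': "D' \<in> ?\<A>" "cell D' = j" "u j X = quantile_score n d q s \<Theta> (code D') X"
          by (auto simp: G_def)
        interpret D': admissible_law P \<eta> d q Rmax Rmin r L D' by (rule law[OF D'(1)])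
        have net: "\<bar>D'.Q \<phi> - Q \<phi>\<bar> \<le> 2 * s" if "\<phi> \<in> \<Theta>" for \<phi>
        proof (rule low_score_imp_close[OF \<Theta>(1) \<Theta>_ne \<Theta>(2) s n(1) _ _ that])
          show "X \<in> concentrated n (L * s / 4) s \<Theta>" using X by (simp add: \<tau>_def)
          show "quantile_score n d q s \<Theta> (quantile_code s \<Theta> D'.Q) X \<le> 2 * (real n * (L * s / 4))"
            using j(2) D'(3) by (simp add: code_def \<tau>_def)
        qed
        have "\<bar>D'.Q \<theta> - Q \<theta>\<bar> \<le> 4 * s" if \<theta>: "\<theta> \<in> unit_sphere d" for \<theta>
        proof -
          obtain \<phi> where \<phi>: "\<phi> \<in> \<Theta>" "\<forall>i<d. \<bar>\<theta> i - \<phi> i\<bar> \<le> \<delta> / real d" using \<Theta>(4)[OF \<theta>] by blast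
          then have \<phi>': "\<phi> \<in> unit_sphere d" using \<Theta>(2) by auto
          have "L2_set (\<lambda>i. \<theta> i - \<phi> i) {..<d} \<le> real d * (\<delta> / real d)"
            using \<phi> by (intro L2_le_of_coords) auto
          then have close: "L2_set (\<lambda>i. \<theta> i - \<phi> i) {..<d} \<le> \<delta>" using pos by simp
          have "\<bar>Q \<theta> - Q \<phi>\<bar> \<le> s"
            by (rule Q_modulus[OF \<phi>' \<theta> close \<delta>(2) s tail(1) tail(2)[OF D]])
          moreover have "\<bar>D'.Q \<theta> - D'.Q \<phi>\<bar> \<le> s"
            by (rule D'.Q_modulus[OF \<phi>' \<theta> close \<delta>(2) s tail(1) tail(2)[OF D'(1)]])
          ultimately show ?thesis using net[OF \<phi>(1)] by linarith
        qed
        then have "L2_set (\<lambda>i. S D' i - S D i) {..<d} \<le> sqrt (real d) * (2 * Rmax * (4 * s) / Rmin)"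
          unfolding S_def using s
          by (intro steiner_point_stability[OF \<sigma> law[OF D] law[OF D'(1)] R]) auto
        also have "\<dots> = \<alpha> / 2" using pos by (simp add: s_def field_simps)
        finally have close: "L2_set (\<lambda>i. S D' i - S D i) {..<d} \<le> \<alpha> / 2" .
        have round: "L2_set (\<lambda>i. y j i - S D' i) {..<d} \<le> real d * h"
        proof (rule L2_le_of_coords)
          fix i assume i: "i < d"
          have "h * real_of_int \<lfloor>S D' i / h\<rfloor> \<le> S D' i" "S D' i \<le> h * real_of_int \<lfloor>S D' i / h\<rfloor> + h"
            using floor_grid_bounds[OF h, of "S D' i"] by (simp_all add: distrib_left)
          then show "\<bar>y j i - S D' i\<bar> \<le> h"
            using i D'(2) h by (auto simp: y_def cell_def grid_cell_def)
        qed
        have "L2_set (\<lambda>i. (y j i - S D' i) + (S D' i - S D i)) {..<d}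
          \<le> L2_set (\<lambda>i. y j i - S D' i) {..<d} + L2_set (\<lambda>i. S D' i - S D i) {..<d}"
          by (rule L2_set_triangle_ineq)
        also have "\<dots> \<le> real d * h + \<alpha> / 2" using round close by (rule add_mono)
        also have "\<dots> = \<alpha>" using pos by (simp add: h_def)
        finally show "y j \<in> ?B" using y by simp
      qed
      moreover have "real (card J) * exp (- \<epsilon> / 2 * (real n * \<tau>)) \<le> 1/20"
        using mult_right_mono[OF card_J exp_ge_zero, of "- \<epsilon> / 2 * (real n * (L * s / 4))"] n(3)
        unfolding \<tau>_def by (rule order_trans)
      ultimately show ?thesis by simp
    qed
    ultimately have "(19/20) * (19/20) \<le> success_prob d n A D (S D) \<alpha>"
      by (intro success_prob_ge[OF A_kernel conc(1)]) auto
    then show ?thesis by simp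
  qed
  then show ?thesis using dp unfolding S_def by blast
qed

section \<open>The sample complexity\<close>

lemma polylog_1_Cons: "polylog 1 (p # ps) = (1 + \<bar>ln p\<bar>) * polylog 1 ps"
  by (simp add: polylog_def)

lemma polylog_1_ge_1: "1 \<le> polylog 1 ps"
proof (induction ps)
  case (Cons p ps)
  have "1 * 1 \<le> (1 + \<bar>ln p\<bar>) * polylog 1 ps" using Cons by (intro mult_mono) auto
  then show ?case unfolding polylog_1_Cons by simp
qed (simp add: polylog_def)

lemma abs_ln_le_polylog: "p \<in> set ps \<Longrightarrow> \<bar>ln p\<bar> \<le> polylog 1 ps"
proof (induction ps)
  case (Cons p' ps)
  have "1 * polylog 1 ps \<le> (1 + \<bar>ln p'\<bar>) * polylog 1 ps"
    using polylog_1_ge_1[of ps] by (intro mult_right_mono) auto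
  moreover have "(1 + \<bar>ln p'\<bar>) * 1 \<le> (1 + \<bar>ln p'\<bar>) * polylog 1 ps"
    using polylog_1_ge_1[of ps] by (intro mult_left_mono) auto
  ultimately show ?case using Cons unfolding polylog_1_Cons by (auto simp del: One_nat_def)
qed simp

text \<open>
  With \<open>\<Lambda> = polylog 1 ps\<close>, every product of powers of parameters is at most \<open>exp (k \<Lambda>)\<close> for a constant
  \<open>k\<close>. This reduces the bookkeeping of logarithmic factors to adding exponents.
\<close>
lemma le_exp_polylog:
  assumes "p \<in> set ps" "0 < p"
  shows "p \<le> exp (polylog 1 ps)" "1 / p \<le> exp (polylog 1 ps)"
proof -
  have "ln p \<le> polylog 1 ps" "- ln p \<le> polylog 1 ps" using abs_ln_le_polylog[OF assms(1)] by linarith+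
  then have "exp (ln p) \<le> exp (polylog 1 ps)" "exp (- ln p) \<le> exp (polylog 1 ps)" by simp_all
  then show "p \<le> exp (polylog 1 ps)" "1 / p \<le> exp (polylog 1 ps)"
    using assms(2) by (simp_all add: exp_minus inverse_eq_divide)
qed

lemma poly_le_power_bound:
  fixes P :: "real poly"
  obtains c :: real and m :: nat where "1 \<le> c" "\<And>x. 1 \<le> x \<Longrightarrow> poly P x \<le> c * x ^ m"
proof
  let ?c = "1 + (\<Sum>i\<le>degree P. \<bar>coeff P i\<bar>)"
  show "1 \<le> ?c" by (simp add: sum_nonneg)
  fix x :: real assume x: "1 \<le> x"
  have "poly P x = (\<Sum>i\<le>degree P. coeff P i * x ^ i)" by (rule poly_altdef)
  also have "\<dots> \<le> (\<Sum>i\<le>degree P. \<bar>coeff P i\<bar> * x ^ degree P)"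
  proof (rule sum_mono)
    fix i assume "i \<in> {..degree P}"
    then have "x ^ i \<le> x ^ degree P" using x by (intro power_increasing) auto
    then show "coeff P i * x ^ i \<le> \<bar>coeff P i\<bar> * x ^ degree P" using x by (intro mult_mono) auto
  qed
  also have "\<dots> \<le> ?c * x ^ degree P"
    unfolding sum_distrib_right[symmetric] using x by (intro mult_right_mono) auto
  finally show "poly P x \<le> ?c * x ^ degree P" .
qed

lemma power_exp_le_1_of_ln_le:
  assumes "0 < X" "0 < c" "ln c + real d * ln X \<le> y"
  shows "c * X ^ d * exp (- y) \<le> 1"
proof -
  have "ln (c * X ^ d) \<le> y" using assms by (simp add: ln_mult ln_realpow)
  then have "c * X ^ d \<le> exp y" using assms by (metis exp_le_cancel_iff exp_ln mult_pos_pos zero_less_power)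
  then show ?thesis by (simp add: exp_minus field_simps)
qed

context admissible_law
begin

lemma success_prob_mono:
  assumes A: "A \<in> samples n (euclid d) \<rightarrow>\<^sub>M prob_algebra (euclid d)" and "\<alpha> \<le> \<alpha>'"
  shows "success_prob d n A D z \<alpha> \<le> success_prob d n A D z \<alpha>'"
proof -
  have S: "samples n D \<in> space (prob_algebra (samples n (euclid d)))"
    using sets_samples[OF sets_D] prob_space_samples[OF prob_space_axioms] by (simp add: space_prob_algebra)
  interpret bind: prob_space "samples n D \<bind> A" by (rule prob_space_bind'[OF S A])
  have sets: "sets (samples n D \<bind> A) = sets (euclid d)" by (rule sets_bind'[OF S A])
  show ?thesis
    unfolding success_prob_def
  proof (rule bind.finite_measure_mono)
    show "{y \<in> space (euclid d). L2_set (\<lambda>i. y i - z i) {..<d} \<le> \<alpha>'} \<in> sets (samples n D \<bind> A)"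
      unfolding sets by (rule L2_ball_sets)
  qed (use assms(2) in auto)
qed

end

text \<open>
  The first summand is the sampling cost \<open>d / (L s)\<^sup>2\<close> up to constants. The second one is the privacy cost
  \<open>d / (\<epsilon> L s)\<close>: a factor \<open>d\<close> from the logarithm of the number of cells and \<open>sqrt d\<close> from \<open>1 / s\<close>.
\<close>
lemma rate_terms_le_main_rate:
  assumes "0 < d" "0 < \<epsilon>" "0 < Rmax" "0 < Rmin" "0 < r" "0 < L" "0 < \<alpha>"
  shows "(real d)\<^sup>2 * Rmax\<^sup>2 / (Rmin\<^sup>2 * \<alpha>\<^sup>2 * L\<^sup>2) + real d * sqrt (real d) * Rmax / (\<epsilon> * L * \<alpha> * Rmin)
    \<le> main_rate d \<epsilon> Rmax Rmin r L \<alpha>"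
proof -
  have "(real d)\<^sup>2 * (Rmax\<^sup>2 / (Rmin\<^sup>2 * \<alpha>\<^sup>2 * L\<^sup>2)) \<le> (real d)\<^sup>2 * ((Rmax + r)\<^sup>2 / (Rmin\<^sup>2 * \<alpha>\<^sup>2 * L\<^sup>2))"
    using assms by (intro mult_left_mono divide_right_mono power_mono) auto
  moreover have "real d * sqrt (real d) * Rmax / (\<epsilon> * L * \<alpha> * Rmin)
    \<le> real d powr 2.5 * ((Rmax + r) / Rmin) * (1 / (\<epsilon> * L * \<alpha>) + 1 / (\<epsilon> * L * min r Rmin))"
  proof -
    have "real d * sqrt (real d) = real d powr (1 + 1/2)"
      unfolding powr_add using assms by (simp add: powr_half_sqrt)
    also have "\<dots> \<le> real d powr 2.5" using assms by (intro powr_mono) auto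
    finally have "real d * sqrt (real d) \<le> real d powr 2.5" .
    then have "(real d * sqrt (real d)) * (Rmax / Rmin) * (1 / (\<epsilon> * L * \<alpha>) + 0)
      \<le> real d powr 2.5 * ((Rmax + r) / Rmin) * (1 / (\<epsilon> * L * \<alpha>) + 1 / (\<epsilon> * L * min r Rmin))"
      using assms by (intro mult_mono add_mono divide_right_mono) auto
    then show ?thesis by (simp add: mult_ac)
  qed
  ultimately show ?thesis unfolding main_rate_def by simp
qed

text \<open>
  The norm bound \<open>M\<close> comes from the tail condition at an auxiliary sample size \<open>n1\<close> of order \<open>1 / (L s)\<close>.
  It is polynomial in the parameters, so that the logarithm of the size of the net is \<open>d\<close> times a
  constant times \<open>\<Lambda>\<close>. Taking \<open>n1\<close> instead of \<open>n\<close> avoids a circular condition on \<open>n\<close>.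
\<close>
lemma private_steiner_rate:
  fixes \<sigma> :: "nat \<Rightarrow> (nat \<Rightarrow> real) measure" and P :: "real poly" and \<eta> :: "nat \<Rightarrow> real"
  assumes haar: "\<And>d. 0 < d \<Longrightarrow> sphere_haar d (\<sigma> d)" and whp: "\<eta> \<longlonglongrightarrow> 0"
  obtains C :: real where "1 \<le> C"
    "\<And>d q \<epsilon> Rmax Rmin r L \<alpha> n. 0 < d \<Longrightarrow> 1/2 < q \<Longrightarrow> q < 1 \<Longrightarrow> 0 < \<epsilon> \<Longrightarrow> 0 < Rmax \<Longrightarrow> 0 < Rmin \<Longrightarrow>
      0 < r \<Longrightarrow> 0 < L \<Longrightarrow> (d = 1 \<Longrightarrow> Rmin \<le> Rmax) \<Longrightarrow> 0 < \<alpha> \<Longrightarrow> \<alpha> \<le> r \<Longrightarrow>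
      admissible P \<eta> d q Rmax Rmin r L \<noteq> {} \<Longrightarrow> 0 < n \<Longrightarrow>
      C * main_rate d \<epsilon> Rmax Rmin r L \<alpha> * polylog 1 [real d, Rmax, Rmin, r, L, \<epsilon>, \<alpha>] \<le> real n \<Longrightarrow>
      \<exists>A. diff_private \<epsilon> d n A \<and> (\<forall>D\<in>admissible P \<eta> d q Rmax Rmin r L.
        0.9 \<le> success_prob d n A D (steiner_point d (\<sigma> d) (floating_body d q D)) \<alpha>)"
proof -
  have "\<forall>\<^sub>F n in sequentially. \<eta> n < 1/2" using whp by (rule order_tendstoD) simp
  then obtain n0 where n0: "\<And>n. n0 \<le> n \<Longrightarrow> \<eta> n \<le> 1/2"
    by (auto simp: eventually_sequentially intro: less_imp_le)
  obtain c0 :: real and m where c0: "1 \<le> c0" "\<And>x. 1 \<le> x \<Longrightarrow> poly P x \<le> c0 * x ^ m"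
    using poly_le_power_bound[of P] by metis
  define K where "K = c0 * (real n0 + 2) ^ m"
  have K: "1 \<le> K"
  proof -
    have "1 * 1 \<le> c0 * (real n0 + 2) ^ m" using c0(1) by (intro mult_mono one_le_power) auto
    then show ?thesis by (simp add: K_def)
  qed
  define c1 where "c1 = ln (6 * K) + 11 * real m + 9"
  have c1: "0 \<le> c1" using K by (simp add: c1_def)
  \<comment> \<open>\<open>2048 = 8 \<cdot> 256\<close> and \<open>3584 = 28 \<cdot> 8 \<cdot> 16\<close>, where \<open>256 = 16\<^sup>2\<close> and \<open>16\<close> come from the denominator of \<open>s\<close> and \<open>8\<close>
    from the exponents of the two failure probabilities.\<close>
  define C where "C = 2048 * (c1 + 119) + 3584"
  show ?thesis
  proof (rule that[of C])
    show "1 \<le> C" using c1 by (simp add: C_def)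
    fix d :: nat and q \<epsilon> Rmax Rmin r L \<alpha> :: real and n :: nat
    assume q: "1/2 < q" "q < 1" and pos: "0 < d" "0 < Rmax" "0 < Rmin" "0 < r" "0 < L" and \<epsilon>: "0 < \<epsilon>"
      and R: "d = 1 \<Longrightarrow> Rmin \<le> Rmax" and \<alpha>: "0 < \<alpha>" "\<alpha> \<le> r"
      and ne: "admissible P \<eta> d q Rmax Rmin r L \<noteq> {}" and n: "0 < n"
        "C * main_rate d \<epsilon> Rmax Rmin r L \<alpha> * polylog 1 [real d, Rmax, Rmin, r, L, \<epsilon>, \<alpha>] \<le> real n"
    let ?\<A> = "admissible P \<eta> d q Rmax Rmin r L"
    define \<Lambda> where "\<Lambda> = polylog 1 [real d, Rmax, Rmin, r, L, \<epsilon>, \<alpha>]"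
    have \<Lambda>: "1 \<le> \<Lambda>" unfolding \<Lambda>_def by (rule polylog_1_ge_1)
    have e: "1 \<le> exp (k * \<Lambda>)" if "0 \<le> k" for k using \<Lambda> that by simp
    have le_d: "real d \<le> exp \<Lambda>" and le_R: "Rmax \<le> exp \<Lambda>"
      unfolding \<Lambda>_def by (rule le_exp_polylog(1); use pos in simp)+
    have le_Rmin: "1 / Rmin \<le> exp \<Lambda>" and le_L: "1 / L \<le> exp \<Lambda>" and le_\<alpha>: "1 / \<alpha> \<le> exp \<Lambda>"
      unfolding \<Lambda>_def by (rule le_exp_polylog(2); use pos \<alpha> in simp)+
    have sqrt_d: "1 \<le> sqrt (real d)" "sqrt (real d) \<le> real d"
    proof -
      show "1 \<le> sqrt (real d)" using pos by simp
      then have "sqrt (real d) * 1 \<le> sqrt (real d) * sqrt (real d)" by (intro mult_left_mono) auto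
      then show "sqrt (real d) \<le> real d" by simp
    qed
    define s where "s = \<alpha> * Rmin / (16 * sqrt (real d) * Rmax)"
    have s: "0 < s" using pos \<alpha> by (simp add: s_def)
    have exp4: "16 \<le> exp (4 * \<Lambda>)"
    proof -
      have "(2::real) ^ 4 \<le> exp 1 ^ 4" using exp_ge_add_one_self[of 1] by (intro power_mono) auto
      also have "exp 1 ^ 4 = exp (4::real)" by (simp flip: exp_of_nat_mult)
      also have "\<dots> \<le> exp (4 * \<Lambda>)" using \<Lambda> by simp
      finally show ?thesis by simp
    qed
    have exp1: "2 \<le> exp \<Lambda>" using exp_ge_add_one_self[of \<Lambda>] \<Lambda> by linarith
    have inv_s: "1 / s \<le> exp (8 * \<Lambda>)"
    proof -
      have "1 / s = 16 * sqrt (real d) * Rmax * (1 / \<alpha>) * (1 / Rmin)" by (simp add: s_def)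
      also have "\<dots> \<le> exp (4 * \<Lambda>) * exp \<Lambda> * exp \<Lambda> * exp \<Lambda> * exp \<Lambda>"
        using pos \<alpha> le_d le_R le_Rmin le_\<alpha> sqrt_d exp4 by (intro mult_mono) auto
      also have "\<dots> = exp (8 * \<Lambda>)" by (simp flip: exp_add)
      finally show ?thesis .
    qed
    define n1 where "n1 = n0 + nat \<lceil>2 / (L * s)\<rceil>"
    have Ls: "0 < 2 / (L * s)" using pos s by simp
    have n1: "n0 \<le> n1" "1 \<le> n1" "2 / (L * s) \<le> real n1" "real n1 \<le> real n0 + 1 + 2 / (L * s)"
      using Ls unfolding n1_def by linarith+
    have n1_le: "real n1 \<le> (real n0 + 2) * exp (10 * \<Lambda>)"
    proof -
      have "2 / (L * s) = 2 * (1 / L) * (1 / s)" by simp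
      also have "\<dots> \<le> exp \<Lambda> * exp \<Lambda> * exp (8 * \<Lambda>)"
        using le_L inv_s pos s exp1 by (intro mult_mono) auto
      also have "\<dots> = exp (10 * \<Lambda>)" by (simp flip: exp_add)
      finally have "2 / (L * s) \<le> exp (10 * \<Lambda>)" .
      moreover have "(real n0 + 1) * 1 \<le> (real n0 + 1) * exp (10 * \<Lambda>)"
        using e[of 10] by (intro mult_left_mono) auto
      ultimately show ?thesis using n1(4) by (simp add: algebra_simps)
    qed
    define M where "M = c0 * (real (n1 * d)) ^ m"
    have n1d: "1 \<le> real (n1 * d)"
    proof -
      have "1 \<le> n1 * d" using n1(2) pos by simp
      then show ?thesis using of_nat_le_iff[of 1 "n1 * d", where ?'a=real] by simp
    qed
    have M1: "1 \<le> M"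
    proof -
      have "1 * 1 \<le> c0 * (real (n1 * d)) ^ m" using c0(1) n1d by (intro mult_mono one_le_power) auto
      then show ?thesis by (simp add: M_def)
    qed
    have M_le: "M \<le> K * exp (11 * real m * \<Lambda>)"
    proof -
      have "real (n1 * d) \<le> (real n0 + 2) * exp (10 * \<Lambda>) * exp \<Lambda>"
        unfolding of_nat_mult using n1_le le_d by (intro mult_mono) auto
      also have "\<dots> = (real n0 + 2) * exp (11 * \<Lambda>)" by (simp add: mult.assoc flip: exp_add)
      finally have "real (n1 * d) ^ m \<le> ((real n0 + 2) * exp (11 * \<Lambda>)) ^ m" by (intro power_mono) auto
      also have "\<dots> = (real n0 + 2) ^ m * exp (11 * real m * \<Lambda>)"
        by (simp add: power_mult_distrib mult_ac flip: exp_of_nat_mult)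
      finally show ?thesis using c0(1) by (simp add: M_def K_def mult.assoc)
    qed
    have tail: "measure D {x \<in> space (euclid d). M < L2_set x {..<d}} \<le> L * s / 2" if D: "D \<in> ?\<A>" for D
    proof -
      interpret admissible_law P \<eta> d q Rmax Rmin r L D by unfold_locales (use D q pos in auto)
      have "prob {x \<in> space (euclid d). M < L2_set x {..<d}} \<le> 1 / real n1"
        using n1 n0 c0(2)[OF n1d] by (intro norm_tail) (auto simp: M_def)
      also have "\<dots> \<le> L * s / 2" using n1 pos s by (simp add: field_simps)
      finally show ?thesis .
    qed
    define \<delta> where "\<delta> = s / (2 * M)"
    have \<delta>: "0 < \<delta>" "2 * M * \<delta> \<le> s" using s M1 by (simp_all add: \<delta>_def)
    have net: "ln (2 * real d / \<delta> + 2) \<le> c1 * \<Lambda>"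
    proof -
      have "2 * real d / \<delta> = 4 * (real d * M * (1 / s))" by (simp add: \<delta>_def)
      also have "real d * M * (1 / s) \<le> exp \<Lambda> * (K * exp (11 * real m * \<Lambda>)) * exp (8 * \<Lambda>)"
        using le_d M_le inv_s s M1 K by (intro mult_mono) auto
      also have "\<dots> = K * exp ((11 * real m + 9) * \<Lambda>)"
        by (simp add: mult.left_commute mult.assoc distrib_right flip: exp_add)
      finally have "2 * real d / \<delta> \<le> 4 * (K * exp ((11 * real m + 9) * \<Lambda>))" by simp
      moreover have "1 * 1 \<le> K * exp ((11 * real m + 9) * \<Lambda>)"
        using K e[of "11 * real m + 9"] by (intro mult_mono) auto
      ultimately have "2 * real d / \<delta> + 2 \<le> 6 * K * exp ((11 * real m + 9) * \<Lambda>)" by simp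
      moreover have "0 < 2 * real d / \<delta> + 2" using \<delta> by (simp add: add_nonneg_pos)
      ultimately have "ln (2 * real d / \<delta> + 2) \<le> ln (6 * K * exp ((11 * real m + 9) * \<Lambda>))"
        by (intro ln_mono)
      also have "\<dots> = ln (6 * K) + (11 * real m + 9) * \<Lambda>" using K by (simp add: ln_mult)
      also have "ln (6 * K) \<le> ln (6 * K) * \<Lambda>"
        using mult_left_mono[OF \<Lambda>, of "ln (6 * K)"] K by simp
      finally show ?thesis by (simp add: c1_def algebra_simps)
    qed
    have cells: "ln (4 * (real d)\<^sup>2 * Rmax / \<alpha> + 2) \<le> 9 * \<Lambda>"
    proof -
      have "4 * (real d)\<^sup>2 * Rmax / \<alpha> = 4 * (real d * real d * Rmax * (1 / \<alpha>))" by (simp add: power2_eq_square)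
      also have "real d * real d * Rmax * (1 / \<alpha>) \<le> exp \<Lambda> * exp \<Lambda> * exp \<Lambda> * exp \<Lambda>"
        using le_d le_R le_\<alpha> pos \<alpha> by (intro mult_mono) auto
      also have "\<dots> = exp (4 * \<Lambda>)" by (simp flip: exp_add)
      finally have "4 * (real d)\<^sup>2 * Rmax / \<alpha> \<le> 4 * exp (4 * \<Lambda>)" by simp
      then have "4 * (real d)\<^sup>2 * Rmax / \<alpha> + 2 \<le> 6 * exp (4 * \<Lambda>)" using exp4 by linarith
      moreover have "0 < 4 * (real d)\<^sup>2 * Rmax / \<alpha> + 2" using pos \<alpha> by (simp add: add_nonneg_pos)
      ultimately have "ln (4 * (real d)\<^sup>2 * Rmax / \<alpha> + 2) \<le> ln (6 * exp (4 * \<Lambda>))" by (intro ln_mono)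
      also have "\<dots> = ln 6 + 4 * \<Lambda>" by (simp add: ln_mult)
      also have "\<dots> \<le> 9 * \<Lambda>" using ln_le_minus_one[of "6::real"] \<Lambda> by simp
      finally show ?thesis .
    qed
    have rate: "C * ((real d)\<^sup>2 * Rmax\<^sup>2 / (Rmin\<^sup>2 * \<alpha>\<^sup>2 * L\<^sup>2) + real d * sqrt (real d) * Rmax / (\<epsilon> * L * \<alpha> * Rmin)) * \<Lambda> \<le> real n"
    proof -
      have "C * ((real d)\<^sup>2 * Rmax\<^sup>2 / (Rmin\<^sup>2 * \<alpha>\<^sup>2 * L\<^sup>2) + real d * sqrt (real d) * Rmax / (\<epsilon> * L * \<alpha> * Rmin)) * \<Lambda>
        \<le> C * main_rate d \<epsilon> Rmax Rmin r L \<alpha> * \<Lambda>"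
        using \<Lambda> c1 rate_terms_le_main_rate[OF pos(1) \<epsilon> pos(2-5) \<alpha>(1)]
        by (intro mult_right_mono mult_left_mono) (auto simp: C_def)
      then show ?thesis using n(2) by (simp add: \<Lambda>_def)
    qed
    define T1 where "T1 = (real d)\<^sup>2 * Rmax\<^sup>2 / (Rmin\<^sup>2 * \<alpha>\<^sup>2 * L\<^sup>2)"
    define T2 where "T2 = real d * sqrt (real d) * Rmax / (\<epsilon> * L * \<alpha> * Rmin)"
    have T: "0 < T1" "0 < T2" using pos \<epsilon> \<alpha> by (simp_all add: T1_def T2_def)
    have "2048 * (c1 + 119) * (T1 * \<Lambda>) \<le> C * (T1 + T2) * \<Lambda>" "3584 * (T2 * \<Lambda>) \<le> C * (T1 + T2) * \<Lambda>"
    proof -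
      have "2048 * (c1 + 119) * T1 \<le> C * (T1 + T2)" "3584 * T2 \<le> C * (T1 + T2)"
        using c1 T by (auto simp: C_def intro!: mult_mono)
      from this[THEN mult_right_mono[of _ _ \<Lambda>]] show "2048 * (c1 + 119) * (T1 * \<Lambda>) \<le> C * (T1 + T2) * \<Lambda>" "3584 * (T2 * \<Lambda>) \<le> C * (T1 + T2) * \<Lambda>"
        using \<Lambda> by (simp_all add: mult.assoc)
    qed
    then have n_ge: "2048 * (c1 + 119) * (T1 * \<Lambda>) \<le> real n" "3584 * (T2 * \<Lambda>) \<le> real n"
      using rate unfolding T1_def T2_def by linarith+
    have d\<Lambda>: "1 \<le> real d * \<Lambda>"
      using mult_mono[of 1 "real d" 1 \<Lambda>] pos \<Lambda> by simp
    have "ln 120 + real d * ln (2 * real d / \<delta> + 2) \<le> 2 * real n * (L * s / 4)\<^sup>2"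
    proof -
      have "ln 120 + real d * ln (2 * real d / \<delta> + 2) \<le> 119 * (real d * \<Lambda>) + real d * (c1 * \<Lambda>)"
        using net ln_le_minus_one[of "120::real"] d\<Lambda> by (intro add_mono mult_left_mono) auto
      also have "\<dots> = (c1 + 119) * (real d * \<Lambda>)" by (simp add: algebra_simps)
      also have "\<dots> = 2048 * (c1 + 119) * (T1 * \<Lambda>) * (L * s)\<^sup>2 / 8"
      proof -
        have "(L * s)\<^sup>2 = L\<^sup>2 * \<alpha>\<^sup>2 * Rmin\<^sup>2 / (256 * real d * Rmax\<^sup>2)"
          by (simp add: s_def power_mult_distrib power_divide)
        then have T1_s: "256 * (T1 * (L * s)\<^sup>2) = real d"
          using pos \<alpha> by (simp add: T1_def power2_eq_square field_simps)
        have "k * (real d * \<Lambda>) = 2048 * k * (T1 * \<Lambda>) * (L * s)\<^sup>2 / 8" for k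
          unfolding T1_s[symmetric] by simp
        then show ?thesis .
      qed
      also have "\<dots> \<le> real n * (L * s)\<^sup>2 / 8"
        using n_ge(1) by (intro divide_right_mono mult_right_mono) auto
      also have "\<dots> = 2 * real n * (L * s / 4)\<^sup>2" by (simp add: power_divide)
      finally show ?thesis .
    qed
    then have n2: "6 * (2 * real d / \<delta> + 2) ^ d * exp (- 2 * real n * (L * s / 4)\<^sup>2) \<le> 1/20"
      using power_exp_le_1_of_ln_le[of "2 * real d / \<delta> + 2" 120 d "2 * real n * (L * s / 4)\<^sup>2"] \<delta>
      by (simp add: add_nonneg_pos)
    have "ln 20 + real d * ln (4 * (real d)\<^sup>2 * Rmax / \<alpha> + 2) \<le> \<epsilon> / 2 * (real n * (L * s / 4))"
    proof -
      have "ln 20 + real d * ln (4 * (real d)\<^sup>2 * Rmax / \<alpha> + 2) \<le> 19 * (real d * \<Lambda>) + real d * (9 * \<Lambda>)"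
        using cells ln_le_minus_one[of "20::real"] d\<Lambda> by (intro add_mono mult_left_mono) auto
      also have "\<dots> = 28 * (real d * \<Lambda>)" by simp
      also have "\<dots> = 3584 * (T2 * \<Lambda>) * (\<epsilon> * L * s) / 8"
      proof -
        have T2_s: "16 * (T2 * (\<epsilon> * L * s)) = real d"
          using pos \<alpha> \<epsilon> by (simp add: T2_def s_def field_simps)
        show ?thesis unfolding T2_s[symmetric] by simp
      qed
      also have "\<dots> \<le> real n * (\<epsilon> * L * s) / 8"
        using n_ge(2) pos \<epsilon> s by (intro divide_right_mono mult_right_mono) auto
      also have "\<dots> = \<epsilon> / 2 * (real n * (L * s / 4))" by simp
      finally show ?thesis .
    qed
    then have n3: "(4 * (real d)\<^sup>2 * Rmax / \<alpha> + 2) ^ d * exp (- \<epsilon> / 2 * (real n * (L * s / 4))) \<le> 1/20"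
      using power_exp_le_1_of_ln_le[of "4 * (real d)\<^sup>2 * Rmax / \<alpha> + 2" 20 d "\<epsilon> / 2 * (real n * (L * s / 4))"] pos \<alpha>
      by (simp add: add_nonneg_pos)
    have "haar_sphere d (\<sigma> d)" using haar pos by unfold_locales auto
    then show "\<exists>A. diff_private \<epsilon> d n A \<and> (\<forall>D\<in>?\<A>.
        0.9 \<le> success_prob d n A D (steiner_point d (\<sigma> d) (floating_body d q D)) \<alpha>)"
      using q pos \<epsilon> R \<alpha> ne M1 tail \<delta> n(1) n2 n3 unfolding s_def
      by (intro private_steiner_mechanism[where M=M and \<delta>=\<delta>]) auto
  qed
qed

lemma main_rate_half_le:
  assumes "0 < \<epsilon>" "0 < Rmax" "0 < Rmin" "0 < r" "0 < L" "0 < \<alpha>"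
  shows "main_rate d \<epsilon> Rmax Rmin r L (\<alpha> / 2) \<le> 4 * main_rate d \<epsilon> Rmax Rmin r L \<alpha>"
proof -
  define W a b where "W = real d powr 2.5 * ((Rmax + r) / Rmin)"
    and "a = 1 / (\<epsilon> * L * \<alpha>)" and "b = 1 / (\<epsilon> * L * min r Rmin)"
  have nonneg: "0 \<le> W" "0 \<le> a" "0 \<le> b" using assms by (auto simp: W_def a_def b_def)
  have half: "1 / (\<epsilon> * L * (\<alpha> / 2)) = 2 * a" by (simp add: a_def)
  have "2 * a + b \<le> 4 * (a + b)" using nonneg unfolding distrib_left by linarith
  then have "W * (2 * a + b) \<le> W * (4 * (a + b))" using nonneg(1) by (rule mult_left_mono)
  also have "\<dots> = 4 * (W * (a + b))" by (rule mult.left_commute)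
  finally have "W * (2 * a + b) \<le> 4 * (W * (a + b))" .
  moreover have "(real d)\<^sup>2 * ((Rmax + r)\<^sup>2 / (Rmin\<^sup>2 * (\<alpha> / 2)\<^sup>2 * L\<^sup>2))
    = 4 * ((real d)\<^sup>2 * ((Rmax + r)\<^sup>2 / (Rmin\<^sup>2 * \<alpha>\<^sup>2 * L\<^sup>2)))"
    by (simp add: power_divide)
  ultimately show ?thesis
    unfolding main_rate_def half a_def[symmetric] b_def[symmetric] W_def[symmetric] distrib_left[of 4]
    by linarith
qed

lemma polylog_half_le:
  assumes "0 < \<alpha>"
  shows "polylog 1 [a, b, c, e, f, g, \<alpha> / 2] \<le> 2 * polylog 1 [a, b, c, e, f, g, \<alpha>]"
proof -
  have "\<bar>ln (\<alpha> / 2)\<bar> \<le> \<bar>ln \<alpha>\<bar> + 1"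
  proof -
    have "ln (\<alpha> / 2) = ln \<alpha> - ln 2" using assms by (simp add: ln_div)
    moreover have "0 < ln (2::real)" by simp
    ultimately show ?thesis using ln_2_less_1 by linarith
  qed
  then have last: "1 + \<bar>ln (\<alpha> / 2)\<bar> \<le> 2 * (1 + \<bar>ln \<alpha>\<bar>)"
    using abs_ge_zero[of "ln \<alpha>"] unfolding distrib_left by linarith
  have eq: "polylog 1 [a, b, c, e, f, g, p] =
    (1 + \<bar>ln a\<bar>) * (1 + \<bar>ln b\<bar>) * (1 + \<bar>ln c\<bar>) * (1 + \<bar>ln e\<bar>) * (1 + \<bar>ln f\<bar>) * (1 + \<bar>ln g\<bar>) * (1 + \<bar>ln p\<bar>)" for p
    by (simp add: polylog_def)
  define W where "W = (1 + \<bar>ln a\<bar>) * (1 + \<bar>ln b\<bar>) * (1 + \<bar>ln c\<bar>) * (1 + \<bar>ln e\<bar>) * (1 + \<bar>ln f\<bar>) * (1 + \<bar>ln g\<bar>)"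
  have "0 \<le> W" by (simp add: W_def)
  with last have "W * (1 + \<bar>ln (\<alpha> / 2)\<bar>) \<le> W * (2 * (1 + \<bar>ln \<alpha>\<bar>))" by (rule mult_left_mono)
  also have "\<dots> = 2 * (W * (1 + \<bar>ln \<alpha>\<bar>))" by (rule mult.left_commute)
  finally show ?thesis unfolding eq W_def[symmetric] .
qed

lemma constant_mechanism_private:
  assumes "0 < \<epsilon>"
  shows "diff_private \<epsilon> d n (\<lambda>_. return (euclid d) (\<lambda>i\<in>{..<d}. 0))"
proof -
  have "return (euclid d) (\<lambda>i\<in>{..<d}. 0) \<in> space (prob_algebra (euclid d))"
    by (simp add: space_prob_algebra prob_space_return space_euclid)
  moreover have "x \<le> exp (\<epsilon> * real k) * x" if "0 \<le> x" for x :: real and k :: nat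
    using mult_right_mono[of 1 "exp (\<epsilon> * real k)" x] that assms by simp
  ultimately show ?thesis unfolding diff_private_def by auto
qed

lemma main_rate_ge_1:
  assumes "0 < d" "0 < \<epsilon>" "0 < Rmax" "0 < Rmin" "0 < r" "0 < L" "0 < \<alpha>" "Rmin \<le> Rmax" "\<alpha> * L \<le> 1"
  shows "1 \<le> main_rate d \<epsilon> Rmax Rmin r L \<alpha>"
proof -
  have "Rmin\<^sup>2 * \<alpha>\<^sup>2 * L\<^sup>2 = (Rmin * (\<alpha> * L))\<^sup>2" by (simp add: power_mult_distrib)
  also have "\<dots> \<le> (Rmax + r)\<^sup>2"
  proof (rule power_mono)
    have "Rmin * (\<alpha> * L) \<le> Rmin * 1" using assms by (intro mult_left_mono) auto
    then show "Rmin * (\<alpha> * L) \<le> Rmax + r" using assms by linarith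
  qed (use assms in auto)
  finally have "1 \<le> (Rmax + r)\<^sup>2 / (Rmin\<^sup>2 * \<alpha>\<^sup>2 * L\<^sup>2)" using assms by simp
  then have "1 * 1 \<le> (real d)\<^sup>2 * ((Rmax + r)\<^sup>2 / (Rmin\<^sup>2 * \<alpha>\<^sup>2 * L\<^sup>2))"
    using assms(1) by (intro mult_mono) auto
  moreover have "0 \<le> real d powr 2.5 * ((Rmax + r) / Rmin) * (1 / (\<epsilon> * L * \<alpha>) + 1 / (\<epsilon> * L * min r Rmin))"
    using assms by (intro mult_nonneg_nonneg add_nonneg_nonneg) auto
  ultimately show ?thesis unfolding main_rate_def by simp
qed

lemma main_rate_ge_inverse:
  assumes "0 < \<epsilon>" "0 < Rmax" "0 < Rmin" "0 < r" "0 < L" "0 < \<alpha>"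
  shows "real d powr 2.5 * ((Rmax + r) / Rmin) * (1 / (\<epsilon> * L)) / \<alpha> \<le> main_rate d \<epsilon> Rmax Rmin r L \<alpha>"
proof -
  have "real d powr 2.5 * ((Rmax + r) / Rmin) * (1 / (\<epsilon> * L * \<alpha>) + 0)
    \<le> real d powr 2.5 * ((Rmax + r) / Rmin) * (1 / (\<epsilon> * L * \<alpha>) + 1 / (\<epsilon> * L * min r Rmin))"
    using assms by (intro mult_left_mono add_left_mono) auto
  moreover have "0 \<le> (real d)\<^sup>2 * ((Rmax + r)\<^sup>2 / (Rmin\<^sup>2 * \<alpha>\<^sup>2 * L\<^sup>2))" by simp
  moreover have "real d powr 2.5 * ((Rmax + r) / Rmin) * (1 / (\<epsilon> * L)) / \<alpha>
    = real d powr 2.5 * ((Rmax + r) / Rmin) * (1 / (\<epsilon> * L * \<alpha>) + 0)" by simp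
  ultimately show ?thesis unfolding main_rate_def by linarith
qed

theorem corollary14:
  fixes \<sigma> :: "nat \<Rightarrow> (nat \<Rightarrow> real) measure"
    and P :: "real poly" and \<eta> :: "nat \<Rightarrow> real"
  assumes haar: "\<And>d. 0 < d \<Longrightarrow> sphere_haar d (\<sigma> d)"
    and whp: "\<eta> \<longlonglongrightarrow> 0"
  shows "\<exists>(C::real) (k::nat). \<forall>(d::nat) (q::real) (\<epsilon>::real) (Rmax::real) (Rmin::real) (r::real) (L::real).
     0 < d \<longrightarrow> 1/2 < q \<longrightarrow> q < 1 \<longrightarrow> 0 < \<epsilon> \<longrightarrow>
     0 < Rmax \<longrightarrow> 0 < Rmin \<longrightarrow> 0 < r \<longrightarrow> 0 < L \<longrightarrow> (d = 1 \<longrightarrow> Rmin \<le> Rmax) \<longrightarrow>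
     (\<exists>(A :: nat \<Rightarrow> (nat \<Rightarrow> nat \<Rightarrow> real) \<Rightarrow> (nat \<Rightarrow> real) measure) (N :: real \<Rightarrow> nat).
        (\<forall>n. diff_private \<epsilon> d n (A n)) \<and>
        (\<forall>D\<in>admissible P \<eta> d q Rmax Rmin r L. \<forall>\<alpha>. 0 < \<alpha> \<and> \<alpha> < min r Rmin / 2 \<longrightarrow>
           0 < N \<alpha> \<and>
           real (N \<alpha>) \<le> C * main_rate d \<epsilon> Rmax Rmin r L \<alpha> * polylog k [real d, Rmax, Rmin, r, L, \<epsilon>, \<alpha>] \<and>
           0.9 \<le> success_prob d (N \<alpha>) (A (N \<alpha>)) D (steiner_point d (\<sigma> d) (floating_body d q D)) \<alpha>))"
proof -
  obtain C :: real where C: "1 \<le> C" and mech: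
    "\<And>d q \<epsilon> Rmax Rmin r L \<alpha> n. 0 < d \<Longrightarrow> 1/2 < q \<Longrightarrow> q < 1 \<Longrightarrow> 0 < \<epsilon> \<Longrightarrow> 0 < Rmax \<Longrightarrow> 0 < Rmin \<Longrightarrow>
      0 < r \<Longrightarrow> 0 < L \<Longrightarrow> (d = 1 \<Longrightarrow> Rmin \<le> Rmax) \<Longrightarrow> 0 < \<alpha> \<Longrightarrow> \<alpha> \<le> r \<Longrightarrow>
      admissible P \<eta> d q Rmax Rmin r L \<noteq> {} \<Longrightarrow> 0 < n \<Longrightarrow>
      C * main_rate d \<epsilon> Rmax Rmin r L \<alpha> * polylog 1 [real d, Rmax, Rmin, r, L, \<epsilon>, \<alpha>] \<le> real n \<Longrightarrow>
      \<exists>A. diff_private \<epsilon> d n A \<and> (\<forall>D\<in>admissible P \<eta> d q Rmax Rmin r L.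
        0.9 \<le> success_prob d n A D (steiner_point d (\<sigma> d) (floating_body d q D)) \<alpha>)"
    using private_steiner_rate[OF haar whp, of P] by metis
  show ?thesis
  proof (intro exI[of _ "16 * C"] exI[of _ "1::nat"] allI impI)
    fix d :: nat and q \<epsilon> Rmax Rmin r L :: real
    assume q: "1/2 < q" "q < 1" and \<epsilon>: "0 < \<epsilon>" and pos: "0 < d" "0 < Rmax" "0 < Rmin" "0 < r" "0 < L"
      and R: "d = 1 \<longrightarrow> Rmin \<le> Rmax"
    let ?\<A> = "admissible P \<eta> d q Rmax Rmin r L"
    \<comment> \<open>The algorithm is told only the sample size \<open>n\<close>, and must serve all accuracies \<open>\<alpha>\<close> with \<open>N \<alpha> = n\<close>.
      The sample size is therefore chosen for accuracy \<open>\<alpha> / 2\<close>: if \<open>\<beta>\<close> is one of these accuracies, less than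
      twice their infimum, then accuracy \<open>\<beta> / 2\<close> is good enough for each of them.\<close>
    define f where "f \<alpha> = C * main_rate d \<epsilon> Rmax Rmin r L (\<alpha> / 2) * polylog 1 [real d, Rmax, Rmin, r, L, \<epsilon>, \<alpha> / 2]" for \<alpha>
    define N where "N \<alpha> = nat \<lceil>f \<alpha>\<rceil>" for \<alpha>
    define E where "E n = {\<alpha>. 0 < \<alpha> \<and> \<alpha> < min r Rmin / 2 \<and> N \<alpha> = n}" for n
    define S where "S D = steiner_point d (\<sigma> d) (floating_body d q D)" for D
    have law: "admissible_law P \<eta> d q Rmax Rmin r L D" if "D \<in> ?\<A>" for D
      using that q pos by unfold_locales
    have f_ge: "main_rate d \<epsilon> Rmax Rmin r L (\<alpha> / 2) \<le> f \<alpha>" if "0 < \<alpha>" for \<alpha>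
    proof -
      have "0 \<le> main_rate d \<epsilon> Rmax Rmin r L (\<alpha> / 2)"
        unfolding main_rate_def using pos \<epsilon> that by (intro add_nonneg_nonneg mult_nonneg_nonneg) auto
      then have "1 * main_rate d \<epsilon> Rmax Rmin r L (\<alpha> / 2) * 1 \<le> f \<alpha>"
        unfolding f_def using C polylog_1_ge_1 by (intro mult_mono) auto
      then show ?thesis by simp
    qed
    have "\<exists>A. diff_private \<epsilon> d n A \<and> (\<forall>D\<in>?\<A>. \<forall>\<alpha>\<in>E n. 0.9 \<le> success_prob d n A D (S D) \<alpha>)" for n
    proof (cases "?\<A> = {} \<or> E n = {} \<or> n = 0")
      case True
      have "f \<alpha> > 0" if "0 < \<alpha>" for \<alpha>
      proof -
        have "0 < real d powr 2.5 * ((Rmax + r) / Rmin) * (1 / (\<epsilon> * L)) / (\<alpha> / 2)" using pos \<epsilon> that by auto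
        then show ?thesis using main_rate_ge_inverse[of \<epsilon> Rmax Rmin r L "\<alpha> / 2" d] f_ge[OF that] pos \<epsilon> that by linarith
      qed
      then have "E 0 = {}" by (force simp: E_def N_def)
      then show ?thesis using True constant_mechanism_private[OF \<epsilon>, of d n] by blast
    next
      case False
      \<comment> \<open>The infimum is positive because the rate grows at least like \<open>\<kappa> / \<alpha>\<close>.\<close>
      define \<kappa> where "\<kappa> = 2 * (real d powr 2.5 * ((Rmax + r) / Rmin) * (1 / (\<epsilon> * L)))"
      have \<kappa>: "0 < \<kappa>" using pos \<epsilon> by (simp add: \<kappa>_def)
      have lower: "\<kappa> / real n \<le> \<alpha>" if "\<alpha> \<in> E n" for \<alpha>
      proof -
        have \<alpha>: "0 < \<alpha>" "N \<alpha> = n" using that by (auto simp: E_def)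
        have "\<kappa> / \<alpha> \<le> main_rate d \<epsilon> Rmax Rmin r L (\<alpha> / 2)"
          using main_rate_ge_inverse[of \<epsilon> Rmax Rmin r L "\<alpha> / 2" d] pos \<epsilon> \<alpha> by (simp add: \<kappa>_def mult_ac)
        also have "\<dots> \<le> f \<alpha>" by (rule f_ge[OF \<alpha>(1)])
        also have "\<dots> \<le> real n" using \<alpha>(2) unfolding N_def by linarith
        finally show ?thesis using \<alpha> False by (simp add: field_simps)
      qed
      then have bdd: "bdd_below (E n)" by (intro bdd_belowI[of _ "\<kappa> / real n"])
      have "\<kappa> / real n \<le> Inf (E n)" using lower False by (intro cInf_greatest) auto
      moreover have "0 < \<kappa> / real n" using \<kappa> False by simp
      ultimately have "Inf (E n) < 2 * Inf (E n)" by linarith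
      then obtain \<beta> where \<beta>: "\<beta> \<in> E n" "\<beta> < 2 * Inf (E n)"
        using cInf_lessD[of "E n" "2 * Inf (E n)"] False by blast
      have "\<exists>A. diff_private \<epsilon> d n A \<and> (\<forall>D\<in>?\<A>. 0.9 \<le> success_prob d n A D (S D) (\<beta> / 2))"
        unfolding S_def
      proof (rule mech)
        show "C * main_rate d \<epsilon> Rmax Rmin r L (\<beta> / 2) * polylog 1 [real d, Rmax, Rmin, r, L, \<epsilon>, \<beta> / 2] \<le> real n"
          using \<beta>(1) unfolding E_def N_def f_def[symmetric] by auto linarith
      qed (use q \<epsilon> pos R False \<beta>(1) in \<open>auto simp: E_def\<close>)
      then obtain A where A: "diff_private \<epsilon> d n A"
        "\<And>D. D \<in> ?\<A> \<Longrightarrow> 0.9 \<le> success_prob d n A D (S D) (\<beta> / 2)" by blast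
      have "0.9 \<le> success_prob d n A D (S D) \<alpha>" if "D \<in> ?\<A>" "\<alpha> \<in> E n" for D \<alpha>
      proof -
        have "Inf (E n) \<le> \<alpha>" using that(2) bdd by (rule cInf_lower)
        then have "\<beta> / 2 \<le> \<alpha>" using \<beta>(2) by linarith
        then have "success_prob d n A D (S D) (\<beta> / 2) \<le> success_prob d n A D (S D) \<alpha>"
          using A(1) by (intro admissible_law.success_prob_mono[OF law[OF that(1)]]) (simp_all add: diff_private_def)
        then show ?thesis using A(2)[OF that(1)] by linarith
      qed
      then show ?thesis using A(1) by blast
    qed
    then obtain A where A: "\<And>n. diff_private \<epsilon> d n (A n)"
      "\<And>n D \<alpha>. D \<in> ?\<A> \<Longrightarrow> \<alpha> \<in> E n \<Longrightarrow> 0.9 \<le> success_prob d n (A n) D (S D) \<alpha>" by metis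
    show "\<exists>A N. (\<forall>n. diff_private \<epsilon> d n (A n)) \<and>
        (\<forall>D\<in>?\<A>. \<forall>\<alpha>. 0 < \<alpha> \<and> \<alpha> < min r Rmin / 2 \<longrightarrow>
           0 < N \<alpha> \<and>
           real (N \<alpha>) \<le> 16 * C * main_rate d \<epsilon> Rmax Rmin r L \<alpha> * polylog 1 [real d, Rmax, Rmin, r, L, \<epsilon>, \<alpha>] \<and>
           0.9 \<le> success_prob d (N \<alpha>) (A (N \<alpha>)) D (steiner_point d (\<sigma> d) (floating_body d q D)) \<alpha>)"
    proof (intro exI[of _ A] exI[of _ N] conjI allI ballI impI A(1))
      fix D \<alpha> assume D: "D \<in> ?\<A>" and "0 < \<alpha> \<and> \<alpha> < min r Rmin / 2"
      then have \<alpha>: "0 < \<alpha>" "\<alpha> < min r Rmin / 2" by auto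
      interpret admissible_law P \<eta> d q Rmax Rmin r L D by (rule law[OF D])
      have RR: "Rmin \<le> Rmax" using Rmin_le_Rmax R pos by (cases "2 \<le> d") auto
      have "\<alpha> / 2 * L \<le> r * L" using \<alpha> pos by (intro mult_right_mono) auto
      moreover have "2 * (r * L) \<le> 1" "0 \<le> r * L" using L_r_le pos by (simp_all add: mult_ac)
      ultimately have aL: "\<alpha> / 2 * L \<le> 1" by linarith
      have "1 \<le> main_rate d \<epsilon> Rmax Rmin r L (\<alpha> / 2)"
        using \<alpha> RR pos \<epsilon> aL by (intro main_rate_ge_1) auto
      then have f1: "1 \<le> f \<alpha>" using f_ge[OF \<alpha>(1)] by linarith
      then show "0 < N \<alpha>" unfolding N_def by simp
      have "f \<alpha> \<le> C * (4 * main_rate d \<epsilon> Rmax Rmin r L \<alpha>) * (2 * polylog 1 [real d, Rmax, Rmin, r, L, \<epsilon>, \<alpha>])"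
      proof -
        have "0 \<le> main_rate d \<epsilon> Rmax Rmin r L \<alpha>"
          unfolding main_rate_def using pos \<epsilon> \<alpha> by (intro add_nonneg_nonneg mult_nonneg_nonneg) auto
        moreover have "0 \<le> polylog 1 [real d, Rmax, Rmin, r, L, \<epsilon>, \<alpha> / 2]"
          using polylog_1_ge_1[of "[real d, Rmax, Rmin, r, L, \<epsilon>, \<alpha> / 2]"] by linarith
        ultimately show ?thesis
          unfolding f_def using C pos \<epsilon> \<alpha> by (intro mult_mono polylog_half_le main_rate_half_le mult_left_mono) auto
      qed
      moreover have "real (N \<alpha>) \<le> 2 * f \<alpha>" using f1 unfolding N_def by linarith
      ultimately show "real (N \<alpha>) \<le> 16 * C * main_rate d \<epsilon> Rmax Rmin r L \<alpha> * polylog 1 [real d, Rmax, Rmin, r, L, \<epsilon>, \<alpha>]"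
        by (simp add: mult_ac)
      show "0.9 \<le> success_prob d (N \<alpha>) (A (N \<alpha>)) D (steiner_point d (\<sigma> d) (floating_body d q D)) \<alpha>"
        using A(2)[OF D, of \<alpha> "N \<alpha>"] \<alpha> by (simp add: E_def S_def)
    qed
  qed
qed

end
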